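(* Let $\mathfrak{g}$ be a finite dimensional Lie algebra over $\mathbb{C}$. The category ${}^{U(\mathfrak{g})}\mathcal{M}$ of left $U(\mathfrak{g})$-comodules and the category ${}^{\mathfrak{g}}\mathrm{conil}\mathcal{M}$ of locally conilpotent left $\mathfrak{g}$-comodules are isomorphic.
   Context: $U(\mathfrak{g})$ is regarded as a coalgebra with its usual Hopf algebra structure (elements of $\mathfrak{g}$ primitive). A left $\mathfrak{g}$-comodule is a vector space $V$ with a linear map $\nabla_{\mathfrak{g}}:V\to\mathfrak{g}\otimes V$, $v\mapsto v_{[-1]}\otimes v_{[0]}$ (summation suppressed), such that $v_{[-2]}\wedge v_{[-1]}\otimes v_{[0]}=0$ in $\wedge^2\mathfrak{g}\otimes V$ for all $v$, where $v_{[-2]}\otimes v_{[-1]}\otimes v_{[0]}=v_{[-1]}\otimes\nabla_{\mathfrak{g}}(v_{[0]})$. It is locally conilpotent if for every $v\in V$ there is $n\in\mathbb{N}$ with $\nabla_{\mathfrak{g}}^n(v)=0$, where $\nabla_{\mathfrak{g}}^n:V\to\mathfrak{g}^{\otimes n}\otimes V$ is the $n$-fold iteration. In both categories the morphisms are the colinear maps, i.e. linear maps commuting with the coactions. *)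

theory Defs
  imports "HOL-Algebra.Algebraic_Closure_Type" "HOL-Library.Poly_Mapping"
begin

section \<open>Complex vector spaces and algebras\<close>

class scaleC =
  fixes scaleC :: "complex \<Rightarrow> 'a \<Rightarrow> 'a"  (infixr \<open>*\<^sub>C\<close> 75)

class complex_vector = scaleC + ab_group_add +
  assumes scaleC_add_right: "a *\<^sub>C (x + y) = a *\<^sub>C x + a *\<^sub>C y"
    and scaleC_add_left: "(a + b) *\<^sub>C x = a *\<^sub>C x + b *\<^sub>C x"
    and scaleC_scaleC: "a *\<^sub>C b *\<^sub>C x = (a * b) *\<^sub>C x"
    and scaleC_one: "1 *\<^sub>C x = x"

class complex_algebra_1 = complex_vector + ring_1 +
  assumes mult_scaleC_left: "(a *\<^sub>C x) * y = a *\<^sub>C (x * y)"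
    and mult_scaleC_right: "x * (a *\<^sub>C y) = a *\<^sub>C (x * y)"

global_interpretation complex_vector:
  vector_space "scaleC :: complex \<Rightarrow> 'a \<Rightarrow> 'a :: complex_vector"
  by unfold_locales (rule scaleC_add_right scaleC_add_left scaleC_scaleC scaleC_one)+

class complex_lie_algebra = complex_vector +
  fixes lie_bracket :: "'a \<Rightarrow> 'a \<Rightarrow> 'a"
  assumes lie_add_left: "lie_bracket (x + y) z = lie_bracket x z + lie_bracket y z"
    and lie_add_right: "lie_bracket x (y + z) = lie_bracket x y + lie_bracket x z"
    and lie_scaleC_left: "lie_bracket (a *\<^sub>C x) y = a *\<^sub>C lie_bracket x y"
    and lie_scaleC_right: "lie_bracket x (a *\<^sub>C y) = a *\<^sub>C lie_bracket x y"
    and lie_alternating: "lie_bracket x x = 0"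
    and lie_jacobi: "lie_bracket x (lie_bracket y z) + lie_bracket y (lie_bracket z x)
                       + lie_bracket z (lie_bracket x y) = 0"

instantiation complex :: complex_algebra_1
begin
definition "scaleC_complex (c::complex) (z::complex) = c * z"
instance by standard (simp_all add: scaleC_complex_def algebra_simps)
end

instantiation poly_mapping :: (type, complex_vector) complex_vector
begin
lift_definition scaleC_poly_mapping :: "complex \<Rightarrow> ('a \<Rightarrow>\<^sub>0 'b) \<Rightarrow> 'a \<Rightarrow>\<^sub>0 'b"
  is "\<lambda>c f k. c *\<^sub>C f k"
  by (erule finite_subset[rotated]) auto
instance
  by standard (transfer; simp add: fun_eq_iff scaleC_add_right scaleC_add_left scaleC_scaleC scaleC_one)+
end

lemma lookup_scaleC [simp]: "Poly_Mapping.lookup (c *\<^sub>C p) k = c *\<^sub>C Poly_Mapping.lookup p k"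
  by transfer simp

lemma scaleC_single [simp]: "c *\<^sub>C Poly_Mapping.single k a = Poly_Mapping.single k (c *\<^sub>C a)"
  by (rule poly_mapping_eqI) (simp add: lookup_single when_def)

abbreviation basis_elem :: "'k \<Rightarrow> 'k \<Rightarrow>\<^sub>0 complex"
  where "basis_elem k \<equiv> Poly_Mapping.single k 1"

definition lin_ext :: "('k \<Rightarrow> 'w::complex_vector) \<Rightarrow> ('k \<Rightarrow>\<^sub>0 complex) \<Rightarrow> 'w"
  where "lin_ext \<phi> p = (\<Sum>k\<in>Poly_Mapping.keys p. Poly_Mapping.lookup p k *\<^sub>C \<phi> k)"

lemma lin_ext_superset:
  assumes "finite S" "Poly_Mapping.keys p \<subseteq> S"
  shows "lin_ext \<phi> p = (\<Sum>k\<in>S. Poly_Mapping.lookup p k *\<^sub>C \<phi> k)"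
  unfolding lin_ext_def using assms
  by (intro sum.mono_neutral_left) (auto simp: in_keys_iff)

lemma lin_ext_add [simp]: "lin_ext \<phi> (p + q) = lin_ext \<phi> p + lin_ext \<phi> q"
proof -
  let ?S = "Poly_Mapping.keys p \<union> Poly_Mapping.keys q"
  have "lin_ext \<phi> (p + q) = (\<Sum>k\<in>?S. Poly_Mapping.lookup (p + q) k *\<^sub>C \<phi> k)"
    by (rule lin_ext_superset) (auto dest: subsetD[OF Poly_Mapping.keys_add])
  also have "\<dots> = (\<Sum>k\<in>?S. Poly_Mapping.lookup p k *\<^sub>C \<phi> k) + (\<Sum>k\<in>?S. Poly_Mapping.lookup q k *\<^sub>C \<phi> k)"
    by (simp add: lookup_add scaleC_add_left sum.distrib)
  also have "\<dots> = lin_ext \<phi> p + lin_ext \<phi> q"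
    by (subst (1 2) lin_ext_superset[symmetric]) auto
  finally show ?thesis .
qed

lemma lin_ext_zero [simp]: "lin_ext \<phi> 0 = 0"
  by (simp add: lin_ext_def)

lemma lin_ext_scaleC [simp]: "lin_ext \<phi> (c *\<^sub>C p) = c *\<^sub>C lin_ext \<phi> p"
proof -
  have "lin_ext \<phi> (c *\<^sub>C p) = (\<Sum>k\<in>Poly_Mapping.keys p. Poly_Mapping.lookup (c *\<^sub>C p) k *\<^sub>C \<phi> k)"
    by (rule lin_ext_superset) (auto simp: in_keys_iff scaleC_complex_def)
  then show ?thesis
    by (simp add: lin_ext_def complex_vector.scale_sum_right scaleC_scaleC scaleC_complex_def)
qed

lemma lin_ext_uminus [simp]: "lin_ext \<phi> (- p) = - lin_ext \<phi> p"
  using lin_ext_add[of \<phi> p "- p"] by (simp add: eq_neg_iff_add_eq_0 add.commute)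

lemma lin_ext_diff [simp]: "lin_ext \<phi> (p - q) = lin_ext \<phi> p - lin_ext \<phi> q"
  using lin_ext_add[of \<phi> p "- q"] by simp

lemma lin_ext_single [simp]: "lin_ext \<phi> (Poly_Mapping.single k a) = a *\<^sub>C \<phi> k"
  by (cases "a = 0") (auto simp: lin_ext_def)

lemma free_induct [case_names add single]:
  fixes p :: "'k \<Rightarrow>\<^sub>0 complex"
  assumes "\<And>p q. P p \<Longrightarrow> P q \<Longrightarrow> P (p + q)" "\<And>k a. P (Poly_Mapping.single k a)"
  shows "P p"
proof -
  have "p = (\<Sum>k\<in>Poly_Mapping.keys p. Poly_Mapping.single k (Poly_Mapping.lookup p k))"
    by (rule poly_mapping_eqI) (auto simp: lookup_sum lookup_single when_def in_keys_iff)
  moreover have "P (\<Sum>k\<in>S. Poly_Mapping.single k (Poly_Mapping.lookup p k))" if "finite S" for S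
    using that
  proof induction
    case empty
    show ?case using assms(2)[of undefined 0] by simp
  qed (auto intro: assms)
  ultimately show ?thesis by (metis finite_keys)
qed


section \<open>The tensor product of two vector spaces, as a type\<close>

definition tensor_null :: "('a::complex_vector \<times> 'b::complex_vector \<Rightarrow>\<^sub>0 complex) set"
  where "tensor_null = complex_vector.span
    (  {basis_elem (x + y, b) - basis_elem (x, b) - basis_elem (y, b) | x y b. True}
     \<union> {basis_elem (c *\<^sub>C x, b) - c *\<^sub>C basis_elem (x, b) | c x b. True}
     \<union> {basis_elem (a, x + y) - basis_elem (a, x) - basis_elem (a, y) | a x y. True}
     \<union> {basis_elem (a, c *\<^sub>C x) - c *\<^sub>C basis_elem (a, x) | a c x. True})"

quotient_type (overloaded) ('a, 'b) tensor = "'a::complex_vector \<times> 'b::complex_vector \<Rightarrow>\<^sub>0 complex"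
  / "\<lambda>p q. p - q \<in> tensor_null"
  morphisms rep_tensor abs_tensor
proof (rule equivpI)
  show "reflp (\<lambda>p q. p - q \<in> (tensor_null :: ('a \<times> 'b \<Rightarrow>\<^sub>0 complex) set))"
    by (simp add: reflp_def tensor_null_def complex_vector.span_zero)
  show "symp (\<lambda>p q. p - q \<in> (tensor_null :: ('a \<times> 'b \<Rightarrow>\<^sub>0 complex) set))"
  proof (rule sympI)
    fix p q :: "'a \<times> 'b \<Rightarrow>\<^sub>0 complex" assume "p - q \<in> tensor_null"
    then show "q - p \<in> tensor_null"
      unfolding tensor_null_def using complex_vector.span_neg by fastforce
  qed
  show "transp (\<lambda>p q. p - q \<in> (tensor_null :: ('a \<times> 'b \<Rightarrow>\<^sub>0 complex) set))"
  proof (rule transpI)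
    fix p q r :: "'a \<times> 'b \<Rightarrow>\<^sub>0 complex" assume "p - q \<in> tensor_null" "q - r \<in> tensor_null"
    from complex_vector.span_add[OF this[unfolded tensor_null_def]]
    show "p - r \<in> tensor_null" by (simp add: tensor_null_def)
  qed
qed

lemma tensor_null_add: "p \<in> tensor_null \<Longrightarrow> q \<in> tensor_null \<Longrightarrow> p + q \<in> tensor_null"
  unfolding tensor_null_def by (rule complex_vector.span_add)

lemma tensor_null_diff: "p \<in> tensor_null \<Longrightarrow> q \<in> tensor_null \<Longrightarrow> p - q \<in> tensor_null"
  unfolding tensor_null_def by (rule complex_vector.span_diff)

lemma tensor_null_scale: "p \<in> tensor_null \<Longrightarrow> c *\<^sub>C p \<in> tensor_null"
  unfolding tensor_null_def by (rule complex_vector.span_scale)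

lemma tensor_null_zero: "0 \<in> tensor_null"
  unfolding tensor_null_def by (rule complex_vector.span_zero)

lemma tensor_null_base:
  "basis_elem (x + y, b) - basis_elem (x, b) - basis_elem (y, b) \<in> tensor_null"
  "basis_elem (c *\<^sub>C x, b) - c *\<^sub>C basis_elem (x, b) \<in> tensor_null"
  "basis_elem (a, b + b') - basis_elem (a, b) - basis_elem (a, b') \<in> tensor_null"
  "basis_elem (a, c *\<^sub>C b) - c *\<^sub>C basis_elem (a, b) \<in> tensor_null"
  unfolding tensor_null_def by (rule complex_vector.span_base; blast)+

lemma lin_ext_tensor_null:
  assumes "\<And>x y b. \<phi> (x + y, b) - \<phi> (x, b) - \<phi> (y, b) \<in> N"
    and "\<And>c x b. \<phi> (c *\<^sub>C x, b) - c *\<^sub>C \<phi> (x, b) \<in> N"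
    and "\<And>a x y. \<phi> (a, x + y) - \<phi> (a, x) - \<phi> (a, y) \<in> N"
    and "\<And>a c x. \<phi> (a, c *\<^sub>C x) - c *\<^sub>C \<phi> (a, x) \<in> N"
    and N: "complex_vector.subspace N" and p: "p \<in> tensor_null"
  shows "lin_ext \<phi> p \<in> N"
  using p unfolding tensor_null_def
proof (induction p rule: complex_vector.span_induct)
  case base
  show ?case using N
    unfolding complex_vector.subspace_def by simp
next
  case (step p)
  then show ?case
    using assms(1-4) by (auto simp: scaleC_one simp flip: scaleC_scaleC) (auto simp: scaleC_complex_def)
qed

instantiation tensor :: (complex_vector, complex_vector) complex_vector
begin
lift_definition zero_tensor :: "('a, 'b) tensor" is 0 .
lift_definition plus_tensor :: "('a, 'b) tensor \<Rightarrow> ('a, 'b) tensor \<Rightarrow> ('a, 'b) tensor" is "(+)"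
  subgoal for p p' q q' using tensor_null_add[of "p - p'" "q - q'"] by (simp add: algebra_simps)
  done
lift_definition uminus_tensor :: "('a, 'b) tensor \<Rightarrow> ('a, 'b) tensor" is uminus
  subgoal for p q using tensor_null_diff[OF tensor_null_zero, of "p - q"] by simp
  done
lift_definition minus_tensor :: "('a, 'b) tensor \<Rightarrow> ('a, 'b) tensor \<Rightarrow> ('a, 'b) tensor" is "(-)"
  subgoal for p p' q q' using tensor_null_diff[of "p - p'" "q - q'"] by (simp add: algebra_simps)
  done
lift_definition scaleC_tensor :: "complex \<Rightarrow> ('a, 'b) tensor \<Rightarrow> ('a, 'b) tensor" is scaleC
  subgoal for c p q using tensor_null_scale[of "p - q" c] by (simp add: complex_vector.scale_right_diff_distrib)
  done
instance
  by standard (transfer; simp add: tensor_null_zero scaleC_add_right scaleC_add_left scaleC_scaleC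
      scaleC_one algebra_simps)+
end

lift_definition tensor_pure :: "'a::complex_vector \<Rightarrow> 'b::complex_vector \<Rightarrow> ('a, 'b) tensor"
  (infixr \<open>\<otimes>\<^sub>C\<close> 72)
  is "\<lambda>a b. basis_elem (a, b)" .

definition tensor_free_mult ::
  "('a::complex_algebra_1 \<times> 'b::complex_algebra_1 \<Rightarrow>\<^sub>0 complex) \<Rightarrow> ('a \<times> 'b \<Rightarrow>\<^sub>0 complex)
     \<Rightarrow> ('a \<times> 'b \<Rightarrow>\<^sub>0 complex)"
  where "tensor_free_mult p q =
    lin_ext (\<lambda>(a, b). lin_ext (\<lambda>(a', b'). basis_elem (a * a', b * b')) q) p"

lemma tensor_free_mult_simps [simp]:
  "tensor_free_mult (p + p') q = tensor_free_mult p q + tensor_free_mult p' q"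
  "tensor_free_mult (p - p') q = tensor_free_mult p q - tensor_free_mult p' q"
  "tensor_free_mult (c *\<^sub>C p) q = c *\<^sub>C tensor_free_mult p q"
  by (simp_all add: tensor_free_mult_def)

lemma tensor_free_mult_add_right [simp]:
  "tensor_free_mult p (q + q') = tensor_free_mult p q + tensor_free_mult p q'"
  by (induction p rule: free_induct) (auto simp: tensor_free_mult_def scaleC_add_right split: prod.splits)

lemma tensor_free_mult_scaleC_right [simp]:
  "tensor_free_mult p (c *\<^sub>C q) = c *\<^sub>C tensor_free_mult p q"
  by (induction p rule: free_induct)
    (auto simp: tensor_free_mult_def scaleC_add_right scaleC_scaleC mult.commute split: prod.splits)

lemma tensor_free_mult_diff_right [simp]:
  "tensor_free_mult p (q - q') = tensor_free_mult p q - tensor_free_mult p q'"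
  using tensor_free_mult_add_right[of p "q - q'" q'] by simp

lemma tensor_free_mult_single [simp]:
  "tensor_free_mult (Poly_Mapping.single (a, b) r) (Poly_Mapping.single (a', b') s)
    = Poly_Mapping.single (a * a', b * b') (r * s)"
  by (simp add: tensor_free_mult_def scaleC_complex_def)

lemma tensor_free_mult_assoc:
  "tensor_free_mult (tensor_free_mult p q) r = tensor_free_mult p (tensor_free_mult q r)"
proof (induction p rule: free_induct)
  case (single k a)
  show ?case
  proof (induction q rule: free_induct)
    case (single k' a')
    show ?case
      by (induction r rule: free_induct)
        (cases k; cases k'; auto simp: mult.assoc)+
  qed auto
qed auto

lemma tensor_free_mult_one:
  "tensor_free_mult (basis_elem (1, 1)) p = p" "tensor_free_mult p (basis_elem (1, 1)) = p"
  by (induction p rule: free_induct; auto)+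

lemma subspace_tensor_null: "complex_vector.subspace tensor_null"
  unfolding tensor_null_def by (rule complex_vector.subspace_span)

lemma basis_elem_scaleC: "Poly_Mapping.single k c = c *\<^sub>C basis_elem k"
  by (simp add: scaleC_complex_def)

lemma tensor_free_mult_null_left: "tensor_free_mult p q \<in> tensor_null" if "p \<in> tensor_null"
proof (induction q rule: free_induct)
  case (add q q') then show ?case by (simp add: tensor_null_add)
next
  case (single k r)
  obtain a b where k: "k = (a, b)" by force
  have "tensor_free_mult p (basis_elem (a, b)) \<in> tensor_null"
    unfolding tensor_free_mult_def using that
    by (rule lin_ext_tensor_null[rotated 5])
      (use tensor_null_base in \<open>auto simp: subspace_tensor_null distrib_left distrib_right
         mult_scaleC_left mult_scaleC_right scaleC_one\<close>)
  then show ?case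
    unfolding k by (subst basis_elem_scaleC) (simp only: tensor_free_mult_scaleC_right tensor_null_scale)
qed

lemma tensor_free_mult_null_right: "tensor_free_mult p q \<in> tensor_null" if "q \<in> tensor_null"
proof (induction p rule: free_induct)
  case (add p p') then show ?case by (simp add: tensor_null_add)
next
  case (single k r)
  obtain a b where k: "k = (a, b)" by force
  have "lin_ext (\<lambda>(a', b'). basis_elem (a * a', b * b')) q \<in> tensor_null"
    using that
    by (rule lin_ext_tensor_null[rotated 5])
      (use tensor_null_base in \<open>auto simp: subspace_tensor_null distrib_left distrib_right
         mult_scaleC_left mult_scaleC_right\<close>)
  then show ?case
    unfolding k by (simp add: tensor_free_mult_def tensor_null_scale)
qed

lemma ex_linear_functional:
  fixes e :: "'a::complex_vector"
  assumes "e \<noteq> 0"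
  obtains f :: "'a \<Rightarrow> complex"
  where "\<And>x y. f (x + y) = f x + f y" "\<And>c x. f (c *\<^sub>C x) = c * f x" "f e = 1"
proof -
  let ?B = "complex_vector.extend_basis {e}"
  have ind: "complex_vector.independent {e}" using assms by simp
  note B = complex_vector.independent_extend_basis[OF ind] complex_vector.span_extend_basis[OF ind]
    complex_vector.extend_basis_superset[OF ind]
  show ?thesis
    using B by (intro that[of "\<lambda>x. complex_vector.representation ?B x e"])
      (auto simp: complex_vector.representation_add complex_vector.representation_scale
        complex_vector.representation_basis)
qed

lemma tensor_pure_nonzero:
  assumes "a \<noteq> 0" "b \<noteq> 0"
  shows "basis_elem (a, b) \<notin> tensor_null"
proof
  assume *: "basis_elem (a, b) \<in> tensor_null"
  obtain f :: "'a \<Rightarrow> complex" where f: "\<And>x y. f (x + y) = f x + f y"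
    "\<And>c x. f (c *\<^sub>C x) = c * f x" "f a = 1" using ex_linear_functional[OF assms(1)] by blast
  obtain g :: "'b \<Rightarrow> complex" where g: "\<And>x y. g (x + y) = g x + g y"
    "\<And>c x. g (c *\<^sub>C x) = c * g x" "g b = 1" using ex_linear_functional[OF assms(2)] by blast
  have "lin_ext (\<lambda>(x, y). f x * g y) (basis_elem (a, b)) \<in> {0}"
    using * by (rule lin_ext_tensor_null[rotated 5])
      (auto simp: f g algebra_simps scaleC_complex_def complex_vector.subspace_def)
  then show False by (simp add: f g scaleC_complex_def)
qed

instantiation tensor :: (complex_algebra_1, complex_algebra_1) complex_algebra_1
begin
lift_definition one_tensor :: "('a, 'b) tensor" is "basis_elem (1, 1)" .
lift_definition times_tensor :: "('a, 'b) tensor \<Rightarrow> ('a, 'b) tensor \<Rightarrow> ('a, 'b) tensor"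
  is tensor_free_mult
proof -
  fix p p' q q' :: "'a \<times> 'b \<Rightarrow>\<^sub>0 complex"
  assume "p - p' \<in> tensor_null" "q - q' \<in> tensor_null"
  then have "tensor_free_mult (p - p') q + tensor_free_mult p' (q - q') \<in> tensor_null"
    by (intro tensor_null_add tensor_free_mult_null_left tensor_free_mult_null_right)
  then show "tensor_free_mult p q - tensor_free_mult p' q' \<in> tensor_null" by simp
qed
instance
proof
  fix x y z :: "('a, 'b) tensor" and c :: complex
  show "x * y * z = x * (y * z)"
    by transfer (simp add: tensor_free_mult_assoc tensor_null_zero)
  show "1 * x = x" by transfer (simp add: tensor_free_mult_one tensor_null_zero)
  show "x * 1 = x" by transfer (simp add: tensor_free_mult_one tensor_null_zero)
  show "(x + y) * z = x * z + y * z" by transfer (simp add: tensor_null_zero)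
  show "x * (y + z) = x * y + x * z" by transfer (simp add: tensor_null_zero)
  show "(c *\<^sub>C x) * y = c *\<^sub>C (x * y)" by transfer (simp add: tensor_null_zero)
  show "x * (c *\<^sub>C y) = c *\<^sub>C (x * y)" by transfer (simp add: tensor_null_zero)
  show "(0 :: ('a, 'b) tensor) \<noteq> 1"
  proof transfer
    have "basis_elem (1, 1) \<notin> (tensor_null :: ('a \<times> 'b \<Rightarrow>\<^sub>0 complex) set)"
      by (rule tensor_pure_nonzero) auto
    then show "0 - basis_elem (1, 1) \<notin> (tensor_null :: ('a \<times> 'b \<Rightarrow>\<^sub>0 complex) set)"
      using tensor_null_diff[OF tensor_null_zero, of "0 - basis_elem (1, 1)"] by auto
  qed
qed
end

lemma tensor_pure_mult: "(a \<otimes>\<^sub>C b) * (a' \<otimes>\<^sub>C b') = (a * a') \<otimes>\<^sub>C (b * b')"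
  by transfer (simp add: tensor_null_zero)

lemma tensor_pure_linear:
  "(a + a') \<otimes>\<^sub>C b = a \<otimes>\<^sub>C b + a' \<otimes>\<^sub>C b"
  "(c *\<^sub>C a) \<otimes>\<^sub>C b = c *\<^sub>C (a \<otimes>\<^sub>C b)"
  "a \<otimes>\<^sub>C (b + b') = a \<otimes>\<^sub>C b + a \<otimes>\<^sub>C b'"
  "a \<otimes>\<^sub>C (c *\<^sub>C b) = c *\<^sub>C (a \<otimes>\<^sub>C b)"
  subgoal by transfer (simp only: diff_diff_eq[symmetric] tensor_null_base)
  subgoal by transfer (simp only: diff_diff_eq[symmetric] tensor_null_base)
  subgoal by transfer (simp only: diff_diff_eq[symmetric] tensor_null_base)
  subgoal by transfer (simp only: diff_diff_eq[symmetric] tensor_null_base)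
  done

lemma tensor_pure_diff:
  "(a - a') \<otimes>\<^sub>C b = a \<otimes>\<^sub>C b - a' \<otimes>\<^sub>C b"
  "a \<otimes>\<^sub>C (b - b') = a \<otimes>\<^sub>C b - a \<otimes>\<^sub>C b'"
  using tensor_pure_linear(1)[of "a - a'" a' b] tensor_pure_linear(3)[of a "b - b'" b']
  by (simp_all add: algebra_simps)

lemma one_tensor_eq: "1 = 1 \<otimes>\<^sub>C 1"
  by transfer (simp add: tensor_null_zero)


section \<open>The exterior square\<close>

quotient_type (overloaded) 'a exterior2 = "('a::complex_vector, 'a) tensor"
  / "\<lambda>s t. s - t \<in> complex_vector.span (range (\<lambda>x. x \<otimes>\<^sub>C x))"
proof (rule equivpI)
  let ?N = "complex_vector.span (range (\<lambda>x::'a. x \<otimes>\<^sub>C x))"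
  show "reflp (\<lambda>s t. s - t \<in> ?N)"
    by (simp add: reflp_def complex_vector.span_zero)
  show "symp (\<lambda>s t. s - t \<in> ?N)"
  proof (rule sympI)
    fix s t assume "s - t \<in> ?N"
    from complex_vector.span_neg[OF this] show "t - s \<in> ?N" by simp
  qed
  show "transp (\<lambda>s t. s - t \<in> ?N)"
  proof (rule transpI)
    fix s t u assume "s - t \<in> ?N" "t - u \<in> ?N"
    from complex_vector.span_add[OF this] show "s - u \<in> ?N" by simp
  qed
qed

instantiation exterior2 :: (complex_vector) complex_vector
begin
lift_definition zero_exterior2 :: "'a exterior2" is 0 .
lift_definition plus_exterior2 :: "'a exterior2 \<Rightarrow> 'a exterior2 \<Rightarrow> 'a exterior2" is "(+)"
  subgoal for p p' q q' using complex_vector.span_add[of "p - p'" _ "q - q'"] by (simp add: algebra_simps)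
  done
lift_definition uminus_exterior2 :: "'a exterior2 \<Rightarrow> 'a exterior2" is uminus
  subgoal for p q using complex_vector.span_diff[OF complex_vector.span_zero, of "p - q"] by simp
  done
lift_definition minus_exterior2 :: "'a exterior2 \<Rightarrow> 'a exterior2 \<Rightarrow> 'a exterior2" is "(-)"
  subgoal for p p' q q' using complex_vector.span_diff[of "p - p'" _ "q - q'"] by (simp add: algebra_simps)
  done
lift_definition scaleC_exterior2 :: "complex \<Rightarrow> 'a exterior2 \<Rightarrow> 'a exterior2" is scaleC
  subgoal for c p q using complex_vector.span_scale[of "p - q" _ c] by (simp add: complex_vector.scale_right_diff_distrib)
  done
instance
  by standard (transfer; simp add: complex_vector.span_zero scaleC_add_right scaleC_add_left
      scaleC_scaleC scaleC_one algebra_simps)+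
end

lift_definition wedge :: "'a::complex_vector \<Rightarrow> 'a \<Rightarrow> 'a exterior2"
  is "\<lambda>x y. x \<otimes>\<^sub>C y" .


section \<open>The universal enveloping algebra and its coalgebra structure\<close>

datatype 'a free_monoid = Word (letters: "'a list")

instantiation free_monoid :: (type) monoid_add
begin
definition "0 = Word []"
definition "v + w = Word (letters v @ letters w)"
instance by standard (auto simp: zero_free_monoid_def plus_free_monoid_def)
end

type_synonym 'a free_algebra = "'a free_monoid \<Rightarrow>\<^sub>0 complex"

abbreviation letter :: "'a \<Rightarrow> 'a free_algebra"
  where "letter x \<equiv> basis_elem (Word [x])"

text \<open>The first two kinds of generators turn the free algebra on the underlying set of the Lie
  algebra into the tensor algebra on the underlying vector space.\<close>

inductive_set uea_ideal :: "'g::complex_lie_algebra free_algebra set" where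
  zero: "0 \<in> uea_ideal"
| add: "p \<in> uea_ideal \<Longrightarrow> q \<in> uea_ideal \<Longrightarrow> p + q \<in> uea_ideal"
| mult_left: "p \<in> uea_ideal \<Longrightarrow> q * p \<in> uea_ideal"
| mult_right: "p \<in> uea_ideal \<Longrightarrow> p * q \<in> uea_ideal"
| letter_add: "letter (x + y) - letter x - letter y \<in> uea_ideal"
| letter_scaleC: "letter (c *\<^sub>C x) - c *\<^sub>C letter x \<in> uea_ideal"
| letter_bracket: "letter x * letter y - letter y * letter x - letter (lie_bracket x y) \<in> uea_ideal"

lemma scaleC_eq_mult: "c *\<^sub>C (p :: 'a free_algebra) = Poly_Mapping.single 0 c * p"
  by (induction p rule: free_induct) (auto simp: scaleC_add_right algebra_simps mult_single scaleC_complex_def)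

lemma scaleC_eq_mult': "c *\<^sub>C (p :: 'a free_algebra) = p * Poly_Mapping.single 0 c"
  by (induction p rule: free_induct) (auto simp: scaleC_add_right algebra_simps mult_single scaleC_complex_def)

lemma uea_ideal_scaleC: "p \<in> uea_ideal \<Longrightarrow> c *\<^sub>C p \<in> uea_ideal"
  unfolding scaleC_eq_mult by (rule uea_ideal.mult_left)

lemma uea_ideal_uminus: "p \<in> uea_ideal \<Longrightarrow> - p \<in> uea_ideal"
  using uea_ideal.mult_left[of p "- 1"] by simp

lemma uea_ideal_diff: "p \<in> uea_ideal \<Longrightarrow> q \<in> uea_ideal \<Longrightarrow> p - q \<in> uea_ideal"
  using uea_ideal.add[OF _ uea_ideal_uminus, of p q] by simp

definition free_algebra_lift :: "('g \<Rightarrow> 'a::complex_algebra_1) \<Rightarrow> 'g free_algebra \<Rightarrow> 'a"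
  where "free_algebra_lift f = lin_ext (\<lambda>w. prod_list (map f (letters w)))"

lemma free_algebra_lift_simps [simp]:
  "free_algebra_lift f (p + q) = free_algebra_lift f p + free_algebra_lift f q"
  "free_algebra_lift f (p - q) = free_algebra_lift f p - free_algebra_lift f q"
  "free_algebra_lift f (c *\<^sub>C p) = c *\<^sub>C free_algebra_lift f p"
  "free_algebra_lift f 0 = 0" "free_algebra_lift f 1 = 1" "free_algebra_lift f (letter x) = f x"
  by (simp_all add: free_algebra_lift_def scaleC_one zero_free_monoid_def flip: single_one)

lemma free_algebra_lift_mult [simp]:
  "free_algebra_lift f (p * q) = free_algebra_lift f p * free_algebra_lift f q"
proof (induction p rule: free_induct)
  case (add p p') then show ?case by (simp add: distrib_right)
next
  case (single v a)
  show ?case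
  proof (induction q rule: free_induct)
    case (add q q') then show ?case by (simp add: distrib_left)
  next
    case (single w b)
    show ?case
      by (simp add: free_algebra_lift_def mult_single plus_free_monoid_def mult_scaleC_left
          mult_scaleC_right scaleC_scaleC)
  qed
qed

lemma free_algebra_lift_uea_ideal:
  assumes "\<And>x y. f (x + y) = f x + f y" "\<And>c x. f (c *\<^sub>C x) = c *\<^sub>C f x"
    and "\<And>x y. f (lie_bracket x y) = f x * f y - f y * f x"
    and "p \<in> uea_ideal"
  shows "free_algebra_lift f p = 0"
  using assms(4)
proof (induction rule: uea_ideal.induct)
  case (letter_scaleC c x)
  have "free_algebra_lift f (c *\<^sub>C letter x) = c *\<^sub>C f x"
    by (simp only: free_algebra_lift_simps)
  then show ?case by (simp add: assms del: scaleC_single)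
qed (auto simp: assms(1-3))

quotient_type (overloaded) 'g uea = "'g::complex_lie_algebra free_algebra"
  / "\<lambda>p q. p - q \<in> uea_ideal"
  morphisms rep_uea abs_uea
proof (rule equivpI)
  show "reflp (\<lambda>p q. p - q \<in> (uea_ideal :: 'g free_algebra set))"
    by (simp add: reflp_def uea_ideal.zero)
  show "symp (\<lambda>p q. p - q \<in> (uea_ideal :: 'g free_algebra set))"
  proof (rule sympI)
    fix p q :: "'g free_algebra" assume "p - q \<in> uea_ideal"
    from uea_ideal_uminus[OF this] show "q - p \<in> uea_ideal" by simp
  qed
  show "transp (\<lambda>p q. p - q \<in> (uea_ideal :: 'g free_algebra set))"
  proof (rule transpI)
    fix p q r :: "'g free_algebra" assume "p - q \<in> uea_ideal" "q - r \<in> uea_ideal"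
    from uea_ideal.add[OF this] show "p - r \<in> uea_ideal" by simp
  qed
qed

instantiation uea :: (complex_lie_algebra) complex_algebra_1
begin
lift_definition zero_uea :: "'a uea" is 0 .
lift_definition one_uea :: "'a uea" is 1 .
lift_definition plus_uea :: "'a uea \<Rightarrow> 'a uea \<Rightarrow> 'a uea" is "(+)"
  subgoal for p p' q q' using uea_ideal.add[of "p - p'" "q - q'"] by (simp add: algebra_simps)
  done
lift_definition uminus_uea :: "'a uea \<Rightarrow> 'a uea" is uminus
  subgoal for p q using uea_ideal_diff[OF uea_ideal.zero, of "p - q"] by simp
  done
lift_definition minus_uea :: "'a uea \<Rightarrow> 'a uea \<Rightarrow> 'a uea" is "(-)"
  subgoal for p p' q q' using uea_ideal_diff[of "p - p'" "q - q'"] by (simp add: algebra_simps)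
  done
lift_definition times_uea :: "'a uea \<Rightarrow> 'a uea \<Rightarrow> 'a uea" is "(*)"
proof -
  fix p p' q q' :: "'a free_algebra"
  assume "p - p' \<in> uea_ideal" "q - q' \<in> uea_ideal"
  then have "(p - p') * q + p' * (q - q') \<in> uea_ideal"
    by (intro uea_ideal.add uea_ideal.mult_left uea_ideal.mult_right)
  then show "p * q - p' * q' \<in> uea_ideal" by (simp add: algebra_simps)
qed
lift_definition scaleC_uea :: "complex \<Rightarrow> 'a uea \<Rightarrow> 'a uea" is scaleC
  subgoal for c p q using uea_ideal_scaleC[of "p - q" c] by (simp add: complex_vector.scale_right_diff_distrib)
  done
instance
proof
  show "(0 :: 'a uea) \<noteq> 1"
  proof transfer
    have "free_algebra_lift (\<lambda>_. 0 :: complex) (0 - 1 :: 'a free_algebra) \<noteq> 0"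
      by (simp del: diff_0)
    then show "0 - 1 \<notin> (uea_ideal :: 'a free_algebra set)"
      using free_algebra_lift_uea_ideal[of "\<lambda>_. 0 :: complex"] by force
  qed
next
  fix c :: complex and x y :: "'a uea"
  show "(c *\<^sub>C x) * y = c *\<^sub>C (x * y)"
    by transfer (simp add: scaleC_eq_mult mult.assoc uea_ideal.zero)
  show "x * (c *\<^sub>C y) = c *\<^sub>C (x * y)"
    by transfer (simp add: scaleC_eq_mult' mult.assoc uea_ideal.zero)
qed (transfer; simp add: uea_ideal.zero scaleC_add_right scaleC_add_left scaleC_scaleC
      scaleC_one algebra_simps)+
end

lift_definition uea_embed :: "'g::complex_lie_algebra \<Rightarrow> 'g uea" is letter .

lemma uea_embed_linear:
  "uea_embed (x + y) = uea_embed x + uea_embed y"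
  "uea_embed (c *\<^sub>C x) = c *\<^sub>C uea_embed x"
  subgoal by transfer (simp only: diff_diff_eq[symmetric] uea_ideal.letter_add)
  subgoal by transfer (rule uea_ideal.letter_scaleC)
  done

lemma uea_embed_bracket:
  "uea_embed (lie_bracket x y) = uea_embed x * uea_embed y - uea_embed y * uea_embed x"
proof transfer
  fix x y :: 'a
  show "letter (lie_bracket x y) - (letter x * letter y - letter y * letter x) \<in> uea_ideal"
    using uea_ideal_uminus[OF uea_ideal.letter_bracket[of x y]] by (simp only: minus_diff_eq)
qed

text \<open>The algebra homomorphism on the universal enveloping algebra that extends a map \<open>f\<close>; by
  \<open>free_algebra_lift_uea_ideal\<close> it is well defined when \<open>f\<close> is a homomorphism of Lie algebras
  into the commutator Lie algebra of its codomain.\<close>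

definition uea_lift :: "('g::complex_lie_algebra \<Rightarrow> 'a::complex_algebra_1) \<Rightarrow> 'g uea \<Rightarrow> 'a"
  where "uea_lift f u = free_algebra_lift f (rep_uea u)"

definition uea_comult :: "'g::complex_lie_algebra uea \<Rightarrow> ('g uea, 'g uea) tensor"
  where "uea_comult = uea_lift (\<lambda>x. uea_embed x \<otimes>\<^sub>C 1 + 1 \<otimes>\<^sub>C uea_embed x)"

definition uea_counit :: "'g::complex_lie_algebra uea \<Rightarrow> complex"
  where "uea_counit = uea_lift (\<lambda>x. 0)"

lemma uea_lift_hom:
  fixes f :: "'g::complex_lie_algebra \<Rightarrow> 'a::complex_algebra_1"
  assumes f: "\<And>x y. f (x + y) = f x + f y" "\<And>c x. f (c *\<^sub>C x) = c *\<^sub>C f x"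
    "\<And>x y. f (lie_bracket x y) = f x * f y - f y * f x"
  shows "uea_lift f (u + v) = uea_lift f u + uea_lift f v"
    and "uea_lift f (c *\<^sub>C u) = c *\<^sub>C uea_lift f u"
    and "uea_lift f (u * v) = uea_lift f u * uea_lift f v"
    and "uea_lift f 1 = 1"
    and "uea_lift f (uea_embed x) = f x"
proof -
  have eq: "uea_lift f (abs_uea p) = free_algebra_lift f p" for p
  proof -
    have "rep_uea (abs_uea p) - p \<in> uea_ideal"
      by (rule Quotient3_rep_abs[OF Quotient3_uea]) (simp add: uea_ideal.zero)
    from free_algebra_lift_uea_ideal[OF f this] show ?thesis by (simp add: uea_lift_def)
  qed
  have ex: "u = abs_uea (rep_uea u)" for u :: "'g uea"
    by (rule Quotient3_abs_rep[OF Quotient3_uea, symmetric])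
  obtain p q where [simp]: "u = abs_uea p" "v = abs_uea q" using ex[of u] ex[of v] by blast
  show "uea_lift f (u + v) = uea_lift f u + uea_lift f v" by (simp add: eq plus_uea.abs_eq)
  show "uea_lift f (c *\<^sub>C u) = c *\<^sub>C uea_lift f u" by (simp add: eq scaleC_uea.abs_eq)
  show "uea_lift f (u * v) = uea_lift f u * uea_lift f v" by (simp add: eq times_uea.abs_eq)
  show "uea_lift f 1 = 1" by (simp add: eq one_uea_def)
  show "uea_lift f (uea_embed x) = f x" by (simp add: eq uea_embed.abs_eq)
qed

lemma uea_comult_hom:
  "uea_comult (u + v) = uea_comult u + uea_comult v"
  "uea_comult (c *\<^sub>C u) = c *\<^sub>C uea_comult u"
  "uea_comult (u * v) = uea_comult u * uea_comult v"
  "uea_comult 1 = 1"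
  "uea_comult (uea_embed x) = uea_embed x \<otimes>\<^sub>C 1 + 1 \<otimes>\<^sub>C uea_embed x"
  unfolding uea_comult_def
  by (rule uea_lift_hom; simp add: uea_embed_linear uea_embed_bracket tensor_pure_linear
      tensor_pure_diff tensor_pure_mult scaleC_add_right algebra_simps)+

lemma uea_counit_hom:
  "uea_counit (u + v) = uea_counit u + uea_counit v"
  "uea_counit (c *\<^sub>C u) = c * uea_counit u"
  "uea_counit (u * v) = uea_counit u * uea_counit v"
  "uea_counit 1 = 1"
  "uea_counit (uea_embed x) = 0"
  unfolding uea_counit_def
proof -
  show "uea_lift (\<lambda>x. 0) (u + v) = uea_lift (\<lambda>x. 0) u + (uea_lift (\<lambda>x. 0) v :: complex)"
    by (rule uea_lift_hom) (simp_all add: scaleC_complex_def)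
  show "uea_lift (\<lambda>x. 0) (c *\<^sub>C u) = c * uea_lift (\<lambda>x. 0) u"
    unfolding scaleC_complex_def[symmetric] by (rule uea_lift_hom) (simp_all add: scaleC_complex_def)
  show "uea_lift (\<lambda>x. 0) (u * v) = uea_lift (\<lambda>x. 0) u * (uea_lift (\<lambda>x. 0) v :: complex)"
    by (rule uea_lift_hom) (simp_all add: scaleC_complex_def)
  show "uea_lift (\<lambda>x. 0) 1 = (1 :: complex)"
    by (rule uea_lift_hom) (simp_all add: scaleC_complex_def)
  show "uea_lift (\<lambda>x. 0) (uea_embed x) = (0 :: complex)"
    by (rule uea_lift_hom(5)[where f = "\<lambda>_. 0"]) (simp_all add: scaleC_complex_def)
qed


section \<open>Vector spaces on arbitrary carrier sets\<close>

type_synonym 'v cspace = "(complex, 'v) module"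

text \<open>Fixing the unused record fields and the values of the operations outside of the carrier
  makes a record with this property the same thing as a vector space whose underlying set is a
  set of elements of the type \<open>'v\<close>.\<close>

definition cspace :: "'v cspace \<Rightarrow> bool" where
  "cspace V \<longleftrightarrow> Module.module (ring_of_type_algebra :: complex ring) V \<and>
     monoid.mult V = undefined \<and> monoid.one V = undefined \<and>
     (\<forall>v w. v \<notin> carrier V \<or> w \<notin> carrier V \<longrightarrow> v \<oplus>\<^bsub>V\<^esub> w = undefined) \<and>
     (\<forall>c v. v \<notin> carrier V \<longrightarrow> c \<odot>\<^bsub>V\<^esub> v = undefined)"

definition clinear_map :: "'v cspace \<Rightarrow> 'w cspace \<Rightarrow> ('v \<Rightarrow> 'w) \<Rightarrow> bool" where
  "clinear_map V W f \<longleftrightarrow> f \<in> carrier V \<rightarrow> carrier W \<and>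
     (\<forall>v\<in>carrier V. \<forall>w\<in>carrier V. f (v \<oplus>\<^bsub>V\<^esub> w) = f v \<oplus>\<^bsub>W\<^esub> f w) \<and>
     (\<forall>c. \<forall>v\<in>carrier V. f (c \<odot>\<^bsub>V\<^esub> v) = c \<odot>\<^bsub>W\<^esub> f v)"


section \<open>The tensor products \<open>A\<^sup>\<otimes>\<^sup>n \<otimes> V\<close>\<close>

text \<open>\<open>A\<^sup>\<otimes>\<^sup>n \<otimes> V\<close> is the free vector space on the tuples \<open>(x\<^sub>1, \<dots>, x\<^sub>n, v)\<close>, written
  \<open>([x\<^sub>1, \<dots>, x\<^sub>n], v)\<close>, modulo multilinearity. Its elements are cosets, so that all these spaces
  have the same type.\<close>

type_synonym ('a, 'v) tens = "('a list \<times> 'v \<Rightarrow>\<^sub>0 complex) set"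

definition tens_null :: "nat \<Rightarrow> 'v cspace \<Rightarrow> ('a::complex_vector, 'v) tens" where
  "tens_null n V = complex_vector.span
    (  {basis_elem (xs @ (x + y) # ys, v) - basis_elem (xs @ x # ys, v) - basis_elem (xs @ y # ys, v)
          | xs x y ys v. length xs + length ys + 1 = n \<and> v \<in> carrier V}
     \<union> {basis_elem (xs @ (c *\<^sub>C x) # ys, v) - c *\<^sub>C basis_elem (xs @ x # ys, v)
          | xs c x ys v. length xs + length ys + 1 = n \<and> v \<in> carrier V}
     \<union> {basis_elem (xs, v \<oplus>\<^bsub>V\<^esub> w) - basis_elem (xs, v) - basis_elem (xs, w)
          | xs v w. length xs = n \<and> v \<in> carrier V \<and> w \<in> carrier V}
     \<union> {basis_elem (xs, c \<odot>\<^bsub>V\<^esub> v) - c *\<^sub>C basis_elem (xs, v)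
          | xs c v. length xs = n \<and> v \<in> carrier V})"

definition tens_coset :: "nat \<Rightarrow> 'v cspace \<Rightarrow> ('a::complex_vector list \<times> 'v \<Rightarrow>\<^sub>0 complex) \<Rightarrow> ('a, 'v) tens"
  where "tens_coset n V p = {p + z | z. z \<in> tens_null n V}"

definition tens :: "nat \<Rightarrow> 'v cspace \<Rightarrow> ('a::complex_vector, 'v) tens cspace" where
  "tens n V = \<lparr>
     carrier = {tens_coset n V p | p. Poly_Mapping.keys p \<subseteq> {xs. length xs = n} \<times> carrier V},
     monoid.mult = undefined, monoid.one = undefined,
     ring.zero = tens_null n V,
     add = (\<lambda>S T. {p + q | p q. p \<in> S \<and> q \<in> T}),
     module.smult = (\<lambda>c S. {c *\<^sub>C p + z | p z. p \<in> S \<and> z \<in> tens_null n V}) \<rparr>"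

definition tens_pure :: "nat \<Rightarrow> 'v cspace \<Rightarrow> 'a::complex_vector list \<Rightarrow> 'v \<Rightarrow> ('a, 'v) tens"
  where "tens_pure n V xs v = tens_coset n V (basis_elem (xs, v))"

definition lin_ext_into :: "'w cspace \<Rightarrow> ('k \<Rightarrow> 'w) \<Rightarrow> ('k \<Rightarrow>\<^sub>0 complex) \<Rightarrow> 'w" where
  "lin_ext_into W \<phi> p = (\<Oplus>\<^bsub>W\<^esub>k\<in>Poly_Mapping.keys p. Poly_Mapping.lookup p k \<odot>\<^bsub>W\<^esub> \<phi> k)"

text \<open>The linear map \<open>A\<^sup>\<otimes>\<^sup>n \<otimes> V \<rightarrow> W\<close> with \<open>x\<^sub>1 \<otimes> \<dots> \<otimes> x\<^sub>n \<otimes> v \<mapsto> \<phi> [x\<^sub>1, \<dots>, x\<^sub>n] v\<close>; the choice of the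
  representative does not matter when \<open>\<phi>\<close> is multilinear.\<close>

definition tens_lift ::
  "'w cspace \<Rightarrow> ('a::complex_vector list \<Rightarrow> 'v \<Rightarrow> 'w) \<Rightarrow> ('a, 'v) tens \<Rightarrow> 'w" where
  "tens_lift W \<phi> S = lin_ext_into W (\<lambda>(xs, v). \<phi> xs v) (SOME p. p \<in> S)"

definition tens_map_right ::
  "nat \<Rightarrow> 'w cspace \<Rightarrow> ('v \<Rightarrow> 'w) \<Rightarrow> ('a::complex_vector, 'v) tens \<Rightarrow> ('a, 'w) tens" where
  "tens_map_right n W f = tens_lift (tens n W) (\<lambda>xs v. tens_pure n W xs (f v))"

text \<open>The map \<open>id \<otimes> \<rho> : A\<^sup>\<otimes>\<^sup>n \<otimes> V \<rightarrow> A\<^sup>\<otimes>\<^sup>(\<^sup>n\<^sup>+\<^sup>1\<^sup>) \<otimes> V\<close> for \<open>\<rho> : V \<rightarrow> A \<otimes> V\<close>; the inner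
  \<open>tens_lift\<close> identifies \<open>A\<^sup>\<otimes>\<^sup>n \<otimes> (A \<otimes> V)\<close> with \<open>A\<^sup>\<otimes>\<^sup>(\<^sup>n\<^sup>+\<^sup>1\<^sup>) \<otimes> V\<close>.\<close>

definition id_coaction ::
  "nat \<Rightarrow> 'v cspace \<Rightarrow> ('v \<Rightarrow> ('a::complex_vector, 'v) tens) \<Rightarrow> ('a, 'v) tens \<Rightarrow> ('a, 'v) tens" where
  "id_coaction n V \<rho> = tens_lift (tens (Suc n) V)
     (\<lambda>xs v. tens_lift (tens (Suc n) V) (\<lambda>ys w. tens_pure (Suc n) V (xs @ ys) w) (\<rho> v))"

definition comult_id ::
  "('c::complex_vector \<Rightarrow> ('c, 'c) tensor) \<Rightarrow> 'v cspace \<Rightarrow> ('c, 'v) tens \<Rightarrow> ('c, 'v) tens" where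
  "comult_id \<Delta> V = tens_lift (tens 2 V)
     (\<lambda>xs v. lin_ext_into (tens 2 V) (\<lambda>(a, b). tens_pure 2 V [a, b] v) (rep_tensor (\<Delta> (hd xs))))"

definition counit_id ::
  "('c::complex_vector \<Rightarrow> complex) \<Rightarrow> 'v cspace \<Rightarrow> ('c, 'v) tens \<Rightarrow> 'v" where
  "counit_id \<epsilon> V = tens_lift V (\<lambda>xs v. \<epsilon> (hd xs) \<odot>\<^bsub>V\<^esub> v)"

definition wedge_id :: "'v cspace \<Rightarrow> ('a::complex_vector, 'v) tens \<Rightarrow> ('a exterior2, 'v) tens" where
  "wedge_id V = tens_lift (tens 1 V) (\<lambda>xs v. tens_pure 1 V [wedge (xs ! 0) (xs ! 1)] v)"


section \<open>Comodules\<close>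

text \<open>A pair of a vector space \<open>V\<close> and a map \<open>V \<rightarrow> A \<otimes> V\<close>.\<close>

type_synonym ('a, 'v) coacted = "'v cspace \<times> ('v \<Rightarrow> ('a, 'v) tens)"

definition linear_coaction :: "('a::complex_vector, 'v) coacted \<Rightarrow> bool" where
  "linear_coaction = (\<lambda>(V, \<rho>). cspace V \<and> \<rho> \<in> extensional (carrier V) \<and> clinear_map V (tens 1 V) \<rho>)"

definition coalgebra_comodule ::
  "('c::complex_vector \<Rightarrow> ('c, 'c) tensor) \<Rightarrow> ('c \<Rightarrow> complex) \<Rightarrow> ('c, 'v) coacted \<Rightarrow> bool" where
  "coalgebra_comodule \<Delta> \<epsilon> = (\<lambda>(V, \<rho>). linear_coaction (V, \<rho>) \<and>
     (\<forall>v\<in>carrier V. comult_id \<Delta> V (\<rho> v) = id_coaction 1 V \<rho> (\<rho> v)) \<and>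
     (\<forall>v\<in>carrier V. counit_id \<epsilon> V (\<rho> v) = v))"

definition lie_comodule :: "('g::complex_lie_algebra, 'v) coacted \<Rightarrow> bool" where
  "lie_comodule = (\<lambda>(V, \<delta>). linear_coaction (V, \<delta>) \<and>
     (\<forall>v\<in>carrier V. wedge_id V (id_coaction 1 V \<delta> (\<delta> v)) = \<zero>\<^bsub>tens 1 V\<^esub>))"

primrec iterated_coaction ::
  "nat \<Rightarrow> 'v cspace \<Rightarrow> ('v \<Rightarrow> ('a::complex_vector, 'v) tens) \<Rightarrow> 'v \<Rightarrow> ('a, 'v) tens" where
  "iterated_coaction 0 V \<delta> v = tens_pure 0 V [] v"
| "iterated_coaction (Suc n) V \<delta> v = id_coaction n V \<delta> (iterated_coaction n V \<delta> v)"

definition locally_conilpotent :: "('a::complex_vector, 'v) coacted \<Rightarrow> bool" where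
  "locally_conilpotent = (\<lambda>(V, \<delta>). \<forall>v\<in>carrier V. \<exists>n. iterated_coaction n V \<delta> v = \<zero>\<^bsub>tens n V\<^esub>)"

definition colinear_maps ::
  "('a::complex_vector, 'v) coacted \<Rightarrow> ('a, 'v) coacted \<Rightarrow> ('v \<Rightarrow> 'v) set" where
  "colinear_maps = (\<lambda>(V, \<rho>) (W, \<sigma>).
     {f \<in> extensional (carrier V). clinear_map V W f \<and>
        (\<forall>v\<in>carrier V. \<sigma> (f v) = tens_map_right 1 W f (\<rho> v))})"


section \<open>Categories\<close>

text \<open>\<open>Comp C A B E g f\<close> is the composite of \<open>f : A \<rightarrow> B\<close> and \<open>g : B \<rightarrow> E\<close>.\<close>

record ('o, 'm) cat =
  Obj :: "'o set"
  Hom :: "'o \<Rightarrow> 'o \<Rightarrow> 'm set"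
  Ident :: "'o \<Rightarrow> 'm"
  Comp :: "'o \<Rightarrow> 'o \<Rightarrow> 'o \<Rightarrow> 'm \<Rightarrow> 'm \<Rightarrow> 'm"

definition category :: "('o, 'm) cat \<Rightarrow> bool" where
  "category C \<longleftrightarrow>
     (\<forall>A\<in>Obj C. Ident C A \<in> Hom C A A) \<and>
     (\<forall>A\<in>Obj C. \<forall>B\<in>Obj C. \<forall>E\<in>Obj C. \<forall>f\<in>Hom C A B. \<forall>g\<in>Hom C B E. Comp C A B E g f \<in> Hom C A E) \<and>
     (\<forall>A\<in>Obj C. \<forall>B\<in>Obj C. \<forall>f\<in>Hom C A B.
        Comp C A A B f (Ident C A) = f \<and> Comp C A B B (Ident C B) f = f) \<and>
     (\<forall>W\<in>Obj C. \<forall>A\<in>Obj C. \<forall>B\<in>Obj C. \<forall>E\<in>Obj C.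
        \<forall>f\<in>Hom C W A. \<forall>g\<in>Hom C A B. \<forall>h\<in>Hom C B E.
          Comp C W B E h (Comp C W A B g f) = Comp C W A E (Comp C A B E h g) f)"

record ('o, 'm, 'p, 'q) cat_functor =
  on_obj :: "'o \<Rightarrow> 'p"
  on_hom :: "'o \<Rightarrow> 'o \<Rightarrow> 'm \<Rightarrow> 'q"

definition is_functor :: "('o, 'm) cat \<Rightarrow> ('p, 'q) cat \<Rightarrow> ('o, 'm, 'p, 'q) cat_functor \<Rightarrow> bool" where
  "is_functor C D F \<longleftrightarrow>
     (\<forall>A\<in>Obj C. on_obj F A \<in> Obj D) \<and>
     (\<forall>A\<in>Obj C. \<forall>B\<in>Obj C. \<forall>f\<in>Hom C A B. on_hom F A B f \<in> Hom D (on_obj F A) (on_obj F B)) \<and>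
     (\<forall>A\<in>Obj C. on_hom F A A (Ident C A) = Ident D (on_obj F A)) \<and>
     (\<forall>A\<in>Obj C. \<forall>B\<in>Obj C. \<forall>E\<in>Obj C. \<forall>f\<in>Hom C A B. \<forall>g\<in>Hom C B E.
        on_hom F A E (Comp C A B E g f)
          = Comp D (on_obj F A) (on_obj F B) (on_obj F E) (on_hom F B E g) (on_hom F A B f))"

definition left_inverse_functor ::
  "('o, 'm) cat \<Rightarrow> ('o, 'm, 'p, 'q) cat_functor \<Rightarrow> ('p, 'q, 'o, 'm) cat_functor \<Rightarrow> bool" where
  "left_inverse_functor C F G \<longleftrightarrow>
     (\<forall>A\<in>Obj C. on_obj G (on_obj F A) = A) \<and>
     (\<forall>A\<in>Obj C. \<forall>B\<in>Obj C. \<forall>f\<in>Hom C A B. on_hom G (on_obj F A) (on_obj F B) (on_hom F A B f) = f)"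

definition isomorphic_categories :: "('o, 'm) cat \<Rightarrow> ('p, 'q) cat \<Rightarrow> bool" where
  "isomorphic_categories C D \<longleftrightarrow> category C \<and> category D \<and>
     (\<exists>F G. is_functor C D F \<and> is_functor D C G \<and>
        left_inverse_functor C F G \<and> left_inverse_functor D G F)"

definition colinear_category ::
  "('a::complex_vector, 'v) coacted set \<Rightarrow> (('a, 'v) coacted, 'v \<Rightarrow> 'v) cat" where
  "colinear_category S = \<lparr>
     Obj = S,
     Hom = colinear_maps,
     Ident = (\<lambda>(V, \<rho>). \<lambda>v\<in>carrier V. v),
     Comp = (\<lambda>(V, \<rho>) B E g f. compose (carrier V) g f) \<rparr>"

definition uea_comodules :: "(('g::complex_lie_algebra uea, 'v) coacted, 'v \<Rightarrow> 'v) cat" where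
  "uea_comodules = colinear_category {M. coalgebra_comodule uea_comult uea_counit M}"

definition conilpotent_lie_comodules :: "(('g::complex_lie_algebra, 'v) coacted, 'v \<Rightarrow> 'v) cat" where
  "conilpotent_lie_comodules = colinear_category {M. lie_comodule M \<and> locally_conilpotent M}"

end

theory Submission
  imports Defs "HOL-Combinatorics.Multiset_Permutations"
begin

text \<open>Write \<open>U\<close> for the universal enveloping algebra of \<open>\<gg>\<close> and \<open>\<iota> : \<gg> \<rightarrow> U\<close> for the canonical map. In
characteristic zero, \<open>U\<close> is as a coalgebra the cofree conilpotent cocommutative coalgebra on \<open>\<gg>\<close>,
and comodules over it amount to locally conilpotent families of commuting operators. What is needed
of this structure is a linear map \<open>log : U \<rightarrow> \<gg>\<close> with \<open>log (\<iota> x) = x\<close> that vanishes on \<open>1\<close> and on every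
symmetrized product of at least two elements of \<open>\<gg>\<close> (\<open>uea_log\<close>, \<open>sum_uea_log_permutations\<close>). Its
existence contains the injectivity of \<open>\<iota>\<close> and is the part of the Poincare--Birkhoff--Witt theorem
that the argument rests on. It is constructed without a basis: \<open>log\<close> is defined on words
\<open>x\<^sub>1 \<dots> x\<^sub>n\<close> by recursion on \<open>n\<close>, where its values on words of length \<open>n\<close> have prescribed differences
under adjacent transpositions. Summing these differences along an insertion sort gives a consistent
answer by the Jacobi identity (\<open>sort_corr_swap\<close>); averaging over all target orders makes it independent
of the order, and subtracting the symmetrization does not affect the differences.

The other input about \<open>U\<close> is that it is spanned by the powers \<open>(\<iota> x)\<^sup>m\<close> (\<open>uea_power_induct\<close>), on which
the comultiplication is given by the binomial theorem. On powers one checks that convolution of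
functionals is commutative (\<open>conv_commute\<close>) and that, for a basis \<open>B\<close> of \<open>\<gg>\<close> with coordinate functionals
\<open>b\<^sup>*\<close>, every \<open>u \<in> U\<close> is the sum of \<open>1/n! \<cdot> (b\<^sub>1\<^sup>* \<circ> log * \<dots> * b\<^sub>n\<^sup>* \<circ> log)(u) \<cdot> b\<^sub>1 \<dots> b\<^sub>n\<close> over all words in
\<open>B\<close>, only finitely many of which contribute (\<open>conv_exp_log\<close>).

A coaction \<open>\<rho> : V \<rightarrow> A \<otimes> V\<close> is studied through the operators \<open>\<rho>\<^sub>\<xi> = (\<xi> \<otimes> id) \<circ> \<rho>\<close> for functionals
\<open>\<xi>\<close> on \<open>A\<close>. For a comodule over \<open>U\<close> one has \<open>\<rho>\<^sub>\<zeta> \<circ> \<rho>\<^sub>\<xi> = \<rho>\<^bsub>\<xi> * \<zeta>\<^esub>\<close> (\<open>act_act\<close>). A linear map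
\<open>\<delta> : V \<rightarrow> \<gg> \<otimes> V\<close> amounts to operators \<open>D\<^sub>b\<close>, \<open>b \<in> B\<close>; it is a Lie comodule iff they commute
(\<open>lie_comodule_iff\<close>), and locally conilpotent iff every vector is killed by all words of some length
in them (\<open>locally_conilpotent_iff\<close>).

The functor from comodules over \<open>U\<close> to Lie comodules sends \<open>\<rho>\<close> to \<open>(log \<otimes> id) \<circ> \<rho>\<close> and does not change
maps. Its inverse sends \<open>\<delta>\<close> to \<open>v \<mapsto> \<Sum> 1/n! \<cdot> b\<^sub>1 \<dots> b\<^sub>n \<otimes> D\<^bsub>b\<^sub>n\<^esub> \<dots> D\<^bsub>b\<^sub>1\<^esub> v\<close>, the exponential of
\<open>\<delta>\<close>. It is coassociative because a comultiplied word is the sum of its unshuffles and the \<open>D\<^sub>b\<close>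
commute (\<open>sum_words_comult\<close>). That the two constructions are mutually inverse follows from the vanishing
of \<open>log\<close> on symmetrized products (\<open>log_exp\<close>) and from the expansion of \<open>u\<close> above (\<open>exp_log\<close>).\<close>

section \<open>Linear maps\<close>

text \<open>Complex linear maps between type class vector spaces.\<close>

definition lin :: "('a::complex_vector \<Rightarrow> 'b::complex_vector) \<Rightarrow> bool" where
  "lin f \<longleftrightarrow> (\<forall>x y. f (x + y) = f x + f y) \<and> (\<forall>c x. f (c *\<^sub>C x) = c *\<^sub>C f x)"

lemma linI: "(\<And>x y. f (x + y) = f x + f y) \<Longrightarrow> (\<And>c x. f (c *\<^sub>C x) = c *\<^sub>C f x) \<Longrightarrow> lin f"
  by (auto simp: lin_def)

lemma lin_simps:
  assumes "lin f"
  shows lin_add: "f (x + y) = f x + f y" and lin_scaleC: "f (c *\<^sub>C x) = c *\<^sub>C f x" and lin_zero: "f 0 = 0"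
    and lin_diff: "f (x - y) = f x - f y" and lin_sum: "f (sum g A) = (\<Sum>a\<in>A. f (g a))"
proof -
  show add: "f (x + y) = f x + f y" for x y using assms by (simp add: lin_def)
  show "f (c *\<^sub>C x) = c *\<^sub>C f x" using assms by (simp add: lin_def)
  show zero: "f 0 = 0" using add[of 0 0] by simp
  show "f (x - y) = f x - f y" using add[of "x - y" y] by simp
  show "f (sum g A) = (\<Sum>a\<in>A. f (g a))"
    by (induction A rule: infinite_finite_induct) (auto simp: add zero)
qed

text \<open>Every subspace is the kernel of a linear map. This gives test maps that separate the elements
of a quotient, so that identities in a quotient can be checked in a type class vector space.\<close>

lemma ex_linear_kernel:
  fixes N :: "'a::complex_vector set"
  assumes N: "complex_vector.subspace N"
  shows "\<exists>P :: 'a \<Rightarrow> 'a. lin P \<and> (\<forall>x. P x = 0 \<longleftrightarrow> x \<in> N)"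
proof -
  obtain B where B: "B \<subseteq> N" "complex_vector.independent B" "N \<subseteq> complex_vector.span B"
    using complex_vector.maximal_independent_subset[of N] by blast
  define C where "C = complex_vector.extend_basis B"
  have C: "B \<subseteq> C" "complex_vector.independent C" "complex_vector.span C = UNIV"
    using complex_vector.extend_basis_superset complex_vector.independent_extend_basis
      complex_vector.span_extend_basis B(2) by (auto simp: C_def)
  interpret vector_space_pair "scaleC :: complex \<Rightarrow> 'a \<Rightarrow> 'a" "scaleC :: complex \<Rightarrow> 'a \<Rightarrow> 'a"
    by unfold_locales
  obtain P where P: "\<And>x. x \<in> C \<Longrightarrow> P x = (if x \<in> B then 0 else x)" "Vector_Spaces.linear scaleC scaleC P"
    using linear_independent_extend[OF C(2), of "\<lambda>x. if x \<in> B then 0 else x"] by blast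
  have lin: "lin P" using P(2) by (auto intro!: linI simp: linear_add linear_scale)
  have span: "complex_vector.span B = N"
    using B N by (meson complex_vector.span_minimal subset_antisym)
  have "P x = 0" if "x \<in> N" for x
    using that unfolding span[symmetric]
  proof (induction rule: complex_vector.span_induct_alt)
    case (step c x y)
    then show ?case using P(1)[of x] C(1) by (auto simp: lin_add[OF lin] lin_scaleC[OF lin])
  qed (rule lin_zero[OF lin])
  moreover have "x - P x \<in> N" for x
  proof -
    have "x \<in> complex_vector.span C" by (simp add: C(3))
    then show ?thesis
    proof (induction rule: complex_vector.span_induct_alt)
      case base
      then show ?case using N by (simp add: lin_zero[OF lin] complex_vector.subspace_0)
    next
      case (step c x y)
      have "x - P x \<in> N" using P(1)[OF step(1)] B(1) N by (auto simp: complex_vector.subspace_0)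
      then have "c *\<^sub>C (x - P x) + (y - P y) \<in> N"
        using step N by (intro complex_vector.subspace_add complex_vector.subspace_scale)
      moreover have "c *\<^sub>C (x - P x) + (y - P y) = c *\<^sub>C x + y - P (c *\<^sub>C x + y)"
        by (simp add: lin_add[OF lin] lin_scaleC[OF lin] complex_vector.scale_right_diff_distrib)
      ultimately show ?case by simp
    qed
  qed
  ultimately have "P x = 0 \<longleftrightarrow> x \<in> N" for x by (metis diff_zero)
  then show ?thesis using lin by blast
qed

section \<open>A linear projection of the enveloping algebra onto the Lie algebra\<close>

text \<open>Let \<open>L\<close> be a function on words of length \<open>n + 1\<close> with
\<open>L (u x y v) - L (u y x v) = M (u [x, y] v)\<close>. If \<open>a\<close> is moved to the right within the word \<open>u a z\<^sub>1 z\<^sub>2 \<dots>\<close>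
past all \<open>z\<^sub>i\<close> up to the first whose label is not smaller, then \<open>L\<close> decreases by \<open>move_corr M u a zs\<close>. The
natural number in front of each letter is its label.\<close>

primrec move_corr ::
  "('g::complex_lie_algebra list \<Rightarrow> 'h::complex_vector) \<Rightarrow> 'g list \<Rightarrow> nat \<times> 'g \<Rightarrow> (nat \<times> 'g) list \<Rightarrow> 'h" where
  "move_corr M u a [] = 0"
| "move_corr M u a (z # zs) = (if fst z < fst a
     then M (u @ lie_bracket (snd a) (snd z) # map snd zs) + move_corr M (u @ [snd z]) a zs else 0)"

text \<open>The amount by which such an \<open>L\<close> decreases when the labelled letters \<open>as\<close> behind the unlabelled
prefix \<open>u\<close> are sorted by insertion.\<close>

primrec sort_corr ::
  "('g::complex_lie_algebra list \<Rightarrow> 'h::complex_vector) \<Rightarrow> 'g list \<Rightarrow> (nat \<times> 'g) list \<Rightarrow> 'h" where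
  "sort_corr M u [] = 0"
| "sort_corr M u (a # as) = sort_corr M (u @ [snd a]) as + move_corr M u a (sort_key fst as)"

text \<open>Multilinearity of a function on words of length \<open>n\<close>; nothing is said about words of other lengths.\<close>

definition multilinear_words :: "nat \<Rightarrow> ('g::complex_vector list \<Rightarrow> 'h::complex_vector) \<Rightarrow> bool" where
  "multilinear_words n M \<longleftrightarrow> (\<forall>u c x y v. length u + length v + 1 = n \<longrightarrow>
     M (u @ (c *\<^sub>C x + y) # v) = c *\<^sub>C M (u @ x # v) + M (u @ y # v))"

lemma multilinear_wordsD:
  "multilinear_words n M \<Longrightarrow> length u + length v + 1 = n \<Longrightarrow>
     M (u @ (c *\<^sub>C x + y) # v) = c *\<^sub>C M (u @ x # v) + M (u @ y # v)"
  by (auto simp: multilinear_words_def)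

lemma multilinear_words_simps:
  assumes "multilinear_words n M" "length u + length v + 1 = n"
  shows multilinear_words_add: "M (u @ (x + y) # v) = M (u @ x # v) + M (u @ y # v)"
    and multilinear_words_zero: "M (u @ 0 # v) = 0"
    and multilinear_words_scaleC: "M (u @ (c *\<^sub>C x) # v) = c *\<^sub>C M (u @ x # v)"
    and multilinear_words_uminus: "M (u @ (- x) # v) = - M (u @ x # v)"
proof -
  note * = multilinear_wordsD[OF assms]
  show add: "M (u @ (x + y) # v) = M (u @ x # v) + M (u @ y # v)" for x y
    using *[of 1 x y] by (simp add: scaleC_one)
  show zero: "M (u @ 0 # v) = 0" using add[of 0 0] by simp
  show "M (u @ (c *\<^sub>C x) # v) = c *\<^sub>C M (u @ x # v)" using *[of c x 0] zero by simp
  show "M (u @ (- x) # v) = - M (u @ x # v)" using add[of x "- x"] zero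
    by (simp add: eq_neg_iff_add_eq_0 add.commute)
qed

lemma lie_bracket_anti: "lie_bracket y x = - lie_bracket x (y :: 'g::complex_lie_algebra)"
proof -
  have "lie_bracket (x + y) (x + y) = 0" by (rule lie_alternating)
  then have "lie_bracket x y + lie_bracket y x = 0"
    unfolding lie_add_left lie_add_right by (simp add: lie_alternating algebra_simps)
  then show ?thesis by (metis add.commute eq_neg_iff_add_eq_0)
qed

text \<open>The rule that relates the values of the logarithm on words of lengths \<open>n\<close> and \<open>n - 1\<close>. For
\<open>n \<le> 1\<close> there is nothing to swap.\<close>

locale bracket_rule =
  fixes n :: nat and M N :: "'g::complex_lie_algebra list \<Rightarrow> 'h::complex_vector"
  assumes M_linear: "multilinear_words n M"
    and N_linear: "multilinear_words (n - 1) N"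
    and swap: "length u + length v + 2 = n \<Longrightarrow>
      M (u @ x # y # v) - M (u @ y # x # v) = N (u @ lie_bracket x y # v)"
begin

lemma M_anti: "length u + length v + 1 = n \<Longrightarrow> M (u @ lie_bracket y x # v) = - M (u @ lie_bracket x y # v)"
  by (subst lie_bracket_anti) (rule multilinear_words_uminus[OF M_linear])

lemma move_corr_swap:
  assumes "length u + length w + length zs + 2 = n"
  shows "move_corr M (u @ x # y # w) a zs - move_corr M (u @ y # x # w) a zs
    = M (u @ lie_bracket x y # w @ snd a # map snd zs)
      - M (u @ lie_bracket x y # w @ map snd (insort_key fst a zs))"
  using assms
proof (induction zs arbitrary: w)
  case (Cons z zs)
  show ?case
  proof (cases "fst z < fst a")
    case True
    have 1: "M (u @ x # y # w @ lie_bracket (snd a) (snd z) # map snd zs)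
        - M (u @ y # x # w @ lie_bracket (snd a) (snd z) # map snd zs)
        = N (u @ lie_bracket x y # w @ lie_bracket (snd a) (snd z) # map snd zs)"
      using Cons.prems by (intro swap) simp
    have 2: "M (u @ lie_bracket x y # w @ snd a # snd z # map snd zs)
        - M (u @ lie_bracket x y # w @ snd z # snd a # map snd zs)
        = N (u @ lie_bracket x y # w @ lie_bracket (snd a) (snd z) # map snd zs)"
      using swap[of "u @ lie_bracket x y # w" "map snd zs" "snd a" "snd z"] Cons.prems by simp
    show ?thesis using True Cons.IH[of "w @ [snd z]"] Cons.prems 1 2
      by (simp add: algebra_simps)
  qed simp
qed simp

lemma sort_corr_swap_prefix:
  assumes "length u + length w + length as + 1 = n"
  shows "sort_corr M (u @ x # y # w) as - sort_corr M (u @ y # x # w) as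
    = M (u @ lie_bracket x y # w @ map snd as)
      - M (u @ lie_bracket x y # w @ map snd (sort_key fst as))"
  using assms
proof (induction as arbitrary: w)
  case (Cons a as)
  have 1: "move_corr M (u @ x # y # w) a (sort_key fst as)
    = M (u @ lie_bracket x y # w @ snd a # map snd (sort_key fst as))
      - M (u @ lie_bracket x y # w @ map snd (sort_key fst (a # as)))
      + move_corr M (u @ y # x # w) a (sort_key fst as)"
    using move_corr_swap[of u w "sort_key fst as" x y a] Cons.prems by (simp flip: diff_eq_eq)
  have 2: "sort_corr M (u @ x # y # w @ [snd a]) as = M (u @ lie_bracket x y # w @ map snd (a # as))
      - M (u @ lie_bracket x y # w @ snd a # map snd (sort_key fst as))
      + sort_corr M (u @ y # x # w @ [snd a]) as"
    using Cons.IH[of "w @ [snd a]"] Cons.prems by (simp flip: diff_eq_eq)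
  show ?case by (simp add: 1 2)
qed simp

text \<open>The consistency of the two ways to sort three letters; this is where the Jacobi identity enters.\<close>

lemma move_corr_two:
  assumes "length u + length Q + 1 = n" "fst a \<noteq> fst b"
  shows "move_corr M (u @ [snd a]) b Q + move_corr M u a (insort_key fst b Q)
     - move_corr M (u @ [snd b]) a Q - move_corr M u b (insort_key fst a Q)
     = M (u @ lie_bracket (snd a) (snd b) # map snd Q)"
  using assms(1)
proof (induction Q arbitrary: u)
  case Nil
  then show ?case using assms(2) M_anti[of u "[]" "snd a" "snd b"]
    by (cases "fst b < fst a") auto
next
  case (Cons z Q)
  obtain i x where a: "a = (i, x)" by force
  obtain j y where b: "b = (j, y)" by force
  obtain k t where z: "z = (k, t)" by force
  let ?q = "map snd Q"
  consider "i \<le> k" | "j \<le> k" | "k < i" "k < j" by linarith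
  then show ?case
  proof cases
    \<comment> \<open>Both letters pass \<open>z\<close>, so swapping them before and after they pass \<open>z\<close> has to be compared.\<close>
    case 3
    have 1: "M (u @ x # lie_bracket y t # ?q) - M (u @ lie_bracket y t # x # ?q)
        = N (u @ lie_bracket x (lie_bracket y t) # ?q)"
      using Cons.prems by (intro swap) simp
    have 2: "M (u @ lie_bracket x t # y # ?q) - M (u @ y # lie_bracket x t # ?q)
        = N (u @ lie_bracket (lie_bracket x t) y # ?q)"
      using Cons.prems by (intro swap) simp
    have 3: "M (u @ t # lie_bracket x y # ?q) - M (u @ lie_bracket x y # t # ?q)
        = N (u @ lie_bracket t (lie_bracket x y) # ?q)"
      using Cons.prems by (intro swap) simp
    have len: "length u + length ?q + 1 = n - 1" using Cons.prems by simp
    have "lie_bracket (lie_bracket x t) y = lie_bracket y (lie_bracket t x)"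
      using lie_bracket_anti[of y "lie_bracket x t"] lie_bracket_anti[of t x]
        lie_scaleC_right[of y "-1" "lie_bracket x t"] lie_bracket_anti[of "lie_bracket t x" y]
        lie_scaleC_right[of y "-1" "lie_bracket t x"]
      by (simp add: complex_vector.scale_minus_left scaleC_one)
    then have "lie_bracket x (lie_bracket y t) + lie_bracket (lie_bracket x t) y
        + lie_bracket t (lie_bracket x y) = 0"
      using lie_jacobi[of x y t] by simp
    then have 4: "N (u @ lie_bracket x (lie_bracket y t) # ?q)
        + N (u @ lie_bracket (lie_bracket x t) y # ?q) + N (u @ lie_bracket t (lie_bracket x y) # ?q) = 0"
      by (metis multilinear_words_simps(1,2)[OF N_linear len])
    have 5: "move_corr M (u @ x # t # []) b Q - move_corr M (u @ t # x # []) b Q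
      = M (u @ lie_bracket x t # [] @ snd b # ?q) - M (u @ lie_bracket x t # [] @ map snd (insort_key fst b Q))"
      using Cons.prems by (intro move_corr_swap) simp
    have 6: "move_corr M (u @ y # t # []) a Q - move_corr M (u @ t # y # []) a Q
      = M (u @ lie_bracket y t # [] @ snd a # ?q) - M (u @ lie_bracket y t # [] @ map snd (insort_key fst a Q))"
      using Cons.prems by (intro move_corr_swap) simp
    have 7: "move_corr M (u @ [t,x]) b Q + move_corr M (u @ [t]) a (insort_key fst b Q)
     - move_corr M (u @ [t,y]) a Q - move_corr M (u @ [t]) b (insort_key fst a Q)
     = M (u @ t # lie_bracket x y # map snd Q)"
      using Cons.IH[of "u @ [t]"] Cons.prems by (simp add: a b)
    have "move_corr M (u @ [snd a]) b (z # Q) + move_corr M u a (insort_key fst b (z # Q))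
     - move_corr M (u @ [snd b]) a (z # Q) - move_corr M u b (insort_key fst a (z # Q))
     = M (u @ x # lie_bracket y t # ?q) + move_corr M (u @ [x,t]) b Q
       + M (u @ lie_bracket x t # map snd (insort_key fst b Q)) + move_corr M (u @ [t]) a (insort_key fst b Q)
       - M (u @ y # lie_bracket x t # ?q) - move_corr M (u @ [y,t]) a Q
       - M (u @ lie_bracket y t # map snd (insort_key fst a Q)) - move_corr M (u @ [t]) b (insort_key fst a Q)"
      using \<open>k < i\<close> \<open>k < j\<close> by (simp add: a b z)
    also have "\<dots> = (M (u @ x # lie_bracket y t # ?q) - M (u @ lie_bracket y t # x # ?q))
       + (M (u @ lie_bracket x t # y # ?q) - M (u @ y # lie_bracket x t # ?q))
       + (M (u @ t # lie_bracket x y # ?q) - M (u @ lie_bracket x y # t # ?q)) + M (u @ lie_bracket x y # t # ?q)"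
      using 5 6 7[symmetric] by (simp add: a b algebra_simps)
    also have "\<dots> = M (u @ lie_bracket x y # t # ?q)"
      unfolding 1 2 3 4 by simp
    finally show ?thesis by (simp add: a b z)
  next
    case 1
    then show ?thesis using assms(2) M_anti[of u "map snd (z # Q)" "snd a" "snd b"] Cons.prems
      by (auto simp: a b z)
  next
    case 2
    then show ?thesis using assms(2) M_anti[of u "map snd (z # Q)" "snd a" "snd b"] Cons.prems
      by (auto simp: a b z)
  qed
qed

text \<open>Although it is computed along one particular way of sorting, \<open>sort_corr M u\<close> has the required
difference under every adjacent transposition.\<close>

lemma sort_corr_swap:
  assumes "length u + length p + length q + 1 = n" "fst a \<noteq> fst b"
  shows "sort_corr M u (p @ a # b # q) - sort_corr M u (p @ b # a # q)
    = M (u @ map snd p @ lie_bracket (snd a) (snd b) # map snd q)"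
  using assms(1)
proof (induction p arbitrary: u)
  case Nil
  let ?Q = "sort_key fst q"
  have "sort_corr M u (a # b # q) - sort_corr M u (b # a # q)
    = (sort_corr M (u @ snd a # snd b # []) q - sort_corr M (u @ snd b # snd a # []) q)
      + (move_corr M (u @ [snd a]) b ?Q + move_corr M u a (insort_key fst b ?Q)
         - move_corr M (u @ [snd b]) a ?Q - move_corr M u b (insort_key fst a ?Q))"
    by (simp add: algebra_simps)
  also have "\<dots> = M (u @ lie_bracket (snd a) (snd b) # map snd q)"
    using sort_corr_swap_prefix[of u "[]" q "snd a" "snd b"]
      move_corr_two[OF _ assms(2), of u ?Q] Nil by simp
  finally show ?case by simp
next
  case (Cons c p)
  have "sort_key fst (p @ a # b # q) = sort_key fst (p @ b # a # q)"
    by (induction p) (simp_all add: insort_key_left_comm assms(2))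
  then show ?case using Cons.IH[of "u @ [snd c]"] Cons.prems by simp
qed

end

context
  fixes n :: nat and M :: "'g::complex_lie_algebra list \<Rightarrow> 'h::complex_vector"
  assumes M: "multilinear_words n M"
begin

lemma move_corr_linear_prefix:
  assumes "length u + length w + length zs + 1 = n"
  shows "move_corr M (u @ (c *\<^sub>C x + y) # w) a zs
    = c *\<^sub>C move_corr M (u @ x # w) a zs + move_corr M (u @ y # w) a zs"
  using assms
proof (induction zs arbitrary: w)
  case (Cons z zs)
  then show ?case
    using multilinear_wordsD[OF M, of u "w @ lie_bracket (snd a) (snd z) # map snd zs" c x y]
      Cons.IH[of "w @ [snd z]"]
    by (simp add: scaleC_add_right algebra_simps)
qed simp

lemma move_corr_linear_moved:
  assumes "length u + length zs = n"
  shows "move_corr M u (k, c *\<^sub>C x + y) zs = c *\<^sub>C move_corr M u (k, x) zs + move_corr M u (k, y) zs"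
  using assms
proof (induction zs arbitrary: u)
  case (Cons z zs)
  then show ?case
    using multilinear_wordsD[OF M, of u "map snd zs"] Cons.IH[of "u @ [snd z]"]
    by (simp add: lie_add_left lie_scaleC_left scaleC_add_right algebra_simps)
qed simp

lemma move_corr_linear_passed:
  assumes "length u + length p + length q + 1 = n"
  shows "move_corr M u a (p @ (k, c *\<^sub>C x + y) # q)
    = c *\<^sub>C move_corr M u a (p @ (k, x) # q) + move_corr M u a (p @ (k, y) # q)"
  using assms
proof (induction p arbitrary: u)
  case Nil
  then show ?case
    using multilinear_wordsD[OF M, of u "map snd q"] move_corr_linear_prefix[of u "[]" q c x y a]
    by (simp add: lie_add_right lie_scaleC_right scaleC_add_right algebra_simps)
next
  case (Cons z p)
  then show ?case
    using multilinear_wordsD[OF M, of "u @ lie_bracket (snd a) (snd z) # map snd p" "map snd q" c x y]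
      Cons.IH[of "u @ [snd z]"]
    by (simp add: scaleC_add_right algebra_simps)
qed

lemma sort_corr_linear_prefix:
  assumes "length u + length w + length as = n"
  shows "sort_corr M (u @ (c *\<^sub>C x + y) # w) as
    = c *\<^sub>C sort_corr M (u @ x # w) as + sort_corr M (u @ y # w) as"
  using assms
proof (induction as arbitrary: w)
  case (Cons a as)
  then show ?case
    using move_corr_linear_prefix[of u w "sort_key fst as" c x y a] Cons.IH[of "w @ [snd a]"]
    by (simp add: scaleC_add_right algebra_simps)
qed simp

end

lemma insort_key_shape:
  "\<exists>p' q'. length p' + length q' = length (p @ q) + 1 \<and>
     (\<forall>x. insort_key fst a (p @ (k, x) # q) = p' @ (k :: 'k::linorder, x) # q')"
proof (induction p)
  case Nil
  show ?case
  proof (cases "fst a \<le> k")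
    case True then show ?thesis by (intro exI[of _ "[a]"] exI[of _ q]) simp
  next
    case False then show ?thesis by (intro exI[of _ "[]"] exI[of _ "insort_key fst a q"]) simp
  qed
next
  case (Cons z p)
  then obtain p' q' where *: "length p' + length q' = length (p @ q) + 1"
    "\<And>x. insort_key fst a (p @ (k, x) # q) = p' @ (k, x) # q'" by blast
  show ?case
  proof (cases "fst a \<le> fst z")
    case True then show ?thesis by (intro exI[of _ "a # z # p"] exI[of _ q]) simp
  next
    case False then show ?thesis using * by (intro exI[of _ "z # p'"] exI[of _ q']) simp
  qed
qed

lemma insort_key_shape_new:
  "\<exists>p' q'. length p' + length q' = length q \<and>
     (\<forall>x. insort_key fst (k :: 'k::linorder, x) q = p' @ (k, x) # q')"
proof (induction q)
  case (Cons z q)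
  then obtain p' q' where *: "length p' + length q' = length q"
    "\<And>x. insort_key fst (k, x) q = p' @ (k, x) # q'" by blast
  show ?case
  proof (cases "k \<le> fst z")
    case True then show ?thesis by (intro exI[of _ "[]"] exI[of _ "z # q"]) simp
  next
    case False then show ?thesis using * by (intro exI[of _ "z # p'"] exI[of _ q']) simp
  qed
qed simp

lemma sort_key_shape:
  "\<exists>p' q'. length p' + length q' = length (p @ q) \<and>
     (\<forall>x. sort_key fst (p @ (k :: 'k::linorder, x) # q) = p' @ (k, x) # q')"
proof (induction p)
  case Nil
  show ?case using insort_key_shape_new[of "sort_key fst q" k] by simp
next
  case (Cons z p)
  then obtain p' q' where *: "length p' + length q' = length (p @ q)"
    "\<And>x. sort_key fst (p @ (k, x) # q) = p' @ (k, x) # q'" by blast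
  from insort_key_shape[of p' q' z k] *(1) show ?case by (simp add: *(2))
qed

lemma sort_corr_linear:
  assumes M: "multilinear_words n M" and "length u + length p + length q = n"
  shows "sort_corr M u (p @ (k, c *\<^sub>C x + y) # q)
    = c *\<^sub>C sort_corr M u (p @ (k, x) # q) + sort_corr M u (p @ (k, y) # q)"
  using assms(2)
proof (induction p arbitrary: u)
  case Nil
  then show ?case
    using sort_corr_linear_prefix[OF M, of u "[]" q c x y]
      move_corr_linear_moved[OF M, of u "sort_key fst q" k c x y]
    by (simp add: scaleC_add_right algebra_simps)
next
  case (Cons z p)
  obtain p' q' where *: "length p' + length q' = length (p @ q)"
    "\<And>x. sort_key fst (p @ (k, x) # q) = p' @ (k, x) # q'" using sort_key_shape[of p q k] by blast
  show ?case
    using Cons.IH[of "u @ [snd z]"] move_corr_linear_passed[OF M, of u p' q' z k c x y] Cons.prems *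
    by (simp add: scaleC_add_right algebra_simps)
qed

text \<open>Labelling the letters of a word by a permutation prescribes an order to sort them into. The average
over all labellings does not depend on a choice of order, and swapping two letters together with their
labels only permutes the labellings.\<close>

definition label_average ::
  "nat \<Rightarrow> ('g::complex_lie_algebra list \<Rightarrow> 'h::complex_vector) \<Rightarrow> 'g list \<Rightarrow> 'h" where
  "label_average n M xs = inverse (fact n) *\<^sub>C (\<Sum>p\<in>permutations_of_set {..<n}. sort_corr M [] (zip p xs))"

text \<open>The average of \<open>T\<close> over all rearrangements of a word of length \<open>n\<close>.\<close>

definition symmetrize :: "nat \<Rightarrow> ('g list \<Rightarrow> 'h::complex_vector) \<Rightarrow> 'g list \<Rightarrow> 'h" where
  "symmetrize n T xs = inverse (fact n) *\<^sub>C (\<Sum>\<sigma> | \<sigma> permutes {..<n}. T (permute_list \<sigma> xs))"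

lemma permute_list_shape:
  assumes "\<sigma> permutes {..<length u + length v + 1}"
  shows "\<exists>u' v'. length u' + length v' = length u + length v \<and> (\<forall>x. permute_list \<sigma> (u @ x # v) = u' @ x # v')"
proof -
  let ?n = "length u + length v + 1"
  define j where "j = Hilbert_Choice.inv \<sigma> (length u)"
  have j: "j < ?n" using permutes_in_image[OF permutes_inv[OF assms], of "length u"] by (simp add: j_def)
  have \<sigma>j: "\<sigma> i = length u \<longleftrightarrow> i = j" for i
    by (metis j_def permutes_inverses[OF assms])
  define ys where "ys = permute_list \<sigma> (u @ undefined # v)"
  have len: "length ys = ?n" by (simp add: ys_def)
  have "permute_list \<sigma> (u @ x # v) = ys[j := x]" for x
  proof (rule nth_equalityI)
    fix i assume i: "i < length (permute_list \<sigma> (u @ x # v))"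
    have "\<sigma> i < ?n" using permutes_in_image[OF assms, of i] i by simp
    then show "permute_list \<sigma> (u @ x # v) ! i = ys[j := x] ! i"
      using i j \<sigma>j[of i] assms len
      by (auto simp: ys_def permute_list_nth nth_list_update nth_append nth_Cons')
  qed (simp add: len)
  then show ?thesis using j len
    by (intro exI[of _ "take j ys"] exI[of _ "drop (Suc j) ys"]) (simp add: upd_conv_take_nth_drop)
qed

lemma multilinear_symmetrize:
  assumes T: "multilinear_words n T"
  shows "multilinear_words n (symmetrize n T)"
  unfolding multilinear_words_def
proof (intro allI impI)
  fix u v :: "'a list" and c x y assume len: "length u + length v + 1 = n"
  have "T (permute_list \<sigma> (u @ (c *\<^sub>C x + y) # v))
      = c *\<^sub>C T (permute_list \<sigma> (u @ x # v)) + T (permute_list \<sigma> (u @ y # v))"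
    if "\<sigma> permutes {..<n}" for \<sigma>
    using permute_list_shape[of \<sigma> u v] that len multilinear_wordsD[OF T, of _ _ c x y] by auto
  then show "symmetrize n T (u @ (c *\<^sub>C x + y) # v) = c *\<^sub>C symmetrize n T (u @ x # v) + symmetrize n T (u @ y # v)"
    by (simp add: symmetrize_def sum.distrib scaleC_add_right mult.commute
        flip: complex_vector.scale_sum_right)
qed

lemma symmetrize_permute:
  assumes "length xs = n" "\<tau> permutes {..<n}"
  shows "symmetrize n T (permute_list \<tau> xs) = symmetrize n T xs"
proof -
  have "(\<Sum>\<sigma> | \<sigma> permutes {..<n}. T (permute_list \<sigma> (permute_list \<tau> xs)))
      = (\<Sum>\<sigma> | \<sigma> permutes {..<n}. T (permute_list (\<tau> \<circ> \<sigma>) xs))"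
    using assms by (intro sum.cong) (auto simp: permute_list_compose)
  also have "\<dots> = (\<Sum>\<sigma> | \<sigma> permutes {..<n}. T (permute_list \<sigma> xs))"
    by (rule setum_permutations_compose_left[OF assms(2), symmetric])
  finally show ?thesis by (simp add: symmetrize_def)
qed

text \<open>Subtracting the symmetrization leaves a function with vanishing symmetrization.\<close>

lemma symmetrize_symmetrize_diff:
  assumes "length xs = n"
  shows "(\<Sum>\<sigma> | \<sigma> permutes {..<n}. T (permute_list \<sigma> xs) - symmetrize n T (permute_list \<sigma> xs)) = 0"
proof -
  have "(\<Sum>\<sigma> | \<sigma> permutes {..<n}. symmetrize n T (permute_list \<sigma> xs))
      = (\<Sum>\<sigma> | \<sigma> permutes {..<n}. symmetrize n T xs)"
    using assms by (intro sum.cong) (auto simp: symmetrize_permute)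
  also have "\<dots> = fact n *\<^sub>C symmetrize n T xs"
    by (simp add: complex_vector.sum_constant_scale card_permutations)
  also have "\<dots> = (\<Sum>\<sigma> | \<sigma> permutes {..<n}. T (permute_list \<sigma> xs))"
    by (simp add: symmetrize_def scaleC_scaleC scaleC_one)
  finally show ?thesis by (simp add: sum_subtractf)
qed

lemma permute_list_transpose:
  "permute_list (Transposition.transpose (length u) (Suc (length u))) (u @ x # y # v) = u @ y # x # v"
  (is "permute_list ?\<tau> ?xs = _")
proof (rule nth_equalityI)
  have \<tau>: "?\<tau> permutes {..<length ?xs}" by (rule permutes_swap_id) auto
  fix i assume "i < length (permute_list ?\<tau> ?xs)"
  then show "permute_list ?\<tau> ?xs ! i = (u @ y # x # v) ! i"
    using permute_list_nth[OF \<tau>, of i]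
    by (auto simp: nth_append nth_Cons' transpose_def)
qed simp

context bracket_rule
begin

lemma multilinear_label_average: "multilinear_words (Suc n) (label_average (Suc n) M)"
  unfolding multilinear_words_def
proof (intro allI impI)
  fix u v :: "'g list" and c x y assume len: "length u + length v + 1 = Suc n"
  have "sort_corr M [] (zip p (u @ (c *\<^sub>C x + y) # v))
      = c *\<^sub>C sort_corr M [] (zip p (u @ x # v)) + sort_corr M [] (zip p (u @ y # v))"
    if p: "p \<in> permutations_of_set {..<Suc n}" for p
  proof -
    have lp: "length p = Suc n" using p length_finite_permutations_of_set[of p "{..<Suc n}"] by simp
    define p1 k p2 where "p1 = take (length u) p" "k = p ! length u" "p2 = drop (Suc (length u)) p"
    have "p = p1 @ k # p2" unfolding p1_k_p2_def using lp len by (intro id_take_nth_drop) simp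
    moreover have "length p1 = length u" "length p2 = length v" using lp len by (auto simp: p1_k_p2_def)
    ultimately have "zip p (u @ z # v) = zip p1 u @ (k, z) # zip p2 v" for z by simp
    then show ?thesis
      using len \<open>length p1 = length u\<close> \<open>length p2 = length v\<close> by (simp add: sort_corr_linear[OF M_linear])
  qed
  then show "label_average (Suc n) M (u @ (c *\<^sub>C x + y) # v)
      = c *\<^sub>C label_average (Suc n) M (u @ x # v) + label_average (Suc n) M (u @ y # v)"
    by (simp add: label_average_def sum.distrib scaleC_add_right mult.commute del: fact_Suc
        flip: complex_vector.scale_sum_right)
qed

lemma label_average_swap:
  assumes len: "length u + length v + 2 = Suc n"
  shows "label_average (Suc n) M (u @ x # y # v) - label_average (Suc n) M (u @ y # x # v)
    = M (u @ lie_bracket x y # v)"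
proof -
  let ?\<tau> = "Transposition.transpose (length u) (Suc (length u))"
  let ?P = "permutations_of_set {..<Suc n}"
  have \<tau>: "?\<tau> permutes {..<Suc n}" using len by (intro permutes_swap_id) auto
  have lenP: "length p = Suc n" if "p \<in> ?P" for p
    using that length_finite_permutations_of_set[of p "{..<Suc n}"] by simp
  have involution: "permute_list ?\<tau> (permute_list ?\<tau> p) = p" if p: "p \<in> ?P" for p
    using permute_list_compose[of ?\<tau> p ?\<tau>] \<tau> lenP[OF p] by simp
  have closed: "permute_list ?\<tau> p \<in> ?P" if p: "p \<in> ?P" for p
    using p \<tau> lenP[OF p] set_permute_list[of ?\<tau> p] distinct_permute_list[of ?\<tau> p]
    by (simp add: permutations_of_set_def)
  \<comment> \<open>Swap the labels along with the letters.\<close>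
  have bij: "(\<Sum>p\<in>?P. sort_corr M [] (zip p (u @ y # x # v)))
      = (\<Sum>p\<in>?P. sort_corr M [] (zip (permute_list ?\<tau> p) (u @ y # x # v)))"
    by (rule sum.reindex_bij_witness[of _ "permute_list ?\<tau>" "permute_list ?\<tau>"])
      (simp_all add: involution closed)
  have "sort_corr M [] (zip p (u @ x # y # v))
      - sort_corr M [] (zip (permute_list ?\<tau> p) (u @ y # x # v)) = M (u @ lie_bracket x y # v)"
    if p: "p \<in> ?P" for p
  proof -
    define p1 q where "p1 = take (length u) p" "q = drop (length u) p"
    have "p = p1 @ q" "length p1 = length u" "length q = length v + 2"
      using lenP[OF p] len by (auto simp: p1_q_def)
    then obtain k l p2 where pe: "p = p1 @ k # l # p2" and l2: "length p2 = length v"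
      by (auto simp: length_Suc_conv numeral_2_eq_2)
    have kl: "k \<noteq> l" using p pe by (auto simp: permutations_of_set_def)
    have "permute_list ?\<tau> p = p1 @ l # k # p2"
      unfolding pe using permute_list_transpose[of p1 k l p2] \<open>length p1 = _\<close> by simp
    then show ?thesis
      using sort_corr_swap[of "[]" "zip p1 u" "zip p2 v" "(k, x)" "(l, y)"] kl l2 \<open>length p1 = _\<close> len
      by (simp add: pe)
  qed
  then have "label_average (Suc n) M (u @ x # y # v) - label_average (Suc n) M (u @ y # x # v)
      = inverse (fact (Suc n)) *\<^sub>C (\<Sum>p\<in>?P. M (u @ lie_bracket x y # v))"
    unfolding label_average_def bij
    by (simp only: complex_vector.scale_right_diff_distrib[symmetric] sum_subtractf[symmetric] cong: sum.cong)
  also have "\<dots> = M (u @ lie_bracket x y # v)"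
    by (simp add: complex_vector.sum_constant_scale scaleC_scaleC scaleC_one del: fact_Suc)
  finally show ?thesis .
qed

text \<open>The symmetrization is invariant under transpositions, so it can be subtracted without
affecting the bracket rule.\<close>

lemma bracket_rule_Suc:
  "bracket_rule (Suc n) (\<lambda>xs. label_average (Suc n) M xs - symmetrize (Suc n) (label_average (Suc n) M) xs) M"
proof
  let ?T = "label_average (Suc n) M"
  show "multilinear_words (Suc n) (\<lambda>xs. ?T xs - symmetrize (Suc n) ?T xs)"
    using multilinear_label_average multilinear_symmetrize[OF multilinear_label_average]
    unfolding multilinear_words_def by (simp add: complex_vector.scale_right_diff_distrib)
  show "multilinear_words (Suc n - 1) M" using M_linear by simp
  fix u v :: "'g list" and x y assume len: "length u + length v + 2 = Suc n"
  have "symmetrize (Suc n) ?T (permute_list (Transposition.transpose (length u) (Suc (length u))) (u @ x # y # v))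
      = symmetrize (Suc n) ?T (u @ x # y # v)"
    using len by (intro symmetrize_permute permutes_swap_id) auto
  then have "symmetrize (Suc n) ?T (u @ y # x # v) = symmetrize (Suc n) ?T (u @ x # y # v)"
    by (simp only: permute_list_transpose)
  then show "?T (u @ x # y # v) - symmetrize (Suc n) ?T (u @ x # y # v)
     - (?T (u @ y # x # v) - symmetrize (Suc n) ?T (u @ y # x # v)) = M (u @ lie_bracket x y # v)"
    using label_average_swap[OF len] by simp
qed

end

text \<open>The logarithm on words; \<open>word_log n\<close> is only meaningful on words of length \<open>n\<close>.\<close>

primrec word_log :: "nat \<Rightarrow> 'g::complex_lie_algebra list \<Rightarrow> 'g" where
  "word_log 0 = (\<lambda>_. 0)"
| "word_log (Suc n) = (if n = 0 then hd else
     (\<lambda>xs. label_average (Suc n) (word_log n) xs - symmetrize (Suc n) (label_average (Suc n) (word_log n)) xs))"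

declare word_log.simps(2) [simp del]

lemma word_log_one: "word_log (Suc 0) = hd"
  by (simp add: word_log.simps(2))

lemma bracket_rule_word_log: "bracket_rule (Suc n) (word_log (Suc n)) (word_log n)"
proof (induction n)
  case 0
  show ?case by standard (auto simp: multilinear_words_def word_log_one)
next
  case (Suc n)
  interpret bracket_rule "Suc n" "word_log (Suc n) :: 'a list \<Rightarrow> 'a" "word_log n" by (rule Suc)
  show ?case using bracket_rule_Suc unfolding word_log.simps(2)[of "Suc n"] by simp
qed

lemma
  fixes x y :: "'a::complex_lie_algebra"
  assumes "n = length u + length v"
  shows word_log_add: "word_log (Suc n) (u @ (x + y) # v) = word_log (Suc n) (u @ x # v) + word_log (Suc n) (u @ y # v)"
    and word_log_scaleC: "word_log (Suc n) (u @ (c *\<^sub>C x) # v) = c *\<^sub>C word_log (Suc n) (u @ x # v)"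
    and word_log_swap: "word_log (Suc (Suc n)) (u @ x # y # v) - word_log (Suc (Suc n)) (u @ y # x # v)
      = word_log (Suc n) (u @ lie_bracket x y # v)"
proof -
  interpret bracket_rule "Suc (Suc n)" "word_log (Suc (Suc n)) :: 'a list \<Rightarrow> 'a" "word_log (Suc n)" by (rule bracket_rule_word_log)
  show "word_log (Suc n) (u @ (x + y) # v) = word_log (Suc n) (u @ x # v) + word_log (Suc n) (u @ y # v)"
    "word_log (Suc n) (u @ (c *\<^sub>C x) # v) = c *\<^sub>C word_log (Suc n) (u @ x # v)"
    using multilinear_words_add[OF N_linear, of u v] multilinear_words_scaleC[OF N_linear, of u v] assms by auto
  show "word_log (Suc (Suc n)) (u @ x # y # v) - word_log (Suc (Suc n)) (u @ y # x # v)
      = word_log (Suc n) (u @ lie_bracket x y # v)" using swap[of u v] assms by simp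
qed

lemma sum_word_log_permutations:
  assumes "length xs \<ge> 2"
  shows "(\<Sum>\<sigma> | \<sigma> permutes {..<length xs}. word_log (length xs) (permute_list \<sigma> xs)) = 0"
proof -
  obtain n where "length xs = Suc (Suc n)" using assms by (metis Suc_le_D numeral_2_eq_2 Suc_le_mono)
  then show ?thesis using symmetrize_symmetrize_diff[of xs "Suc (Suc n)"]
    by (simp add: word_log.simps(2)[of "Suc n"])
qed

text \<open>The linear extension of \<open>word_log\<close> to the free algebra.\<close>

definition free_log :: "'g::complex_lie_algebra free_algebra \<Rightarrow> 'g" where
  "free_log = lin_ext (\<lambda>w. word_log (length (letters w)) (letters w))"

lemma free_algebra_scaleC_left: "(c *\<^sub>C p) * q = c *\<^sub>C (p * q :: 'a free_algebra)"
  unfolding scaleC_eq_mult by (rule mult.assoc)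

lemma free_algebra_scaleC_right: "p * (c *\<^sub>C q) = c *\<^sub>C (p * q :: 'a free_algebra)"
  unfolding scaleC_eq_mult' by (rule mult.assoc[symmetric])

lemma free_log_uea_ideal:
  assumes "p \<in> uea_ideal"
  shows "free_log (a * p * b) = 0"
proof -
  \<comment> \<open>By linearity in the outer factors, words suffice there.\<close>
  have red: "free_log (a * p * b) = 0"
    if *: "\<And>u v. free_log (basis_elem (Word u) * p * basis_elem (Word v)) = 0" for p a b
  proof (induction a rule: free_induct)
    case (single w r)
    show ?case
    proof (induction b rule: free_induct)
      case (single w' s)
      have "Poly_Mapping.single w r * p * Poly_Mapping.single w' s
        = (r *\<^sub>C basis_elem w) * p * (s *\<^sub>C basis_elem w')"
        by (simp add: scaleC_complex_def)
      also have "\<dots> = r *\<^sub>C s *\<^sub>C (basis_elem (Word (letters w)) * p * basis_elem (Word (letters w')))"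
        by (simp only: free_algebra_scaleC_left free_algebra_scaleC_right free_monoid.collapse
            scaleC_scaleC mult.commute)
      finally have "free_log (Poly_Mapping.single w r * p * Poly_Mapping.single w' s)
        = r *\<^sub>C s *\<^sub>C free_log (basis_elem (Word (letters w)) * p * basis_elem (Word (letters w')))"
        by (simp only: free_log_def lin_ext_scaleC)
      then show ?case by (simp only: * complex_vector.scale_zero_right)
    qed (auto simp: distrib_left free_log_def)
  qed (auto simp: distrib_right free_log_def)
  show ?thesis using assms
  proof (induction arbitrary: a b rule: uea_ideal.induct)
    case (add p q) then show ?case by (simp add: distrib_left distrib_right free_log_def)
  next
    case (mult_left p q) from this(2)[of "a * q" b] show ?case by (simp add: mult.assoc)
  next
    case (mult_right p q) from this(2)[of a "q * b"] show ?case by (simp add: mult.assoc)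
  next
    case (letter_add x y)
    show ?case
      by (rule red) (simp add: right_diff_distrib left_diff_distrib mult_single plus_free_monoid_def
          free_log_def word_log_add scaleC_one)
  next
    case (letter_scaleC c x)
    show ?case
      by (rule red) (simp add: right_diff_distrib left_diff_distrib mult_single plus_free_monoid_def
          free_log_def word_log_scaleC scaleC_one scaleC_complex_def)
  next
    case (letter_bracket x y)
    show ?case
      by (rule red) (simp add: right_diff_distrib left_diff_distrib mult_single plus_free_monoid_def
          free_log_def word_log_swap scaleC_one)
  qed (simp add: free_log_def)
qed

text \<open>The linear projection of the enveloping algebra onto the Lie algebra. It is the logarithm of the
identity with respect to convolution, followed by the inverse of the canonical embedding.\<close>

lift_definition uea_log :: "'g::complex_lie_algebra uea \<Rightarrow> 'g" is free_log
proof -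
  fix p q :: "'g free_algebra" assume "p - q \<in> uea_ideal"
  from free_log_uea_ideal[OF this, of 1 1] show "free_log p = free_log q" by (simp add: free_log_def)
qed

lemma uea_log_add: "uea_log (u + v) = uea_log u + uea_log v"
  by transfer (simp add: free_log_def)

lemma uea_log_scaleC: "uea_log (c *\<^sub>C u) = c *\<^sub>C uea_log u"
  by transfer (simp add: free_log_def)

lemma uea_log_embed: "uea_log (uea_embed x) = x"
  by transfer (simp add: free_log_def scaleC_one word_log_one)

text \<open>The product in the enveloping algebra of the letters of a word.\<close>

definition uea_word :: "'g::complex_lie_algebra list \<Rightarrow> 'g uea" where
  "uea_word xs = prod_list (map uea_embed xs)"

lemma uea_word_simps [simp]:
  "uea_word [] = 1" "uea_word (x # xs) = uea_embed x * uea_word xs"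
  "uea_word (xs @ ys) = uea_word xs * uea_word ys"
  by (simp_all add: uea_word_def)

lemma uea_word_abs: "uea_word xs = abs_uea (basis_elem (Word xs))"
proof (induction xs)
  case Nil show ?case by (simp add: one_uea_def zero_free_monoid_def flip: single_one)
next
  case (Cons x xs)
  then show ?case
    by (simp add: uea_embed.abs_eq times_uea.abs_eq mult_single plus_free_monoid_def)
qed

lemma uea_log_word: "uea_log (uea_word xs) = word_log (length xs) xs"
  by (simp add: uea_word_abs uea_log.abs_eq free_log_def scaleC_one)

lemma sum_uea_log_permutations:
  "length xs \<ge> 2 \<Longrightarrow> (\<Sum>\<sigma> | \<sigma> permutes {..<length xs}. uea_log (uea_word (permute_list \<sigma> xs))) = 0"
  by (simp add: uea_log_word sum_word_log_permutations)

section \<open>Powers span the enveloping algebra\<close>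

text \<open>If the values of a vector valued polynomial lie in a subspace, then so do its coefficients.\<close>

lemma coefficient_in_subspace:
  assumes S: "complex_vector.subspace S"
    and "\<And>t :: complex. (\<Sum>j\<le>m. t ^ j *\<^sub>C a j) \<in> S" and "j \<le> m"
  shows "a j \<in> S"
  using assms(2,3)
proof (induction m arbitrary: a j)
  case 0
  then show ?case using "0.prems"(1)[of 1] by (simp add: scaleC_one)
next
  case (Suc m)
  \<comment> \<open>The combination \<open>P (2 t) - 2\<^sup>m\<^sup>+\<^sup>1 P t\<close> cancels the leading coefficient and rescales the others.\<close>
  have *: "(\<Sum>j\<le>m. t ^ j *\<^sub>C ((2 ^ j - 2 ^ Suc m) *\<^sub>C a j)) \<in> S" for t
  proof -
    have term_eq: "(2 * t) ^ j *\<^sub>C a j - 2 ^ Suc m *\<^sub>C t ^ j *\<^sub>C a j = t ^ j *\<^sub>C ((2 ^ j - 2 ^ Suc m) *\<^sub>C a j)" for j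
      by (simp only: scaleC_scaleC complex_vector.scale_left_diff_distrib[symmetric] right_diff_distrib
          power_mult_distrib mult.commute)
    have "(\<Sum>j\<le>m. t ^ j *\<^sub>C ((2 ^ j - 2 ^ Suc m) *\<^sub>C a j))
        = (\<Sum>j\<le>Suc m. t ^ j *\<^sub>C ((2 ^ j - 2 ^ Suc m) *\<^sub>C a j))"
      by simp
    also have "\<dots> = (\<Sum>j\<le>Suc m. (2 * t) ^ j *\<^sub>C a j) - 2 ^ Suc m *\<^sub>C (\<Sum>j\<le>Suc m. t ^ j *\<^sub>C a j)"
      by (simp only: complex_vector.scale_sum_right sum_subtractf[symmetric] term_eq)
    finally have "(\<Sum>j\<le>m. t ^ j *\<^sub>C ((2 ^ j - 2 ^ Suc m) *\<^sub>C a j))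
        = (\<Sum>j\<le>Suc m. (2 * t) ^ j *\<^sub>C a j) - 2 ^ Suc m *\<^sub>C (\<Sum>j\<le>Suc m. t ^ j *\<^sub>C a j)" .
    then show ?thesis
      using Suc.prems(1)[of "2 * t"] Suc.prems(1)[of t] S
      by (auto intro!: complex_vector.subspace_diff complex_vector.subspace_scale simp del: power_Suc sum.atMost_Suc)
  qed
  have lower: "a j \<in> S" if "j \<le> m" for j
  proof -
    have "(2 :: complex) ^ j \<noteq> 2 ^ Suc m"
    proof
      assume "(2 :: complex) ^ j = 2 ^ Suc m"
      then have "(of_nat (2 ^ j) :: complex) = of_nat (2 ^ Suc m)" by simp
      then have "(2 :: nat) ^ j = 2 ^ Suc m" by (simp only: of_nat_eq_iff)
      then show False using that by (subst (asm) power_inject_exp) auto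
    qed
    then have nz: "(2 :: complex) ^ j - 2 ^ Suc m \<noteq> 0" by simp
    have "inverse (2 ^ j - 2 ^ Suc m) *\<^sub>C ((2 ^ j - 2 ^ Suc m) *\<^sub>C a j) \<in> S"
      using Suc.IH[OF * that] S by (rule complex_vector.subspace_scale[rotated])
    then show ?thesis using nz by (simp add: scaleC_scaleC scaleC_one del: power_Suc)
  qed
  have "a (Suc m) = (\<Sum>j\<le>Suc m. 1 ^ j *\<^sub>C a j) - (\<Sum>j\<le>m. a j)"
    by (simp add: scaleC_one)
  also have "\<dots> \<in> S"
    by (rule complex_vector.subspace_diff[OF S Suc.prems(1) complex_vector.subspace_sum[OF S]])
      (simp add: lower)
  finally show ?case using lower Suc.prems(2) by (cases "j = Suc m") auto
qed

text \<open>The power of a sum as a polynomial in a scalar, without commutativity. Only its linear coefficient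
is made explicit.\<close>

lemma power_expansion:
  fixes x y :: "'a::complex_algebra_1"
  shows "\<exists>a. (\<forall>t. (x + t *\<^sub>C y) ^ m = (\<Sum>j\<le>m. t ^ j *\<^sub>C a j)) \<and> (\<forall>j>m. a j = 0) \<and> a 0 = x ^ m
    \<and> a 1 = (\<Sum>i<m. x ^ i * y * x ^ (m - 1 - i))"
proof (induction m)
  case 0
  show ?case by (intro exI[of _ "\<lambda>j. if j = 0 then 1 else 0"]) (simp add: scaleC_one)
next
  case (Suc m)
  then obtain a where a: "\<And>t. (x + t *\<^sub>C y) ^ m = (\<Sum>j\<le>m. t ^ j *\<^sub>C a j)" "\<And>j. j > m \<Longrightarrow> a j = 0"
    "a 0 = x ^ m" "a 1 = (\<Sum>i<m. x ^ i * y * x ^ (m - 1 - i))" by blast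
  define b where "b j = x * a j + (if j = 0 then 0 else y * a (j - 1))" for j
  have "(x + t *\<^sub>C y) ^ Suc m = (\<Sum>j\<le>Suc m. t ^ j *\<^sub>C b j)" for t
  proof -
    have "(x + t *\<^sub>C y) ^ Suc m = (\<Sum>j\<le>m. t ^ j *\<^sub>C (x * a j)) + (\<Sum>j\<le>m. t ^ Suc j *\<^sub>C (y * a j))"
      by (simp add: a(1) distrib_right sum_distrib_left mult_scaleC_right mult_scaleC_left
          scaleC_scaleC scaleC_add_right sum.distrib mult.commute)
    also have "(\<Sum>j\<le>m. t ^ j *\<^sub>C (x * a j)) = (\<Sum>j\<le>Suc m. t ^ j *\<^sub>C (x * a j))"
      by (simp add: a(2))
    also have "(\<Sum>j\<le>m. t ^ Suc j *\<^sub>C (y * a j)) = (\<Sum>j\<le>Suc m. t ^ j *\<^sub>C (if j = 0 then 0 else y * a (j - 1)))"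
      by (subst sum.atMost_Suc_shift) simp
    finally show ?thesis by (simp add: b_def sum.distrib scaleC_add_right)
  qed
  moreover have "b 1 = (\<Sum>i<Suc m. x ^ i * y * x ^ (Suc m - 1 - i))"
  proof -
    have "b 1 = x * a 1 + y * x ^ m" by (simp add: b_def a(3))
    also have "x * a 1 = (\<Sum>i<m. x ^ Suc i * y * x ^ (m - Suc i))"
      by (simp add: a(4)[simplified] sum_distrib_left mult.assoc)
    finally show ?thesis by (simp add: sum.lessThan_Suc_shift add.commute del: sum.lessThan_Suc)
  qed
  ultimately show ?case by (intro exI[of _ b]) (auto simp: b_def a(2,3))
qed

lemma uea_word_replicate: "uea_word (replicate m x) = uea_embed x ^ m"
  by (induction m) simp_all

abbreviation uea_powers :: "'g::complex_lie_algebra uea set" where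
  "uea_powers \<equiv> complex_vector.span (range (\<lambda>(x, m). uea_embed x ^ m))"

text \<open>Modulo products of fewer than \<open>n\<close> letters, letters commute in the enveloping algebra.\<close>

lemma uea_word_move:
  assumes S: "complex_vector.subspace S" and lower: "\<And>w. length w < n \<Longrightarrow> uea_word w \<in> S"
    and "length u + length v + length w + 1 = n"
  shows "uea_word (u @ v @ y # w) - uea_word (u @ y # v @ w) \<in> S"
  using assms(3)
proof (induction v arbitrary: u)
  case Nil
  then show ?case using S by (simp add: complex_vector.subspace_0)
next
  case (Cons z v)
  have "uea_word (u @ z # y # v @ w) - uea_word (u @ y # z # v @ w) = uea_word (u @ lie_bracket z y # v @ w)"
    by (simp add: uea_embed_bracket algebra_simps)
  then have "uea_word (u @ z # y # v @ w) - uea_word (u @ y # z # v @ w) \<in> S"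
    using lower[of "u @ lie_bracket z y # v @ w"] Cons.prems by simp
  moreover have "uea_word ((u @ [z]) @ v @ y # w) - uea_word ((u @ [z]) @ y # v @ w) \<in> S"
    using Cons.prems by (intro Cons.IH) simp
  ultimately have "(uea_word ((u @ [z]) @ v @ y # w) - uea_word ((u @ [z]) @ y # v @ w))
      + (uea_word (u @ z # y # v @ w) - uea_word (u @ y # z # v @ w)) \<in> S"
    by (intro complex_vector.subspace_add[OF S])
  then show ?case by simp
qed

text \<open>Polarization. By induction on \<open>k\<close>, all products \<open>y\<^sub>1 \<dots> y\<^sub>k x\<^sup>n\<^sup>-\<^sup>k\<close> lie in the span of the powers: the
linear coefficient in \<open>t\<close> of \<open>y\<^sub>1 \<dots> y\<^sub>k (x + t y)\<^sup>n\<^sup>-\<^sup>k\<close> is \<open>(n - k) y\<^sub>1 \<dots> y\<^sub>k y x\<^sup>n\<^sup>-\<^sup>k\<^sup>-\<^sup>1\<close> up to shorter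
products.\<close>

lemma uea_word_in_powers: "uea_word w \<in> uea_powers"
proof (induction "length w" arbitrary: w rule: less_induct)
  case less
  let ?n = "length w" and ?S = "uea_powers :: 'a uea set"
  have S: "complex_vector.subspace ?S" by (rule complex_vector.subspace_span)
  have lower: "uea_word v \<in> ?S" if "length v < ?n" for v using less that by blast
  have "uea_word ys * uea_embed x ^ (?n - k) \<in> ?S" if "k \<le> ?n" "length ys = k" for k ys x
    using that
  proof (induction k arbitrary: ys x)
    case 0
    then show ?case by (auto intro!: complex_vector.span_base)
  next
    case (Suc k)
    then obtain zs y where ys: "ys = zs @ [y]" "length zs = k"
      by (metis append_butlast_last_id length_0_conv length_append_singleton nat.distinct(1) nat.inject)
    define m where "m = ?n - k"
    have m: "m > 0" "k + m = ?n" "?n - Suc k = m - 1" using Suc.prems by (auto simp: m_def)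
    let ?X = "uea_embed x" and ?Y = "uea_embed y"
    obtain a where a: "\<And>t. (?X + t *\<^sub>C ?Y) ^ m = (\<Sum>j\<le>m. t ^ j *\<^sub>C a j)"
      "a 1 = (\<Sum>i<m. ?X ^ i * ?Y * ?X ^ (m - 1 - i))"
      using power_expansion[of ?X ?Y m] by blast
    have "(\<Sum>j\<le>m. t ^ j *\<^sub>C (uea_word zs * a j)) \<in> ?S" for t
    proof -
      have "(\<Sum>j\<le>m. t ^ j *\<^sub>C (uea_word zs * a j)) = uea_word zs * uea_embed (x + t *\<^sub>C y) ^ m"
        by (simp add: uea_embed_linear a sum_distrib_left mult_scaleC_right)
      then show ?thesis using Suc.IH[of zs "x + t *\<^sub>C y"] Suc.prems ys by (simp add: m_def)
    qed
    from coefficient_in_subspace[OF S this, of 1] m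
    have 1: "uea_word zs * a 1 \<in> ?S" by simp
    have "uea_word zs * (?X ^ i * ?Y * ?X ^ (m - 1 - i)) - uea_word zs * (?Y * ?X ^ (m - 1)) \<in> ?S"
      if "i < m" for i
    proof -
      have "uea_word (zs @ replicate i x @ y # replicate (m - 1 - i) x)
        - uea_word (zs @ y # replicate i x @ replicate (m - 1 - i) x) \<in> ?S"
        using lower m that ys by (intro uea_word_move[OF S, where n = ?n]) auto
      moreover have "?X ^ i * ?X ^ (m - 1 - i) = ?X ^ (m - 1)"
        using that by (simp flip: power_add)
      ultimately show ?thesis by (simp add: uea_word_replicate mult.assoc)
    qed
    then have "(\<Sum>i<m. uea_word zs * (?X ^ i * ?Y * ?X ^ (m - 1 - i)) - uea_word zs * (?Y * ?X ^ (m - 1))) \<in> ?S"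
      by (intro complex_vector.subspace_sum[OF S]) auto
    then have "uea_word zs * a 1 - of_nat m *\<^sub>C (uea_word zs * (?Y * ?X ^ (m - 1))) \<in> ?S"
      by (simp only: a(2) sum_subtractf sum_distrib_left complex_vector.sum_constant_scale card_lessThan)
    from complex_vector.subspace_diff[OF S 1 this]
    have "of_nat m *\<^sub>C (uea_word zs * (?Y * ?X ^ (m - 1))) \<in> ?S" by simp
    then have "inverse (of_nat m) *\<^sub>C of_nat m *\<^sub>C (uea_word zs * (?Y * ?X ^ (m - 1))) \<in> ?S"
      by (rule complex_vector.subspace_scale[OF S])
    moreover have "inverse (of_nat m) *\<^sub>C of_nat m *\<^sub>C (uea_word zs * (?Y * ?X ^ (m - 1)))
        = uea_word ys * ?X ^ (?n - Suc k)"
      using m by (simp add: ys mult.assoc)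
    ultimately show ?case by simp
  qed
  from this[of ?n w 0] show ?case by simp
qed

lemma uea_power_induct [case_names add scaleC power]:
  fixes u :: "'g::complex_lie_algebra uea"
  assumes add: "\<And>u v. P u \<Longrightarrow> P v \<Longrightarrow> P (u + v)" and scale: "\<And>c u. P u \<Longrightarrow> P (c *\<^sub>C u)"
    and power: "\<And>x m. P (uea_embed x ^ m)"
  shows "P u"
proof -
  have zero: "P 0" using scale[OF power, of 0] by simp
  have "P v" if "v \<in> uea_powers" for v
    using that
  proof (induction rule: complex_vector.span_induct_alt)
    case base show ?case by (rule zero)
  next
    case (step c x y) then show ?case by (auto intro!: add scale power)
  qed
  then have words: "P (uea_word w)" for w using uea_word_in_powers by blast
  obtain p where u: "u = abs_uea p" by (metis Quotient3_abs_rep Quotient3_uea)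
  have "P (abs_uea p)"
  proof (induction p rule: free_induct)
    case (add p q) then show ?case using assms(1) by (simp flip: plus_uea.abs_eq)
  next
    case (single w r)
    have "abs_uea (Poly_Mapping.single w r) = r *\<^sub>C uea_word (letters w)"
      by (simp add: uea_word_abs scaleC_uea.abs_eq scaleC_complex_def)
    then show ?case using scale words by simp
  qed
  then show ?thesis by (simp add: u)
qed

lemma uea_log_power: "uea_log (uea_embed x ^ m) = (if m = 1 then x else 0)"
proof -
  consider "m = 0" | "m = 1" | "m \<ge> 2" by linarith
  then show ?thesis
  proof cases
    case 1
    have "uea_log (uea_word []) = (0 :: 'a)" by (subst uea_log_word) simp
    then show ?thesis using 1 by simp
  next
    case 3
    let ?xs = "replicate m x"
    have "permute_list \<sigma> ?xs = ?xs" if "\<sigma> permutes {..<m}" for \<sigma>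
      using that permutes_in_image[OF that] by (intro nth_equalityI) (auto simp: permute_list_nth)
    then have "(\<Sum>\<sigma> | \<sigma> permutes {..<m}. uea_log (uea_word ?xs)) = 0"
      using sum_uea_log_permutations[of ?xs] 3 by simp
    then have "fact m *\<^sub>C uea_log (uea_word ?xs) = 0"
      by (simp add: complex_vector.sum_constant_scale card_permutations)
    then show ?thesis using 3 by (simp add: uea_word_replicate)
  qed (simp add: uea_log_embed)
qed

section \<open>Convolution of functionals on the enveloping algebra\<close>

text \<open>The linear map on \<open>A \<otimes> B\<close> with \<open>a \<otimes> b \<mapsto> \<beta> a b\<close>, for bilinear \<open>\<beta>\<close>.\<close>

definition tensor_eval :: "('a::complex_vector \<Rightarrow> 'b::complex_vector \<Rightarrow> 'x::complex_vector) \<Rightarrow> ('a, 'b) tensor \<Rightarrow> 'x" where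
  "tensor_eval \<beta> t = lin_ext (\<lambda>(a, b). \<beta> a b) (rep_tensor t)"

text \<open>Bilinear maps between type class vector spaces.\<close>

definition bilin :: "('a::complex_vector \<Rightarrow> 'b::complex_vector \<Rightarrow> 'x::complex_vector) \<Rightarrow> bool" where
  "bilin \<beta> \<longleftrightarrow> (\<forall>b. lin (\<lambda>a. \<beta> a b)) \<and> (\<forall>a. lin (\<beta> a))"

lemma tensor_eval_abs:
  assumes "bilin \<beta>"
  shows "tensor_eval \<beta> (abs_tensor p) = lin_ext (\<lambda>(a, b). \<beta> a b) p"
proof -
  have \<beta>: "lin (\<lambda>a. \<beta> a b)" "lin (\<beta> a)" for a b using assms by (auto simp: bilin_def)
  have "rep_tensor (abs_tensor p) - p \<in> tensor_null"
    by (rule Quotient3_rep_abs[OF Quotient3_tensor]) (simp add: tensor_null_zero)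
  then have "lin_ext (\<lambda>(a, b). \<beta> a b) (rep_tensor (abs_tensor p) - p) \<in> {0}"
    by (rule lin_ext_tensor_null[rotated 5])
      (auto simp: lin_add[OF \<beta>(1)] lin_add[OF \<beta>(2)] lin_scaleC[OF \<beta>(1)] lin_scaleC[OF \<beta>(2)])
  then show ?thesis by (simp add: tensor_eval_def)
qed

lemma tensor_abs_cases: obtains p where "t = abs_tensor p"
  by (rule that[of "rep_tensor t"]) (rule Quotient3_abs_rep[OF Quotient3_tensor, symmetric])

lemma tensor_eval_simps:
  assumes "bilin \<beta>"
  shows "tensor_eval \<beta> (s + t) = tensor_eval \<beta> s + tensor_eval \<beta> t"
    and "tensor_eval \<beta> (c *\<^sub>C t) = c *\<^sub>C tensor_eval \<beta> t"
    and "tensor_eval \<beta> (a \<otimes>\<^sub>C b) = \<beta> a b"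
proof -
  obtain p where [simp]: "s = abs_tensor p" by (rule tensor_abs_cases)
  obtain q where [simp]: "t = abs_tensor q" by (rule tensor_abs_cases)
  show "tensor_eval \<beta> (s + t) = tensor_eval \<beta> s + tensor_eval \<beta> t"
    by (simp add: plus_tensor.abs_eq tensor_eval_abs[OF assms])
  show "tensor_eval \<beta> (c *\<^sub>C t) = c *\<^sub>C tensor_eval \<beta> t"
    by (simp add: scaleC_tensor.abs_eq tensor_eval_abs[OF assms])
  show "tensor_eval \<beta> (a \<otimes>\<^sub>C b) = \<beta> a b"
    by (simp add: tensor_pure.abs_eq tensor_eval_abs[OF assms] scaleC_one)
qed

lemma lin_tensor_eval: "bilin \<beta> \<Longrightarrow> lin (tensor_eval \<beta>)"
  by (intro linI tensor_eval_simps)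

lemma tensor_induct [case_names add pure]:
  assumes "\<And>s t. P s \<Longrightarrow> P t \<Longrightarrow> P (s + t)" "\<And>a b. P (a \<otimes>\<^sub>C b)"
  shows "P t"
proof -
  obtain p where t: "t = abs_tensor p" by (rule tensor_abs_cases)
  have "P (abs_tensor p)"
  proof (induction p rule: free_induct)
    case (add p q) then show ?case using assms(1) by (simp flip: plus_tensor.abs_eq)
  next
    case (single k r)
    obtain a b where k: "k = (a, b)" by force
    have "abs_tensor (Poly_Mapping.single k r) = r *\<^sub>C (a \<otimes>\<^sub>C b)"
      by (simp add: k tensor_pure.abs_eq scaleC_tensor.abs_eq scaleC_complex_def)
    then have "abs_tensor (Poly_Mapping.single k r) = (r *\<^sub>C a) \<otimes>\<^sub>C b"
      by (simp only: tensor_pure_linear)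
    then show ?case using assms(2) by simp
  qed
  then show ?thesis by (simp add: t)
qed

text \<open>The induction step of the binomial theorem, for arbitrary terms in place of \<open>a\<^sup>i b\<^sup>j\<close>.\<close>

lemma sum_pascal:
  fixes r :: "nat \<Rightarrow> nat \<Rightarrow> 'x::complex_vector"
  shows "(\<Sum>i\<le>n. of_nat (n choose i) *\<^sub>C (r (Suc i) (n - i) + r i (Suc n - i)))
    = (\<Sum>i\<le>Suc n. of_nat (Suc n choose i) *\<^sub>C r i (Suc n - i))"
proof -
  have 1: "(\<Sum>i\<le>n. of_nat (n choose i) *\<^sub>C r i (Suc n - i))
      = r 0 (Suc n) + (\<Sum>i\<le>n. of_nat (n choose Suc i) *\<^sub>C r (Suc i) (n - i))"
  proof -
    have "(\<Sum>i\<le>n. of_nat (n choose i) *\<^sub>C r i (Suc n - i)) = (\<Sum>i\<le>Suc n. of_nat (n choose i) *\<^sub>C r i (Suc n - i))"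
      by simp
    also have "\<dots> = r 0 (Suc n) + (\<Sum>i\<le>n. of_nat (n choose Suc i) *\<^sub>C r (Suc i) (n - i))"
      by (subst sum.atMost_Suc_shift) (simp add: scaleC_one)
    finally show ?thesis .
  qed
  have "(\<Sum>i\<le>Suc n. of_nat (Suc n choose i) *\<^sub>C r i (Suc n - i))
      = r 0 (Suc n) + (\<Sum>i\<le>n. of_nat (Suc n choose Suc i) *\<^sub>C r (Suc i) (n - i))"
    by (subst sum.atMost_Suc_shift) (simp add: scaleC_one)
  then show ?thesis
    by (simp add: scaleC_add_right scaleC_add_left sum.distrib 1 add.left_commute)
qed

lemma power_add_commuting:
  fixes a b :: "'a::complex_algebra_1"
  assumes "a * b = b * a"
  shows "(a + b) ^ m = (\<Sum>k\<le>m. of_nat (m choose k) *\<^sub>C (a ^ k * b ^ (m - k)))"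
proof (induction m)
  case (Suc m)
  have comm: "b * a ^ k = a ^ k * b" for k
    by (induction k) (simp_all add: mult.assoc, metis assms mult.assoc)
  have "(a + b) ^ Suc m
      = (\<Sum>k\<le>m. of_nat (m choose k) *\<^sub>C (a ^ Suc k * b ^ (m - k) + a ^ k * b ^ (Suc m - k)))"
    by (simp add: Suc distrib_right sum_distrib_left mult_scaleC_right mult.assoc Suc_diff_le
        mult.assoc[symmetric, of b "a ^ _"] comm scaleC_add_right sum.distrib)
  also have "\<dots> = (\<Sum>k\<le>Suc m. of_nat (Suc m choose k) *\<^sub>C (a ^ k * b ^ (Suc m - k)))"
    by (rule sum_pascal[where r = "\<lambda>i j. a ^ i * b ^ j"])
  finally show ?case .
qed (simp add: scaleC_one)

lemma tensor_pure_power: "(a \<otimes>\<^sub>C b) ^ m = (a ^ m) \<otimes>\<^sub>C (b ^ m)"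
  by (induction m) (simp_all add: one_tensor_eq tensor_pure_mult)

lemma uea_comult_power:
  "uea_comult (uea_embed x ^ m) = (\<Sum>k\<le>m. of_nat (m choose k) *\<^sub>C (uea_embed x ^ k \<otimes>\<^sub>C uea_embed x ^ (m - k)))"
proof -
  let ?X = "uea_embed x"
  have "uea_comult (?X ^ m) = uea_comult ?X ^ m"
    by (induction m) (simp_all add: uea_comult_hom(3,4))
  also have "\<dots> = (?X \<otimes>\<^sub>C 1 + 1 \<otimes>\<^sub>C ?X) ^ m" by (simp add: uea_comult_hom)
  also have "\<dots> = (\<Sum>k\<le>m. of_nat (m choose k) *\<^sub>C ((?X \<otimes>\<^sub>C 1) ^ k * (1 \<otimes>\<^sub>C ?X) ^ (m - k)))"
    by (rule power_add_commuting) (simp add: tensor_pure_mult)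
  finally show ?thesis by (simp add: tensor_pure_power tensor_pure_mult)
qed

text \<open>The convolution product of functionals on the enveloping algebra, dual to its comultiplication.\<close>

definition conv :: "('g::complex_lie_algebra uea \<Rightarrow> complex) \<Rightarrow> ('g uea \<Rightarrow> complex) \<Rightarrow> 'g uea \<Rightarrow> complex" where
  "conv \<xi> \<zeta> u = tensor_eval (\<lambda>a b. \<xi> a * \<zeta> b) (uea_comult u)"

lemma bilin_mult: "lin \<xi> \<Longrightarrow> lin \<zeta> \<Longrightarrow> bilin (\<lambda>a b. \<xi> a * (\<zeta> b :: complex))"
  by (auto simp: bilin_def lin_def scaleC_complex_def algebra_simps)

lemma lin_conv:
  assumes "lin \<xi>" "lin \<zeta>" shows "lin (conv \<xi> \<zeta>)"
  unfolding conv_def using tensor_eval_simps(1,2)[OF bilin_mult[OF assms]]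
  by (intro linI) (simp_all add: uea_comult_hom)

lemma conv_power:
  assumes "lin \<xi>" "lin \<zeta>"
  shows "conv \<xi> \<zeta> (uea_embed x ^ m)
    = (\<Sum>k\<le>m. of_nat (m choose k) * (\<xi> (uea_embed x ^ k) * \<zeta> (uea_embed x ^ (m - k))))"
  using lin_tensor_eval[OF bilin_mult[OF assms]]
  by (simp add: conv_def uea_comult_power lin_sum lin_scaleC tensor_eval_simps(3)[OF bilin_mult[OF assms]]
      scaleC_complex_def)

lemma lin_eq_on_powers:
  assumes "lin f" "lin g" "\<And>x m. f (uea_embed x ^ m) = g (uea_embed x ^ m)"
  shows "f u = g u"
  by (induction u rule: uea_power_induct) (simp_all add: assms lin_add lin_scaleC)

lemma conv_commute:
  assumes "lin \<xi>" "lin \<zeta>"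
  shows "conv \<xi> \<zeta> u = conv \<zeta> \<xi> u"
proof (rule lin_eq_on_powers)
  fix x and m :: nat
  show "conv \<xi> \<zeta> (uea_embed x ^ m) = conv \<zeta> \<xi> (uea_embed x ^ m)"
    unfolding conv_power[OF assms] conv_power[OF assms(2,1)]
    by (rule sum.reindex_bij_witness[of _ "\<lambda>k. m - k" "\<lambda>k. m - k"]) (auto simp: binomial_symmetric[symmetric])
qed (use assms lin_conv in auto)

lemma lin_uea_counit: "lin uea_counit"
  by (intro linI) (simp_all add: uea_counit_hom scaleC_complex_def)

lemma lin_uea_log: "lin uea_log"
  by (intro linI uea_log_add uea_log_scaleC)

lemma lin_comp: "lin f \<Longrightarrow> lin g \<Longrightarrow> lin (\<lambda>x. f (g x))"
  by (simp add: lin_def)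

text \<open>The convolution product of the functionals \<open>\<alpha> \<circ> log\<close> for \<open>\<alpha>\<close> in a list.\<close>

primrec conv_logs :: "('g::complex_lie_algebra \<Rightarrow> complex) list \<Rightarrow> 'g uea \<Rightarrow> complex" where
  "conv_logs [] = uea_counit"
| "conv_logs (\<alpha> # \<alpha>s) = conv (\<lambda>u. \<alpha> (uea_log u)) (conv_logs \<alpha>s)"

lemma lin_conv_logs: "(\<And>\<alpha>. \<alpha> \<in> set \<alpha>s \<Longrightarrow> lin \<alpha>) \<Longrightarrow> lin (conv_logs \<alpha>s)"
  by (induction \<alpha>s) (auto intro!: lin_conv lin_uea_counit lin_comp[OF _ lin_uea_log])

lemma uea_counit_power: "uea_counit (uea_embed x ^ m) = (if m = 0 then 1 else 0)"
  by (cases m) (simp_all add: uea_counit_hom)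

lemma conv_logs_power:
  assumes "\<And>\<alpha>. \<alpha> \<in> set \<alpha>s \<Longrightarrow> lin \<alpha>"
  shows "conv_logs \<alpha>s (uea_embed x ^ m)
    = (if m = length \<alpha>s then fact m * prod_list (map (\<lambda>\<alpha>. \<alpha> x) \<alpha>s) else 0)"
  using assms
proof (induction \<alpha>s arbitrary: m)
  case Nil then show ?case by (simp add: uea_counit_power)
next
  case (Cons \<alpha> \<alpha>s)
  have \<alpha>: "lin \<alpha>" and \<alpha>s: "lin (conv_logs \<alpha>s)" using Cons.prems lin_conv_logs[of \<alpha>s] by auto
  have "of_nat (m choose k) * (\<alpha> (uea_log (uea_embed x ^ k)) * conv_logs \<alpha>s (uea_embed x ^ (m - k)))
      = (if k = 1 then of_nat m * (\<alpha> x * conv_logs \<alpha>s (uea_embed x ^ (m - 1))) else 0)" for k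
    by (simp add: uea_log_power lin_zero[OF \<alpha>])
  then have "conv_logs (\<alpha> # \<alpha>s) (uea_embed x ^ m)
      = (\<Sum>k\<le>m. if k = 1 then of_nat m * (\<alpha> x * conv_logs \<alpha>s (uea_embed x ^ (m - 1))) else 0)"
    by (simp only: conv_logs.simps conv_power[OF lin_comp[OF \<alpha> lin_uea_log] \<alpha>s])
  also have "\<dots> = (if m = 0 then 0 else of_nat m * (\<alpha> x * conv_logs \<alpha>s (uea_embed x ^ (m - 1))))"
    by (subst sum.delta) auto
  also have "\<dots> = (if m = length (\<alpha> # \<alpha>s) then fact m * prod_list (map (\<lambda>\<alpha>. \<alpha> x) (\<alpha> # \<alpha>s)) else 0)"
    using Cons.IH[of "m - 1"] Cons.prems by (cases m) (simp_all del: of_nat_Suc)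
  finally show ?case .
qed

section \<open>Linear maps out of vector spaces on carrier sets\<close>

text \<open>Complex vector spaces in the sense of the module locale, without the conditions on values outside of
the carrier that \<open>cspace\<close> adds. The tensor products \<open>tens n V\<close> are of this kind.\<close>

abbreviation cmodule :: "'v cspace \<Rightarrow> bool" where
  "cmodule \<equiv> Module.module (ring_of_type_algebra :: complex ring)"

lemma complex_ring_simps [simp]:
  "carrier (ring_of_type_algebra :: complex ring) = UNIV"
  "\<zero>\<^bsub>(ring_of_type_algebra :: complex ring)\<^esub> = 0"
  "\<one>\<^bsub>(ring_of_type_algebra :: complex ring)\<^esub> = 1"
  "x \<oplus>\<^bsub>(ring_of_type_algebra :: complex ring)\<^esub> y = x + y"
  "x \<otimes>\<^bsub>(ring_of_type_algebra :: complex ring)\<^esub> y = x * y"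
  by (simp_all add: ring_of_type_algebra_def)

lemma cspace_cmodule: "cspace V \<Longrightarrow> cmodule V"
  by (simp add: cspace_def)

text \<open>Linear maps from a vector space on a carrier set to a type class vector space.\<close>

definition lin_on :: "'w cspace \<Rightarrow> ('w \<Rightarrow> 'x::complex_vector) \<Rightarrow> bool" where
  "lin_on W l \<longleftrightarrow> (\<forall>v\<in>carrier W. \<forall>w\<in>carrier W. l (v \<oplus>\<^bsub>W\<^esub> w) = l v + l w) \<and>
     (\<forall>c. \<forall>v\<in>carrier W. l (c \<odot>\<^bsub>W\<^esub> v) = c *\<^sub>C l v)"

lemma lin_onI:
  "(\<And>v w. v \<in> carrier W \<Longrightarrow> w \<in> carrier W \<Longrightarrow> l (v \<oplus>\<^bsub>W\<^esub> w) = l v + l w) \<Longrightarrow>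
   (\<And>c v. v \<in> carrier W \<Longrightarrow> l (c \<odot>\<^bsub>W\<^esub> v) = c *\<^sub>C l v) \<Longrightarrow> lin_on W l"
  by (simp add: lin_on_def)

lemma lin_on_simps:
  assumes "lin_on W l"
  shows lin_on_add: "v \<in> carrier W \<Longrightarrow> w \<in> carrier W \<Longrightarrow> l (v \<oplus>\<^bsub>W\<^esub> w) = l v + l w"
    and lin_on_smult: "v \<in> carrier W \<Longrightarrow> l (c \<odot>\<^bsub>W\<^esub> v) = c *\<^sub>C l v"
  using assms by (simp_all add: lin_on_def)

lemma lin_on_zero:
  assumes "lin_on W l" "cmodule W" shows "l \<zero>\<^bsub>W\<^esub> = 0"
proof -
  interpret Module.module "ring_of_type_algebra :: complex ring" W by fact
  show ?thesis using lin_on_add[OF assms(1), of "\<zero>\<^bsub>W\<^esub>" "\<zero>\<^bsub>W\<^esub>"] by simp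
qed

lemma lin_on_comp: "clinear_map V W f \<Longrightarrow> lin_on W l \<Longrightarrow> lin_on V (\<lambda>v. l (f v))"
  by (auto simp: clinear_map_def lin_on_def Pi_iff)

lemma lin_on_compose: "lin f \<Longrightarrow> lin_on W l \<Longrightarrow> lin_on W (\<lambda>w. f (l w))"
  by (simp add: lin_on_def lin_def)

lemma lin_ext_into_closed:
  assumes "cmodule W" "\<And>k. k \<in> Poly_Mapping.keys p \<Longrightarrow> \<phi> k \<in> carrier W"
  shows "lin_ext_into W \<phi> p \<in> carrier W"
proof -
  interpret Module.module "ring_of_type_algebra :: complex ring" W by fact
  show ?thesis unfolding lin_ext_into_def using assms(2) by (intro M.finsum_closed) auto
qed

lemma lin_ext_into_map:
  assumes W: "cmodule W" and l: "lin_on W l" and \<phi>: "\<And>k. k \<in> Poly_Mapping.keys p \<Longrightarrow> \<phi> k \<in> carrier W"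
  shows "l (lin_ext_into W \<phi> p) = lin_ext (\<lambda>k. l (\<phi> k)) p"
proof -
  interpret Module.module "ring_of_type_algebra :: complex ring" W by fact
  have "l (\<Oplus>\<^bsub>W\<^esub>k\<in>S. Poly_Mapping.lookup p k \<odot>\<^bsub>W\<^esub> \<phi> k) = (\<Sum>k\<in>S. Poly_Mapping.lookup p k *\<^sub>C l (\<phi> k))"
    if "finite S" "S \<subseteq> Poly_Mapping.keys p" for S
    using that
  proof (induction S rule: finite_induct)
    case empty
    then show ?case by (simp add: lin_on_zero[OF l W])
  next
    case (insert k S)
    have "(\<Oplus>\<^bsub>W\<^esub>k\<in>S. Poly_Mapping.lookup p k \<odot>\<^bsub>W\<^esub> \<phi> k) \<in> carrier W"
      using insert \<phi> by (intro M.finsum_closed) auto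
    then show ?case using insert \<phi>
      by (subst M.finsum_insert) (auto simp: lin_on_add[OF l] lin_on_smult[OF l])
  qed
  then show ?thesis by (simp add: lin_ext_into_def lin_ext_def)
qed

lemma lin_ext_into_superset:
  assumes W: "cmodule W" and "finite S" "Poly_Mapping.keys p \<subseteq> S" "\<And>k. k \<in> S \<Longrightarrow> \<phi> k \<in> carrier W"
  shows "lin_ext_into W \<phi> p = (\<Oplus>\<^bsub>W\<^esub>k\<in>S. Poly_Mapping.lookup p k \<odot>\<^bsub>W\<^esub> \<phi> k)"
proof -
  interpret Module.module "ring_of_type_algebra :: complex ring" W by fact
  show ?thesis unfolding lin_ext_into_def
  proof (rule M.add.finprod_mono_neutral_cong_left)
    show "Poly_Mapping.lookup p i \<odot>\<^bsub>W\<^esub> \<phi> i = \<zero>\<^bsub>W\<^esub>" if "i \<in> S - Poly_Mapping.keys p" for i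
      using that assms(4) smult_l_null[of "\<phi> i"] by (auto simp: in_keys_iff)
  qed (use assms in auto)
qed

lemma lin_ext_into_add:
  assumes W: "cmodule W" and \<phi>: "\<And>k. k \<in> Poly_Mapping.keys p \<union> Poly_Mapping.keys q \<Longrightarrow> \<phi> k \<in> carrier W"
  shows "lin_ext_into W \<phi> (p + q) = lin_ext_into W \<phi> p \<oplus>\<^bsub>W\<^esub> lin_ext_into W \<phi> q"
proof -
  interpret Module.module "ring_of_type_algebra :: complex ring" W by fact
  let ?S = "Poly_Mapping.keys p \<union> Poly_Mapping.keys q"
  have *: "lin_ext_into W \<phi> r = (\<Oplus>\<^bsub>W\<^esub>k\<in>?S. Poly_Mapping.lookup r k \<odot>\<^bsub>W\<^esub> \<phi> k)"
    if "Poly_Mapping.keys r \<subseteq> ?S" for r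
    using that \<phi> by (intro lin_ext_into_superset[OF W]) auto
  have "lin_ext_into W \<phi> (p + q)
      = (\<Oplus>\<^bsub>W\<^esub>k\<in>?S. Poly_Mapping.lookup p k \<odot>\<^bsub>W\<^esub> \<phi> k \<oplus>\<^bsub>W\<^esub> Poly_Mapping.lookup q k \<odot>\<^bsub>W\<^esub> \<phi> k)"
    unfolding *[OF Poly_Mapping.keys_add]
    using \<phi> smult_l_distr by (intro M.add.finprod_cong') (auto simp: lookup_add)
  also have "\<dots> = lin_ext_into W \<phi> p \<oplus>\<^bsub>W\<^esub> lin_ext_into W \<phi> q"
    unfolding *[OF Un_upper1] *[OF Un_upper2] using \<phi> by (intro M.finsum_addf) auto
  finally show ?thesis .
qed

lemma lin_ext_into_single:
  assumes W: "cmodule W" and "\<phi> k \<in> carrier W"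
  shows "lin_ext_into W \<phi> (Poly_Mapping.single k a) = a \<odot>\<^bsub>W\<^esub> \<phi> k"
proof -
  interpret Module.module "ring_of_type_algebra :: complex ring" W by fact
  show ?thesis using lin_ext_into_superset[OF W, of "{k}" "Poly_Mapping.single k a" \<phi>] assms
    by (simp add: M.finsum_insert)
qed

lemma lin_ext_into_scaleC:
  assumes W: "cmodule W" and \<phi>: "\<And>k. k \<in> Poly_Mapping.keys p \<Longrightarrow> \<phi> k \<in> carrier W"
  shows "lin_ext_into W \<phi> (c *\<^sub>C p) = c \<odot>\<^bsub>W\<^esub> lin_ext_into W \<phi> p"
proof -
  interpret Module.module "ring_of_type_algebra :: complex ring" W by fact
  have "lin_ext_into W \<phi> (c *\<^sub>C p) = (\<Oplus>\<^bsub>W\<^esub>k\<in>Poly_Mapping.keys p. Poly_Mapping.lookup (c *\<^sub>C p) k \<odot>\<^bsub>W\<^esub> \<phi> k)"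
    using \<phi> by (intro lin_ext_into_superset[OF W]) (auto simp: in_keys_iff scaleC_complex_def)
  also have "\<dots> = (\<Oplus>\<^bsub>W\<^esub>k\<in>Poly_Mapping.keys p. c \<odot>\<^bsub>W\<^esub> (Poly_Mapping.lookup p k \<odot>\<^bsub>W\<^esub> \<phi> k))"
    using \<phi> smult_assoc1 by (intro M.add.finprod_cong') (auto simp: scaleC_complex_def)
  also have "\<dots> = c \<odot>\<^bsub>W\<^esub> lin_ext_into W \<phi> p"
    unfolding lin_ext_into_def using \<phi> by (intro finsum_smult_ldistr[symmetric]) auto
  finally show ?thesis .
qed

lemma keys_add_subset: "Poly_Mapping.keys p \<subseteq> K \<Longrightarrow> Poly_Mapping.keys q \<subseteq> K \<Longrightarrow> Poly_Mapping.keys (p + q) \<subseteq> K"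
  using Poly_Mapping.keys_add[of p q] by blast

lemma keys_scaleC_subset: "Poly_Mapping.keys (p :: _ \<Rightarrow>\<^sub>0 complex) \<subseteq> K \<Longrightarrow> Poly_Mapping.keys (c *\<^sub>C p) \<subseteq> K"
  by (auto simp: in_keys_iff scaleC_complex_def)

text \<open>The linear maps into the free vector space on the type of the elements separate points: the kernel of
the linear map from finitely supported functions on the carrier to \<open>V\<close> is the kernel of some
endomorphism \<open>P\<close>, and \<open>v \<mapsto> P (basis_elem v)\<close> is linear and injective.\<close>

lemma cmodule_eqI:
  fixes v w :: 'v
  assumes V: "cmodule V" and vw: "v \<in> carrier V" "w \<in> carrier V"
    and eq: "\<And>l :: 'v \<Rightarrow> 'v \<Rightarrow>\<^sub>0 complex. lin_on V l \<Longrightarrow> l v = l w"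
  shows "v = w"
proof -
  interpret Module.module "ring_of_type_algebra :: complex ring" V by fact
  let ?ev = "lin_ext_into V (\<lambda>v. v)"
  define N where "N = {p. Poly_Mapping.keys p \<subseteq> carrier V \<and> ?ev p = \<zero>\<^bsub>V\<^esub>}"
  have "complex_vector.subspace N"
  proof (rule complex_vector.subspaceI)
    show "0 \<in> N" by (simp add: N_def lin_ext_into_def)
    show "p + q \<in> N" if "p \<in> N" "q \<in> N" for p q
    proof -
      have "?ev (p + q) = ?ev p \<oplus>\<^bsub>V\<^esub> ?ev q"
        using that by (intro lin_ext_into_add[OF V]) (auto simp: N_def)
      then show ?thesis using that keys_add_subset[of p "carrier V" q] by (simp add: N_def)
    qed
    show "c *\<^sub>C p \<in> N" if "p \<in> N" for c p
    proof -
      have "?ev (c *\<^sub>C p) = c \<odot>\<^bsub>V\<^esub> ?ev p"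
        using that by (intro lin_ext_into_scaleC[OF V]) (auto simp: N_def)
      then show ?thesis using that keys_scaleC_subset[of p "carrier V" c] smult_r_null[of c] by (simp add: N_def)
    qed
  qed
  then obtain P :: "('v \<Rightarrow>\<^sub>0 complex) \<Rightarrow> ('v \<Rightarrow>\<^sub>0 complex)" where P: "lin P" "\<And>x. P x = 0 \<longleftrightarrow> x \<in> N"
    using ex_linear_kernel by blast
  have diff: "p - q \<in> N \<longleftrightarrow> ?ev p = ?ev q"
    if k: "Poly_Mapping.keys p \<subseteq> carrier V" "Poly_Mapping.keys q \<subseteq> carrier V" for p q
  proof -
    have kd: "Poly_Mapping.keys (p - q) \<subseteq> carrier V"
      using keys_diff[of p q] k by blast
    have closed: "?ev p \<in> carrier V" "?ev q \<in> carrier V" "?ev (p - q) \<in> carrier V"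
      using k kd by (auto intro!: lin_ext_into_closed[OF V])
    have "?ev p = ?ev (p - q) \<oplus>\<^bsub>V\<^esub> ?ev q"
      using lin_ext_into_add[OF V, of "p - q" q "\<lambda>v. v"] k kd by auto
    then show ?thesis using closed kd by (auto simp: N_def)
  qed
  have "lin_on V (\<lambda>v. P (basis_elem v))"
  proof (rule lin_onI)
    fix v w assume *: "v \<in> carrier V" "w \<in> carrier V"
    have "?ev (basis_elem v + basis_elem w) = ?ev (basis_elem v) \<oplus>\<^bsub>V\<^esub> ?ev (basis_elem w)"
      using * by (intro lin_ext_into_add[OF V]) auto
    then have "basis_elem (v \<oplus>\<^bsub>V\<^esub> w) - (basis_elem v + basis_elem w) \<in> N"
      using * keys_add_subset[of "basis_elem v" "carrier V" "basis_elem w"]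
      by (subst diff) (simp_all add: lin_ext_into_single[OF V] smult_one[unfolded complex_ring_simps])
    then show "P (basis_elem (v \<oplus>\<^bsub>V\<^esub> w)) = P (basis_elem v) + P (basis_elem w)"
      using P(2)[of "basis_elem (v \<oplus>\<^bsub>V\<^esub> w) - (basis_elem v + basis_elem w)"]
      by (simp add: lin_diff[OF P(1)] lin_add[OF P(1)])
  next
    fix c v assume *: "v \<in> carrier V"
    then have "basis_elem (c \<odot>\<^bsub>V\<^esub> v) - c *\<^sub>C basis_elem v \<in> N"
      by (subst diff) (auto simp: lin_ext_into_single[OF V] scaleC_complex_def
          smult_one[unfolded complex_ring_simps])
    then show "P (basis_elem (c \<odot>\<^bsub>V\<^esub> v)) = c *\<^sub>C P (basis_elem v)"
      using P(2)[of "basis_elem (c \<odot>\<^bsub>V\<^esub> v) - c *\<^sub>C basis_elem v"]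
      by (simp add: lin_diff[OF P(1)] lin_scaleC[OF P(1)] del: scaleC_single)
  qed
  from eq[OF this] have "basis_elem v - basis_elem w \<in> N"
    using P(2)[of "basis_elem v - basis_elem w"] by (simp add: lin_diff[OF P(1)])
  then show ?thesis using vw
    by (subst (asm) diff) (auto simp: lin_ext_into_single[OF V] smult_one[unfolded complex_ring_simps])
qed

section \<open>Multilinear maps out of the tensor products\<close>

text \<open>Maps \<open>\<Phi>\<close> into a type class vector space such that \<open>\<Phi> [x\<^sub>1, \<dots>, x\<^sub>n] v\<close> is linear in each \<open>x\<^sub>i\<close> and in
\<open>v\<close>.\<close>

definition multilin :: "nat \<Rightarrow> 'v cspace \<Rightarrow> ('a::complex_vector list \<Rightarrow> 'v \<Rightarrow> 'x::complex_vector) \<Rightarrow> bool" where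
  "multilin n V \<Phi> \<longleftrightarrow>
     (\<forall>xs ys. length xs + length ys + 1 = n \<longrightarrow> (\<forall>v\<in>carrier V. lin (\<lambda>x. \<Phi> (xs @ x # ys) v))) \<and>
     (\<forall>xs. length xs = n \<longrightarrow> lin_on V (\<Phi> xs))"

text \<open>The linear map \<open>A\<^sup>\<otimes>\<^sup>n \<otimes> V \<rightarrow> X\<close> with \<open>x\<^sub>1 \<otimes> \<dots> \<otimes> x\<^sub>n \<otimes> v \<mapsto> \<Phi> [x\<^sub>1, \<dots>, x\<^sub>n] v\<close>. It evaluates the same
representative as \<open>tens_lift\<close>, and does not depend on it if \<open>\<Phi>\<close> is multilinear.\<close>

definition tens_eval :: "('a::complex_vector list \<Rightarrow> 'v \<Rightarrow> 'x::complex_vector) \<Rightarrow> ('a, 'v) tens \<Rightarrow> 'x" where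
  "tens_eval \<Phi> S = lin_ext (\<lambda>(xs, v). \<Phi> xs v) (SOME p. p \<in> S)"

abbreviation tens_keys :: "nat \<Rightarrow> 'v cspace \<Rightarrow> ('a list \<times> 'v) set" where
  "tens_keys n V \<equiv> {xs. length xs = n} \<times> carrier V"

lemma subspace_tens_null: "complex_vector.subspace (tens_null n V)"
  unfolding tens_null_def by (rule complex_vector.subspace_span)

lemma keys_tens_null:
  assumes "cmodule V" "z \<in> tens_null n V"
  shows "Poly_Mapping.keys z \<subseteq> tens_keys n V"
proof -
  interpret Module.module "ring_of_type_algebra :: complex ring" V by fact
  let ?T = "{p :: 'b list \<times> 'a \<Rightarrow>\<^sub>0 complex. Poly_Mapping.keys p \<subseteq> tens_keys n V}"
  have T: "complex_vector.subspace ?T"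
  proof (rule complex_vector.subspaceI)
    show "p + q \<in> ?T" if "p \<in> ?T" "q \<in> ?T" for p q
      using that Poly_Mapping.keys_add[of p q] by blast
    show "c *\<^sub>C p \<in> ?T" if "p \<in> ?T" for c p
      using that by (auto simp: in_keys_iff scaleC_complex_def subset_iff)
  qed simp
  have basis: "basis_elem (xs, v) \<in> ?T" if "length xs = n" "v \<in> carrier V" for xs v
    using that by simp
  have "tens_null n V \<subseteq> ?T"
    unfolding tens_null_def
  proof (rule complex_vector.span_minimal[OF _ T], intro Un_least)
  qed ((rule subsetI, elim CollectE exE conjE, erule ssubst,
      (intro complex_vector.subspace_diff[OF T] complex_vector.subspace_scale[OF T] basis; simp))+)
  then show ?thesis using assms(2) by blast
qed

lemma multilin_tens_null:
  assumes \<Phi>: "multilin n V \<Phi>" and z: "z \<in> tens_null n V"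
  shows "lin_ext (\<lambda>(xs, v). \<Phi> xs v) z = 0"
proof -
  let ?T = "{p. lin_ext (\<lambda>(xs, v). \<Phi> xs v) p = 0}"
  have T: "complex_vector.subspace ?T"
    by (rule complex_vector.subspaceI) auto
  have 1: "lin (\<lambda>x. \<Phi> (xs @ x # ys) v)" if "length xs + length ys + 1 = n" "v \<in> carrier V" for xs ys v
    using \<Phi> that by (auto simp: multilin_def)
  have 2: "lin_on V (\<Phi> xs)" if "length xs = n" for xs
    using \<Phi> that by (auto simp: multilin_def)
  have "tens_null n V \<subseteq> ?T"
    unfolding tens_null_def
    by (rule complex_vector.span_minimal[OF _ T])
      (auto simp: scaleC_one scaleC_complex_def lin_add[OF 1] lin_scaleC[OF 1] lin_on_add[OF 2] lin_on_smult[OF 2])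
  then show ?thesis using z by blast
qed

lemma mem_tens_coset: "q \<in> tens_coset n V p \<longleftrightarrow> q - p \<in> tens_null n V"
  unfolding tens_coset_def by (auto simp: algebra_simps intro!: exI[of _ "q - p"])

lemma tens_coset_self: "p \<in> tens_coset n V p"
  by (simp add: mem_tens_coset complex_vector.subspace_0[OF subspace_tens_null])

lemma tens_coset_eq: "tens_coset n V p = tens_coset n V q \<longleftrightarrow> p - q \<in> tens_null n V"
proof
  assume "tens_coset n V p = tens_coset n V q"
  then show "p - q \<in> tens_null n V" using tens_coset_self[of p n V] by (simp add: mem_tens_coset)
next
  assume *: "p - q \<in> tens_null n V"
  have "r - p \<in> tens_null n V \<longleftrightarrow> r - q \<in> tens_null n V" for r
    using complex_vector.subspace_add[OF subspace_tens_null *, of "r - p"]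
      complex_vector.subspace_diff[OF subspace_tens_null _ *, of "r - q"] by auto
  then show "tens_coset n V p = tens_coset n V q" by (auto simp: mem_tens_coset)
qed

lemma tens_eval_coset:
  assumes "multilin n V \<Phi>"
  shows "tens_eval \<Phi> (tens_coset n V p) = lin_ext (\<lambda>(xs, v). \<Phi> xs v) p"
proof -
  let ?q = "SOME q. q \<in> tens_coset n V p"
  have "?q \<in> tens_coset n V p" by (rule someI[of _ p]) (rule tens_coset_self)
  then have "?q - p \<in> tens_null n V" by (simp add: mem_tens_coset)
  from multilin_tens_null[OF assms this] show ?thesis by (simp add: tens_eval_def)
qed

lemma some_rep_keys:
  assumes "cmodule V" "t \<in> carrier (tens n V)"
  shows "Poly_Mapping.keys (SOME p. p \<in> t) \<subseteq> tens_keys n V"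
proof -
  obtain p where t: "t = tens_coset n V p" and p: "Poly_Mapping.keys p \<subseteq> tens_keys n V"
    using assms(2) by (auto simp: tens_def)
  let ?q = "SOME q. q \<in> t"
  have "?q \<in> t" unfolding t by (rule someI[of _ p]) (rule tens_coset_self)
  then have "?q - p \<in> tens_null n V" by (simp add: t mem_tens_coset)
  from keys_tens_null[OF assms(1) this] p Poly_Mapping.keys_add[of "?q - p" p]
  show ?thesis by auto
qed

lemma tens_coset_closed: "Poly_Mapping.keys p \<subseteq> tens_keys n V \<Longrightarrow> tens_coset n V p \<in> carrier (tens n V)"
  by (auto simp: tens_def)

lemma tens_carrierE:
  assumes "t \<in> carrier (tens n V)"
  obtains p where "t = tens_coset n V p" "Poly_Mapping.keys p \<subseteq> tens_keys n V"
  using assms by (auto simp: tens_def)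

lemma tens_ops:
  shows tens_zero: "\<zero>\<^bsub>tens n V\<^esub> = tens_coset n V 0"
    and tens_add: "tens_coset n V p \<oplus>\<^bsub>tens n V\<^esub> tens_coset n V q = tens_coset n V (p + q)"
    and tens_smult: "c \<odot>\<^bsub>tens n V\<^esub> tens_coset n V p = tens_coset n V (c *\<^sub>C p)"
proof -
  note N = subspace_tens_null[of n V]
  show "\<zero>\<^bsub>tens n V\<^esub> = tens_coset n V 0" by (auto simp: tens_def tens_coset_def)
  show "tens_coset n V p \<oplus>\<^bsub>tens n V\<^esub> tens_coset n V q = tens_coset n V (p + q)"
  proof (rule Set.set_eqI, rule iffI)
    fix r assume "r \<in> tens_coset n V p \<oplus>\<^bsub>tens n V\<^esub> tens_coset n V q"
    then obtain p' q' where r: "r = p' + q'" "p' - p \<in> tens_null n V" "q' - q \<in> tens_null n V"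
      by (auto simp: tens_def mem_tens_coset)
    have "r - (p + q) = (p' - p) + (q' - q)" by (simp add: r)
    then show "r \<in> tens_coset n V (p + q)"
      using complex_vector.subspace_add[OF N r(2,3)] by (simp only: mem_tens_coset)
  next
    fix r assume "r \<in> tens_coset n V (p + q)"
    then have "r - q \<in> tens_coset n V p" by (simp add: mem_tens_coset algebra_simps)
    moreover have "r = (r - q) + q" by simp
    ultimately have "\<exists>p' q'. r = p' + q' \<and> p' \<in> tens_coset n V p \<and> q' \<in> tens_coset n V q"
      using tens_coset_self[of q n V] by blast
    then show "r \<in> tens_coset n V p \<oplus>\<^bsub>tens n V\<^esub> tens_coset n V q"
      by (simp add: tens_def)
  qed
  show "c \<odot>\<^bsub>tens n V\<^esub> tens_coset n V p = tens_coset n V (c *\<^sub>C p)"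
  proof (rule Set.set_eqI, rule iffI)
    fix r assume "r \<in> c \<odot>\<^bsub>tens n V\<^esub> tens_coset n V p"
    then obtain p' z where r: "r = c *\<^sub>C p' + z" "p' - p \<in> tens_null n V" "z \<in> tens_null n V"
      by (auto simp: tens_def mem_tens_coset)
    have "r - c *\<^sub>C p = c *\<^sub>C (p' - p) + z"
      by (simp add: r complex_vector.scale_right_diff_distrib)
    then show "r \<in> tens_coset n V (c *\<^sub>C p)"
      using complex_vector.subspace_add[OF N complex_vector.subspace_scale[OF N r(2)] r(3)]
      by (simp only: mem_tens_coset)
  next
    fix r assume "r \<in> tens_coset n V (c *\<^sub>C p)"
    then have "r - c *\<^sub>C p \<in> tens_null n V" by (simp add: mem_tens_coset)
    moreover have "r = c *\<^sub>C p + (r - c *\<^sub>C p)" by simp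
    ultimately have "\<exists>p' z. r = c *\<^sub>C p' + z \<and> p' \<in> tens_coset n V p \<and> z \<in> tens_null n V"
      using tens_coset_self[of p n V] by blast
    then show "r \<in> c \<odot>\<^bsub>tens n V\<^esub> tens_coset n V p"
      by (simp add: tens_def)
  qed
qed

lemma cmodule_tens: "cmodule (tens n V :: ('a::complex_vector, 'v) tens cspace)"
proof (rule moduleI)
  show "cring (ring_of_type_algebra :: complex ring)" by (rule cring_from_type_algebra)
  show "abelian_group (tens n V :: ('a, 'v) tens cspace)"
  proof (rule abelian_groupI)
    fix s t u :: "('a, 'v) tens" assume "s \<in> carrier (tens n V)" "t \<in> carrier (tens n V)" "u \<in> carrier (tens n V)"
    then obtain p q r where *: "s = tens_coset n V p" "t = tens_coset n V q" "u = tens_coset n V r"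
      "Poly_Mapping.keys p \<subseteq> tens_keys n V" "Poly_Mapping.keys q \<subseteq> tens_keys n V"
      by (metis tens_carrierE)
    show "s \<oplus>\<^bsub>tens n V\<^esub> t \<in> carrier (tens n V)"
      using * by (auto simp: tens_add intro!: tens_coset_closed keys_add_subset del: subsetI)
    show "s \<oplus>\<^bsub>tens n V\<^esub> t \<oplus>\<^bsub>tens n V\<^esub> u = s \<oplus>\<^bsub>tens n V\<^esub> (t \<oplus>\<^bsub>tens n V\<^esub> u)"
      by (simp add: * tens_add add.assoc)
    show "s \<oplus>\<^bsub>tens n V\<^esub> t = t \<oplus>\<^bsub>tens n V\<^esub> s" by (simp add: * tens_add add.commute)
    show "\<zero>\<^bsub>tens n V\<^esub> \<oplus>\<^bsub>tens n V\<^esub> s = s" by (simp add: * tens_zero tens_add)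
    show "\<exists>y\<in>carrier (tens n V). y \<oplus>\<^bsub>tens n V\<^esub> s = \<zero>\<^bsub>tens n V\<^esub>"
      using * by (intro bexI[of _ "tens_coset n V (- p)"]) (auto simp: tens_zero tens_add intro!: tens_coset_closed)
  qed (simp add: tens_zero tens_coset_closed)
next
  fix a b :: complex and s t :: "('a, 'v) tens" assume "s \<in> carrier (tens n V)" "t \<in> carrier (tens n V)"
  then obtain p q where *: "s = tens_coset n V p" "t = tens_coset n V q" by (metis tens_carrierE)
  show "(a \<oplus>\<^bsub>ring_of_type_algebra\<^esub> b) \<odot>\<^bsub>tens n V\<^esub> s = a \<odot>\<^bsub>tens n V\<^esub> s \<oplus>\<^bsub>tens n V\<^esub> b \<odot>\<^bsub>tens n V\<^esub> s"
    by (simp add: * tens_add tens_smult scaleC_add_left)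
  show "a \<odot>\<^bsub>tens n V\<^esub> (s \<oplus>\<^bsub>tens n V\<^esub> t) = a \<odot>\<^bsub>tens n V\<^esub> s \<oplus>\<^bsub>tens n V\<^esub> a \<odot>\<^bsub>tens n V\<^esub> t"
    by (simp add: * tens_add tens_smult scaleC_add_right)
  show "(a \<otimes>\<^bsub>ring_of_type_algebra\<^esub> b) \<odot>\<^bsub>tens n V\<^esub> s = a \<odot>\<^bsub>tens n V\<^esub> (b \<odot>\<^bsub>tens n V\<^esub> s)"
    by (simp add: * tens_smult scaleC_scaleC)
next
  fix a :: complex and s :: "('a, 'v) tens" assume "s \<in> carrier (tens n V)"
  then obtain p where *: "s = tens_coset n V p" "Poly_Mapping.keys p \<subseteq> tens_keys n V" by (metis tens_carrierE)
  show "a \<odot>\<^bsub>tens n V\<^esub> s \<in> carrier (tens n V)"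
    using * by (auto simp: tens_smult intro!: tens_coset_closed keys_scaleC_subset del: subsetI)
  show "\<one>\<^bsub>ring_of_type_algebra\<^esub> \<odot>\<^bsub>tens n V\<^esub> s = s" by (simp add: * tens_smult scaleC_one)
qed

lemma lin_on_tens_eval:
  assumes "multilin n V \<Phi>" shows "lin_on (tens n V) (tens_eval \<Phi>)"
  by (rule lin_onI; elim tens_carrierE) (simp_all add: tens_add tens_smult tens_eval_coset[OF assms])

lemma tens_eval_zero: "multilin n V \<Phi> \<Longrightarrow> tens_eval \<Phi> \<zero>\<^bsub>tens n V\<^esub> = 0"
  by (simp add: tens_zero tens_eval_coset)

lemma tens_eval_pure: "multilin n V \<Phi> \<Longrightarrow> tens_eval \<Phi> (tens_pure n V xs v) = \<Phi> xs v"
  by (simp add: tens_pure_def tens_eval_coset scaleC_one)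

lemma tens_pure_closed: "length xs = n \<Longrightarrow> v \<in> carrier V \<Longrightarrow> tens_pure n V xs v \<in> carrier (tens n V)"
  by (simp add: tens_pure_def tens_coset_closed)

lemma lin_ext_cong: "(\<And>k. k \<in> Poly_Mapping.keys p \<Longrightarrow> \<phi> k = \<psi> k) \<Longrightarrow> lin_ext \<phi> p = lin_ext \<psi> p"
  by (simp add: lin_ext_def)

lemma tens_eval_cong:
  assumes "cmodule V" "t \<in> carrier (tens n V)"
    and "\<And>xs v. length xs = n \<Longrightarrow> v \<in> carrier V \<Longrightarrow> \<Phi> xs v = \<Psi> xs v"
  shows "tens_eval \<Phi> t = tens_eval \<Psi> t"
  unfolding tens_eval_def using some_rep_keys[OF assms(1,2)] assms(3)
  by (intro lin_ext_cong) auto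

lemma tens_lift_closed:
  assumes "cmodule V" "cmodule W" "t \<in> carrier (tens n V)"
    and "\<And>xs v. length xs = n \<Longrightarrow> v \<in> carrier V \<Longrightarrow> \<phi> xs v \<in> carrier W"
  shows "tens_lift W \<phi> t \<in> carrier W"
  unfolding tens_lift_def using some_rep_keys[OF assms(1,3)] assms(4)
  by (intro lin_ext_into_closed[OF assms(2)]) auto

text \<open>A linear map after \<open>tens_lift\<close> is an evaluation. As both sides use the same representative, \<open>\<phi>\<close> need not
be multilinear.\<close>

lemma tens_lift_eval:
  assumes "cmodule V" "cmodule W" "t \<in> carrier (tens n V)" "lin_on W l"
    and "\<And>xs v. length xs = n \<Longrightarrow> v \<in> carrier V \<Longrightarrow> \<phi> xs v \<in> carrier W"
  shows "l (tens_lift W \<phi> t) = tens_eval (\<lambda>xs v. l (\<phi> xs v)) t"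
proof -
  have "l (tens_lift W \<phi> t) = lin_ext (\<lambda>k. l (case k of (xs, v) \<Rightarrow> \<phi> xs v)) (SOME p. p \<in> t)"
    unfolding tens_lift_def using some_rep_keys[OF assms(1,3)] assms(5)
    by (intro lin_ext_into_map[OF assms(2,4)]) auto
  also have "\<dots> = tens_eval (\<lambda>xs v. l (\<phi> xs v)) t"
    unfolding tens_eval_def by (intro arg_cong2[where f = lin_ext]) auto
  finally show ?thesis .
qed

text \<open>Multilinear maps into the free vector space on the generators separate the elements of
\<open>A\<^sup>\<otimes>\<^sup>n \<otimes> V\<close>. All identities in tensor products below are proved by evaluating both sides.\<close>

lemma tens_eqI:
  fixes s t :: "('a::complex_vector, 'v) tens"
  assumes "s \<in> carrier (tens n V)" "t \<in> carrier (tens n V)"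
    and eq: "\<And>\<Phi> :: 'a list \<Rightarrow> 'v \<Rightarrow> ('a list \<times> 'v \<Rightarrow>\<^sub>0 complex). multilin n V \<Phi> \<Longrightarrow> tens_eval \<Phi> s = tens_eval \<Phi> t"
  shows "s = t"
proof -
  obtain P :: "('a list \<times> 'v \<Rightarrow>\<^sub>0 complex) \<Rightarrow> ('a list \<times> 'v \<Rightarrow>\<^sub>0 complex)" where P: "lin P" "\<And>x. P x = 0 \<longleftrightarrow> x \<in> tens_null n V"
    using ex_linear_kernel[OF subspace_tens_null[of n V]] by blast
  define \<Phi> where "\<Phi> xs v = P (basis_elem (xs, v))" for xs v
  have eqP: "P p = P q" if "p - q \<in> tens_null n V" for p q
    using that P(2)[of "p - q"] by (simp add: lin_diff[OF P(1)])
  have "multilin n V \<Phi>"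
    unfolding multilin_def
  proof (intro conjI allI impI ballI linI lin_onI)
    fix xs ys :: "'a list" and x y c v assume "length xs + length ys + 1 = n" "v \<in> carrier V"
    then have "basis_elem (xs @ (x + y) # ys, v) - basis_elem (xs @ x # ys, v) - basis_elem (xs @ y # ys, v) \<in> tens_null n V"
      "basis_elem (xs @ (c *\<^sub>C x) # ys, v) - c *\<^sub>C basis_elem (xs @ x # ys, v) \<in> tens_null n V"
      unfolding tens_null_def by (intro complex_vector.span_base; blast)+
    then show "\<Phi> (xs @ (x + y) # ys) v = \<Phi> (xs @ x # ys) v + \<Phi> (xs @ y # ys) v"
      "\<Phi> (xs @ (c *\<^sub>C x) # ys) v = c *\<^sub>C \<Phi> (xs @ x # ys) v"
      unfolding \<Phi>_def lin_add[OF P(1), symmetric] lin_scaleC[OF P(1), symmetric]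
      by (intro eqP; simp only: diff_diff_eq[symmetric])+
  next
    fix xs :: "'a list" and v w c assume "length xs = n" and v: "v \<in> carrier V"
    then have *: "basis_elem (xs, v \<oplus>\<^bsub>V\<^esub> w) - basis_elem (xs, v) - basis_elem (xs, w) \<in> tens_null n V"
      if "w \<in> carrier V" for w
      using that unfolding tens_null_def by (intro complex_vector.span_base; blast)
    have "basis_elem (xs, c \<odot>\<^bsub>V\<^esub> v) - c *\<^sub>C basis_elem (xs, v) \<in> tens_null n V"
      using \<open>length xs = n\<close> v unfolding tens_null_def by (intro complex_vector.span_base; blast)
    then show "\<Phi> xs (c \<odot>\<^bsub>V\<^esub> v) = c *\<^sub>C \<Phi> xs v"
      unfolding \<Phi>_def lin_scaleC[OF P(1), symmetric] by (rule eqP)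
    assume "w \<in> carrier V"
    from *[OF this] show "\<Phi> xs (v \<oplus>\<^bsub>V\<^esub> w) = \<Phi> xs v + \<Phi> xs w"
      unfolding \<Phi>_def lin_add[OF P(1), symmetric] by (intro eqP; simp only: diff_diff_eq[symmetric])
  qed
  note eq[OF this]
  moreover obtain p q where pq: "s = tens_coset n V p" "t = tens_coset n V q" using assms(1,2) by (metis tens_carrierE)
  moreover have "lin_ext (\<lambda>(xs, v). \<Phi> xs v) r = P r" for r
    by (induction r rule: free_induct) (auto simp: \<Phi>_def lin_add[OF P(1)] lin_scaleC[OF P(1), symmetric] scaleC_complex_def)
  ultimately have "P p = P q" using tens_eval_coset[OF \<open>multilin n V \<Phi>\<close>] by metis
  then have "P (p - q) = 0" by (simp add: lin_diff[OF P(1)])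
  then show ?thesis by (simp add: P(2) pq tens_coset_eq)
qed

section \<open>Coactions as families of operators\<close>

lemma tens_eval_scaleC: "tens_eval (\<lambda>xs v. c *\<^sub>C \<Phi> xs v) t = c *\<^sub>C tens_eval \<Phi> t"
  by (simp add: tens_eval_def lin_ext_def complex_vector.scale_sum_right mult.commute split_def)

lemma tens_eval_sum: "tens_eval (\<lambda>xs v. \<Sum>i\<in>I. \<Phi> i xs v) t = (\<Sum>i\<in>I. tens_eval (\<Phi> i) t)"
  unfolding tens_eval_def lin_ext_def by (subst sum.swap) (simp add: complex_vector.scale_sum_right split_def)

lemma tensor_eval_scaleC_left: "tensor_eval (\<lambda>a b. \<beta> a b *\<^sub>C x) t = tensor_eval \<beta> t *\<^sub>C x"
  by (simp add: tensor_eval_def lin_ext_def complex_vector.scale_sum_left scaleC_scaleC scaleC_complex_def split_def)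

lemma multilin_1_iff:
  "multilin 1 V \<Phi> \<longleftrightarrow> (\<forall>v\<in>carrier V. lin (\<lambda>x. \<Phi> [x] v)) \<and> (\<forall>x. lin_on V (\<Phi> [x]))"
  unfolding multilin_def by (auto simp: length_Suc_conv)

lemma multilin_1I:
  "(\<And>v. v \<in> carrier V \<Longrightarrow> lin (\<lambda>x. \<Phi> [x] v)) \<Longrightarrow> (\<And>x. lin_on V (\<Phi> [x])) \<Longrightarrow> multilin 1 V \<Phi>"
  unfolding multilin_1_iff by blast

lemma multilin_2_iff:
  "multilin 2 V \<Phi> \<longleftrightarrow> (\<forall>v\<in>carrier V. \<forall>y. lin (\<lambda>x. \<Phi> [x, y] v)) \<and> (\<forall>v\<in>carrier V. \<forall>x. lin (\<lambda>y. \<Phi> [x, y] v))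
     \<and> (\<forall>x y. lin_on V (\<Phi> [x, y]))"
proof
  assume *: "multilin 2 V \<Phi>"
  show "(\<forall>v\<in>carrier V. \<forall>y. lin (\<lambda>x. \<Phi> [x, y] v)) \<and> (\<forall>v\<in>carrier V. \<forall>x. lin (\<lambda>y. \<Phi> [x, y] v))
     \<and> (\<forall>x y. lin_on V (\<Phi> [x, y]))"
  proof (intro conjI ballI allI)
    fix v x y assume "v \<in> carrier V"
    then show "lin (\<lambda>x. \<Phi> [x, y] v)" "lin (\<lambda>y. \<Phi> [x, y] v)"
      using * unfolding multilin_def
      by (auto dest!: conjunct1 dest: spec[of _ "[]"] spec[of _ "[x]"] spec[of _ "[y]"])
  next
    fix x y show "lin_on V (\<Phi> [x, y])" using * by (auto simp: multilin_def)
  qed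
next
  assume *: "(\<forall>v\<in>carrier V. \<forall>y. lin (\<lambda>x. \<Phi> [x, y] v)) \<and> (\<forall>v\<in>carrier V. \<forall>x. lin (\<lambda>y. \<Phi> [x, y] v))
     \<and> (\<forall>x y. lin_on V (\<Phi> [x, y]))"
  show "multilin 2 V \<Phi>"
    unfolding multilin_def
  proof (intro conjI allI impI ballI)
    fix xs ys :: "'b list" and v assume len: "length xs + length ys + 1 = 2" and v: "v \<in> carrier V"
    then consider y where "xs = []" "ys = [y]" | x where "xs = [x]" "ys = []"
      by (cases xs; cases ys) auto
    then show "lin (\<lambda>x. \<Phi> (xs @ x # ys) v)" using * v by cases auto
  next
    fix xs :: "'b list" assume "length xs = 2"
    then obtain x y where "xs = [x, y]" by (auto simp: numeral_2_eq_2 length_Suc_conv)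
    then show "lin_on V (\<Phi> xs)" using * by auto
  qed
qed

lemma multilin_2I:
  "(\<And>v y. v \<in> carrier V \<Longrightarrow> lin (\<lambda>x. \<Phi> [x, y] v)) \<Longrightarrow> (\<And>v x. v \<in> carrier V \<Longrightarrow> lin (\<lambda>y. \<Phi> [x, y] v)) \<Longrightarrow>
    (\<And>x y. lin_on V (\<Phi> [x, y])) \<Longrightarrow> multilin 2 V \<Phi>"
  by (simp add: multilin_2_iff)

lemma multilinD:
  assumes "multilin n V \<Phi>"
  shows "length xs + length ys + 1 = n \<Longrightarrow> v \<in> carrier V \<Longrightarrow> lin (\<lambda>x. \<Phi> (xs @ x # ys) v)"
    and "length xs = n \<Longrightarrow> lin_on V (\<Phi> xs)"
  using assms by (auto simp: multilin_def)

lemma lin_scaleC_right: "lin f \<Longrightarrow> lin (\<lambda>x. c *\<^sub>C f x)"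
  by (auto simp: lin_def scaleC_add_right mult.commute)

lemma lin_scaleC_left: "lin f \<Longrightarrow> lin (\<lambda>x. f x *\<^sub>C y)"
  by (auto simp: lin_def scaleC_add_left scaleC_complex_def)

lemma lin_on_scaleC: "lin_on V l \<Longrightarrow> lin_on V (\<lambda>v. c *\<^sub>C l v)"
  by (rule lin_on_compose) (auto simp: lin_def scaleC_add_right mult.commute)

lemma lin_sum_fun: "(\<And>i. i \<in> I \<Longrightarrow> lin (f i)) \<Longrightarrow> lin (\<lambda>x. \<Sum>i\<in>I. f i x)"
  by (simp add: lin_def sum.distrib complex_vector.scale_sum_right)

lemma lin_on_sum: "(\<And>i. i \<in> I \<Longrightarrow> lin_on V (f i)) \<Longrightarrow> lin_on V (\<lambda>x. \<Sum>i\<in>I. f i x)"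
  by (simp add: lin_on_def sum.distrib complex_vector.scale_sum_right)

lemma counit_id_closed:
  assumes "cmodule V" "t \<in> carrier (tens 1 V)"
  shows "counit_id \<xi> V t \<in> carrier V"
proof -
  interpret Module.module "ring_of_type_algebra :: complex ring" V by (rule assms)
  show ?thesis unfolding counit_id_def
    by (rule tens_lift_closed[OF assms(1,1,2)]) auto
qed

lemma counit_id_eval:
  assumes "cmodule V" "t \<in> carrier (tens 1 V)" "lin_on V l"
  shows "l (counit_id \<xi> V t) = tens_eval (\<lambda>xs v. \<xi> (hd xs) *\<^sub>C l v) t"
proof -
  interpret Module.module "ring_of_type_algebra :: complex ring" V by (rule assms)
  have "l (counit_id \<xi> V t) = tens_eval (\<lambda>xs v. l (\<xi> (hd xs) \<odot>\<^bsub>V\<^esub> v)) t"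
    unfolding counit_id_def by (rule tens_lift_eval[OF assms(1,1,2,3)]) auto
  also have "\<dots> = tens_eval (\<lambda>xs v. \<xi> (hd xs) *\<^sub>C l v) t"
    by (rule tens_eval_cong[OF assms(1,2)]) (simp add: lin_on_smult[OF assms(3)])
  finally show ?thesis .
qed

lemma multilin_contract: "lin \<xi> \<Longrightarrow> lin_on V l \<Longrightarrow> multilin 1 V (\<lambda>xs v. \<xi> (hd xs) *\<^sub>C l v)"
  by (rule multilin_1I) (auto intro: lin_scaleC_left lin_on_scaleC)

text \<open>The map \<open>f \<otimes> id : A \<otimes> V \<rightarrow> B \<otimes> V\<close>.\<close>

definition tens_map_left :: "'v cspace \<Rightarrow> ('a::complex_vector \<Rightarrow> 'b::complex_vector) \<Rightarrow> ('a, 'v) tens \<Rightarrow> ('b, 'v) tens" where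
  "tens_map_left V f = tens_lift (tens 1 V) (\<lambda>xs v. tens_pure 1 V [f (hd xs)] v)"

lemma tens_map_left_closed:
  assumes "cmodule V" "t \<in> carrier (tens 1 V)" shows "tens_map_left V f t \<in> carrier (tens 1 V)"
  unfolding tens_map_left_def
  by (rule tens_lift_closed[OF assms(1) cmodule_tens assms(2)]) (simp add: tens_pure_closed)

lemma tens_map_left_eval:
  assumes "cmodule V" "t \<in> carrier (tens 1 V)" "multilin 1 V \<Phi>"
  shows "tens_eval \<Phi> (tens_map_left V f t) = tens_eval (\<lambda>xs v. \<Phi> [f (hd xs)] v) t"
  unfolding tens_map_left_def
  by (subst tens_lift_eval[OF assms(1) cmodule_tens assms(2) lin_on_tens_eval[OF assms(3)]])
    (simp_all add: tens_pure_closed tens_eval_pure[OF assms(3)] del: One_nat_def)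

lemma tens_map_right_closed:
  assumes "cmodule V" "t \<in> carrier (tens n V)" "f \<in> carrier V \<rightarrow> carrier W"
  shows "tens_map_right n W f t \<in> carrier (tens n W)"
  unfolding tens_map_right_def using assms(3)
  by (intro tens_lift_closed[OF assms(1) cmodule_tens assms(2)] tens_pure_closed) auto

lemma tens_map_right_eval:
  assumes "cmodule V" "t \<in> carrier (tens n V)" "f \<in> carrier V \<rightarrow> carrier W" "multilin n W \<Phi>"
  shows "tens_eval \<Phi> (tens_map_right n W f t) = tens_eval (\<lambda>xs v. \<Phi> xs (f v)) t"
  unfolding tens_map_right_def using assms(3)
  by (subst tens_lift_eval[OF assms(1) cmodule_tens assms(2) lin_on_tens_eval[OF assms(4)]])
    (auto simp: tens_eval_pure[OF assms(4)] intro!: tens_pure_closed)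

lemma multilin_map_right:
  assumes f: "clinear_map V W f" and \<Phi>: "multilin n W \<Phi>"
  shows "multilin n V (\<lambda>xs v. \<Phi> xs (f v))"
proof -
  have "f v \<in> carrier W" if "v \<in> carrier V" for v using f that by (auto simp: clinear_map_def)
  moreover have "lin_on V (\<lambda>v. \<Phi> xs (f v))" if "length xs = n" for xs
    using \<Phi> that by (intro lin_on_comp[OF f]) (simp add: multilin_def)
  ultimately show ?thesis using \<Phi> unfolding multilin_def by blast
qed

lemma wedge_linear:
  "wedge (x + y) z = wedge x z + wedge y z" "wedge (c *\<^sub>C x) z = c *\<^sub>C wedge x z"
  "wedge z (x + y) = wedge z x + wedge z y" "wedge z (c *\<^sub>C x) = c *\<^sub>C wedge z x" "wedge x x = 0"
  by (transfer; simp add: tensor_pure_linear complex_vector.span_zero complex_vector.span_base)+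

lemma wedge_anti: "wedge y x = - wedge x y"
proof -
  have "wedge (x + y) (x + y) = 0" by (rule wedge_linear)
  then have "wedge x y + wedge y x = 0" unfolding wedge_linear(1,3) by (simp add: wedge_linear(5) algebra_simps)
  then show ?thesis by (metis add.commute eq_neg_iff_add_eq_0)
qed

text \<open>Alternating bilinear forms factor through the exterior square.\<close>

lemma ex_exterior2_functional:
  assumes \<beta>: "bilin \<beta>" and alt: "\<And>x. \<beta> x x = (0 :: complex)"
  shows "\<exists>\<omega>. lin \<omega> \<and> (\<forall>x y. \<omega> (wedge x y) = \<beta> x y)"
proof -
  define \<omega> where "\<omega> s = tensor_eval \<beta> (rep_exterior2 s)" for s
  let ?N = "complex_vector.span (range (\<lambda>x. x \<otimes>\<^sub>C x))"
  note lin = lin_tensor_eval[OF \<beta>]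
  have null: "tensor_eval \<beta> s = 0" if "s \<in> ?N" for s
    using that
  proof (induction rule: complex_vector.span_induct_alt)
    case (step c x y)
    then show ?case by (auto simp: lin_add[OF lin] lin_scaleC[OF lin] tensor_eval_simps(3)[OF \<beta>] alt)
  qed (rule lin_zero[OF lin])
  have abs: "\<omega> (abs_exterior2 s) = tensor_eval \<beta> s" for s
  proof -
    have "rep_exterior2 (abs_exterior2 s) - s \<in> ?N"
      by (rule Quotient3_rep_abs[OF Quotient3_exterior2]) (simp add: complex_vector.span_zero)
    from null[OF this] show ?thesis by (simp add: \<omega>_def lin_diff[OF lin])
  qed
  have ex: "\<exists>s. w = abs_exterior2 s" for w :: "'a exterior2"
    by (rule exI[of _ "rep_exterior2 w"]) (rule Quotient3_abs_rep[OF Quotient3_exterior2, symmetric])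
  have "lin \<omega>"
  proof (rule linI)
    fix x y :: "'a exterior2" and c
    obtain s where [simp]: "x = abs_exterior2 s" using ex by blast
    obtain t where [simp]: "y = abs_exterior2 t" using ex by blast
    show "\<omega> (x + y) = \<omega> x + \<omega> y" by (simp add: plus_exterior2.abs_eq abs lin_add[OF lin])
    show "\<omega> (c *\<^sub>C x) = c *\<^sub>C \<omega> x" by (simp add: scaleC_exterior2.abs_eq abs lin_scaleC[OF lin])
  qed
  moreover have "\<omega> (wedge x y) = \<beta> x y" for x y
    by (simp add: wedge.abs_eq abs tensor_eval_simps(3)[OF \<beta>])
  ultimately show ?thesis by blast
qed

lemma wedge_id_closed:
  assumes "cmodule V" "t \<in> carrier (tens 2 V)" shows "wedge_id V t \<in> carrier (tens 1 V)"
  unfolding wedge_id_def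
  by (rule tens_lift_closed[OF assms(1) cmodule_tens assms(2)]) (simp add: tens_pure_closed)

lemma wedge_id_eval:
  assumes "cmodule V" "t \<in> carrier (tens 2 V)" "multilin 1 V \<Phi>"
  shows "tens_eval \<Phi> (wedge_id V t) = tens_eval (\<lambda>xs v. \<Phi> [wedge (xs ! 0) (xs ! 1)] v) t"
  unfolding wedge_id_def
  by (subst tens_lift_eval[OF assms(1) cmodule_tens assms(2) lin_on_tens_eval[OF assms(3)]])
    (simp_all add: tens_pure_closed tens_eval_pure[OF assms(3)] del: One_nat_def)

lemma multilin_wedge:
  assumes "multilin 1 V \<Phi>" shows "multilin 2 V (\<lambda>xs v. \<Phi> [wedge (xs ! 0) (xs ! 1)] v)"
  using assms unfolding multilin_1_iff multilin_2_iff lin_def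
  by (auto simp: wedge_linear)

lemma comult_id_closed:
  assumes "cmodule V" "t \<in> carrier (tens 1 V)" shows "comult_id \<Delta> V t \<in> carrier (tens 2 V)"
  unfolding comult_id_def
  by (rule tens_lift_closed[OF assms(1) cmodule_tens assms(2)])
    (auto intro!: lin_ext_into_closed[OF cmodule_tens] tens_pure_closed)

lemma comult_id_eval:
  assumes "cmodule V" "t \<in> carrier (tens 1 V)" "multilin 2 V \<Phi>"
  shows "tens_eval \<Phi> (comult_id \<Delta> V t) = tens_eval (\<lambda>xs v. tensor_eval (\<lambda>a b. \<Phi> [a, b] v) (\<Delta> (hd xs))) t"
proof -
  let ?\<phi> = "\<lambda>xs v. lin_ext_into (tens 2 V) (\<lambda>(a, b). tens_pure 2 V [a, b] v) (rep_tensor (\<Delta> (hd xs)))"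
  have "tens_eval \<Phi> (comult_id \<Delta> V t) = tens_eval (\<lambda>xs v. tens_eval \<Phi> (?\<phi> xs v)) t"
    unfolding comult_id_def
    by (rule tens_lift_eval[OF assms(1) cmodule_tens assms(2) lin_on_tens_eval[OF assms(3)]])
      (auto intro!: lin_ext_into_closed[OF cmodule_tens] tens_pure_closed)
  also have "\<dots> = tens_eval (\<lambda>xs v. tensor_eval (\<lambda>a b. \<Phi> [a, b] v) (\<Delta> (hd xs))) t"
  proof (rule tens_eval_cong[OF assms(1,2)])
    fix xs v assume v: "v \<in> carrier V"
    have "tens_eval \<Phi> (?\<phi> xs v)
        = lin_ext (\<lambda>k. tens_eval \<Phi> (case k of (a, b) \<Rightarrow> tens_pure 2 V [a, b] v)) (rep_tensor (\<Delta> (hd xs)))"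
      using v by (intro lin_ext_into_map[OF cmodule_tens lin_on_tens_eval[OF assms(3)]])
        (auto intro!: tens_pure_closed)
    then show "tens_eval \<Phi> (?\<phi> xs v) = tensor_eval (\<lambda>a b. \<Phi> [a, b] v) (\<Delta> (hd xs))"
      by (simp add: tensor_eval_def split_def tens_eval_pure[OF assms(3)])
  qed
  finally show ?thesis .
qed

text \<open>A vector space \<open>V\<close> with a linear map \<open>V \<rightarrow> A \<otimes> V\<close>.\<close>

locale coaction =
  fixes V :: "'v cspace" and \<rho> :: "'v \<Rightarrow> ('a::complex_vector, 'v) tens"
  assumes linear_coaction: "linear_coaction (V, \<rho>)"
begin

lemma cspace: "cspace V" and coaction_ext: "\<rho> \<in> extensional (carrier V)"
  and coaction_linear: "clinear_map V (tens 1 V) \<rho>"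
  using linear_coaction by (auto simp: linear_coaction_def)

lemma cmodule: "cmodule V" by (rule cspace_cmodule[OF cspace])

sublocale V: Module.module "ring_of_type_algebra :: complex ring" V by (rule cmodule)

lemma coaction_closed: "v \<in> carrier V \<Longrightarrow> \<rho> v \<in> carrier (tens 1 V)"
  using coaction_linear by (auto simp: clinear_map_def)

lemma lin_on_coaction: "multilin 1 V \<Phi> \<Longrightarrow> lin_on V (\<lambda>v. tens_eval \<Phi> (\<rho> v))"
  by (rule lin_on_comp[OF coaction_linear lin_on_tens_eval])

text \<open>The operator \<open>(\<xi> \<otimes> id) \<circ> \<rho>\<close> on \<open>V\<close>; the functional \<open>\<xi>\<close> takes the place of a counit in \<open>counit_id\<close>.\<close>

definition act :: "('a \<Rightarrow> complex) \<Rightarrow> 'v \<Rightarrow> 'v" where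
  "act \<xi> v = counit_id \<xi> V (\<rho> v)"

lemma act_closed: "v \<in> carrier V \<Longrightarrow> act \<xi> v \<in> carrier V"
  by (simp add: act_def counit_id_closed[OF cmodule coaction_closed])

lemma act_eval: "v \<in> carrier V \<Longrightarrow> lin_on V l \<Longrightarrow> l (act \<xi> v) = tens_eval (\<lambda>xs u. \<xi> (hd xs) *\<^sub>C l u) (\<rho> v)"
  unfolding act_def by (rule counit_id_eval[OF cmodule coaction_closed])

lemma act_linear: "lin \<xi> \<Longrightarrow> clinear_map V V (act \<xi>)"
  unfolding clinear_map_def
proof (intro conjI ballI allI)
  assume \<xi>: "lin \<xi>"
  show "act \<xi> \<in> carrier V \<rightarrow> carrier V" by (simp add: act_closed)
  have *: "lin_on V (\<lambda>v. l (act \<xi> v))" if l: "lin_on V l" for l :: "'v \<Rightarrow> 'v \<Rightarrow>\<^sub>0 complex"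
    using lin_on_coaction[OF multilin_contract[OF \<xi> l]] unfolding lin_on_def by (auto simp: act_eval l)
  fix v assume v: "v \<in> carrier V"
  show "act \<xi> (v \<oplus>\<^bsub>V\<^esub> w) = act \<xi> v \<oplus>\<^bsub>V\<^esub> act \<xi> w" if w: "w \<in> carrier V" for w
    by (rule cmodule_eqI[OF cmodule]) (use v w in \<open>auto simp: act_closed lin_on_add lin_on_add[OF *]\<close>)
  show "act \<xi> (c \<odot>\<^bsub>V\<^esub> v) = c \<odot>\<^bsub>V\<^esub> act \<xi> v" for c
    by (rule cmodule_eqI[OF cmodule]) (use v in \<open>auto simp: act_closed lin_on_smult lin_on_smult[OF *]\<close>)
qed

lemma id_coaction_inner_closed:
  "length xs = n \<Longrightarrow> v \<in> carrier V \<Longrightarrow>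
    tens_lift (tens (Suc n) V) (\<lambda>ys w. tens_pure (Suc n) V (xs @ ys) w) (\<rho> v) \<in> carrier (tens (Suc n) V)"
  by (rule tens_lift_closed[OF cmodule cmodule_tens coaction_closed]) (simp_all add: tens_pure_closed)

lemma id_coaction_closed: "t \<in> carrier (tens n V) \<Longrightarrow> id_coaction n V \<rho> t \<in> carrier (tens (Suc n) V)"
  unfolding id_coaction_def
  by (rule tens_lift_closed[OF cmodule cmodule_tens]) (assumption, rule id_coaction_inner_closed)

lemma id_coaction_eval:
  assumes t: "t \<in> carrier (tens n V)" and \<Phi>: "multilin (Suc n) V \<Phi>"
  shows "tens_eval \<Phi> (id_coaction n V \<rho> t) = tens_eval (\<lambda>xs v. tens_eval (\<lambda>ys w. \<Phi> (xs @ ys) w) (\<rho> v)) t"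
proof -
  have "tens_eval \<Phi> (id_coaction n V \<rho> t) = tens_eval (\<lambda>xs v. tens_eval \<Phi>
      (tens_lift (tens (Suc n) V) (\<lambda>ys w. tens_pure (Suc n) V (xs @ ys) w) (\<rho> v))) t"
    unfolding id_coaction_def
    by (rule tens_lift_eval[OF cmodule cmodule_tens t lin_on_tens_eval[OF \<Phi>]]) (rule id_coaction_inner_closed)
  also have "\<dots> = tens_eval (\<lambda>xs v. tens_eval (\<lambda>ys w. \<Phi> (xs @ ys) w) (\<rho> v)) t"
  proof (rule tens_eval_cong[OF cmodule t])
    fix xs :: "'a list" and v assume "length xs = n" "v \<in> carrier V"
    then show "tens_eval \<Phi> (tens_lift (tens (Suc n) V) (\<lambda>ys w. tens_pure (Suc n) V (xs @ ys) w) (\<rho> v))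
      = tens_eval (\<lambda>ys w. \<Phi> (xs @ ys) w) (\<rho> v)"
      by (subst tens_lift_eval[OF cmodule cmodule_tens coaction_closed lin_on_tens_eval[OF \<Phi>]])
        (simp_all add: tens_pure_closed tens_eval_pure[OF \<Phi>])
  qed
  finally show ?thesis .
qed

lemma multilin_append:
  assumes \<Phi>: "multilin (Suc n) V \<Phi>" and "length xs = n"
  shows "multilin 1 V (\<lambda>ys w. \<Phi> (xs @ ys) w)"
  using multilinD[OF \<Phi>] assms(2) by (intro multilin_1I) (auto simp: multilinD(1)[OF \<Phi>, where ys = "[]"])

lemma iterated_coaction_closed: "v \<in> carrier V \<Longrightarrow> iterated_coaction n V \<rho> v \<in> carrier (tens n V)"
  by (induction n) (simp_all add: tens_pure_closed id_coaction_closed)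

text \<open>Composing two operators contracts both tensor factors of \<open>(id \<otimes> \<rho>) (\<rho> v)\<close>.\<close>

lemma act_act_eval:
  assumes v: "v \<in> carrier V" and "lin \<xi>" "lin \<zeta>" "lin_on V l"
  shows "l (act \<zeta> (act \<xi> v)) = tens_eval (\<lambda>xs v. (\<xi> (xs ! 0) * \<zeta> (xs ! 1)) *\<^sub>C l v) (id_coaction 1 V \<rho> (\<rho> v))"
proof -
  let ?l = "\<lambda>w. tens_eval (\<lambda>ys u. \<zeta> (hd ys) *\<^sub>C l u) (\<rho> w)"
  have l': "lin_on V ?l" using assms by (intro lin_on_coaction multilin_contract)
  have "multilin 2 V (\<lambda>xs v. (\<xi> (xs ! 0) * \<zeta> (xs ! 1)) *\<^sub>C l v)"
    using assms(2,3) by (intro multilin_2I lin_scaleC_left lin_on_scaleC assms(4))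
      (auto simp: lin_def scaleC_complex_def algebra_simps)
  then have \<Phi>: "multilin (Suc 1) V (\<lambda>xs v. (\<xi> (xs ! 0) * \<zeta> (xs ! 1)) *\<^sub>C l v)" by (simp add: numeral_2_eq_2)
  have "l (act \<zeta> (act \<xi> v)) = ?l (act \<xi> v)"
    by (simp add: act_eval act_closed v assms(4))
  also have "\<dots> = tens_eval (\<lambda>xs w. \<xi> (hd xs) *\<^sub>C ?l w) (\<rho> v)" by (rule act_eval[OF v l'])
  also have "\<dots> = tens_eval (\<lambda>xs w. tens_eval (\<lambda>ys u. (\<xi> ((xs @ ys) ! 0) * \<zeta> ((xs @ ys) ! 1)) *\<^sub>C l u) (\<rho> w)) (\<rho> v)"
    unfolding tens_eval_scaleC[symmetric]
  proof (rule tens_eval_cong[OF cmodule coaction_closed[OF v]], rule tens_eval_cong[OF cmodule coaction_closed])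
    fix xs ys :: "'a list" and u w assume "length xs = 1" "length ys = 1"
    then show "\<xi> (hd xs) *\<^sub>C \<zeta> (hd ys) *\<^sub>C l u = (\<xi> ((xs @ ys) ! 0) * \<zeta> ((xs @ ys) ! 1)) *\<^sub>C l u"
      by (auto simp: length_Suc_conv)
  qed
  also have "\<dots> = tens_eval (\<lambda>xs v. (\<xi> (xs ! 0) * \<zeta> (xs ! 1)) *\<^sub>C l v) (id_coaction 1 V \<rho> (\<rho> v))"
    by (rule id_coaction_eval[OF coaction_closed[OF v] \<Phi>, symmetric])
  finally show ?thesis .
qed

end

text \<open>The finitely many elements of \<open>A\<close> that occur in the representative at which \<open>tens_eval\<close> evaluates an
element of \<open>A \<otimes> V\<close>. Two maps that agree on them have the same evaluation.\<close>

definition support :: "('a::complex_vector, 'v) tens \<Rightarrow> 'a set" where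
  "support t = (\<lambda>(xs, v). hd xs) ` Poly_Mapping.keys (SOME p. p \<in> t)"

lemma finite_support: "finite (support t)"
  by (simp add: support_def)

lemma tens_eval_cong_support:
  assumes "cmodule V" "t \<in> carrier (tens 1 V)"
    and "\<And>x v. x \<in> support t \<Longrightarrow> v \<in> carrier V \<Longrightarrow> \<Phi> [x] v = \<Psi> [x] v"
  shows "tens_eval \<Phi> t = tens_eval \<Psi> t"
  unfolding tens_eval_def
proof (rule lin_ext_cong)
  fix k assume k: "k \<in> Poly_Mapping.keys (SOME p. p \<in> t)"
  then have "k \<in> tens_keys 1 V" using some_rep_keys[OF assms(1,2)] by blast
  then obtain x v where kv: "k = ([x], v)" "v \<in> carrier V" by (auto simp: length_Suc_conv)
  then have "x \<in> support t" using k unfolding support_def by force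
  then show "(case k of (xs, v) \<Rightarrow> \<Phi> xs v) = (case k of (xs, v) \<Rightarrow> \<Psi> xs v)" using assms(3) kv by simp
qed

text \<open>A comodule over the universal enveloping algebra.\<close>

locale uea_comodule = coaction V \<rho> for V :: "'v cspace" and \<rho> :: "'v \<Rightarrow> ('g::complex_lie_algebra uea, 'v) tens" +
  assumes uea_comodule: "coalgebra_comodule uea_comult uea_counit (V, \<rho>)"
begin

lemma act_counit: "v \<in> carrier V \<Longrightarrow> act uea_counit v = v"
  using uea_comodule by (simp add: coalgebra_comodule_def act_def)

text \<open>Coassociativity makes \<open>V\<close> a module over the convolution algebra of functionals.\<close>

lemma act_act:
  assumes v: "v \<in> carrier V" and \<xi>: "lin \<xi>" and \<zeta>: "lin \<zeta>"
  shows "act \<zeta> (act \<xi> v) = act (conv \<xi> \<zeta>) v"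
proof (rule cmodule_eqI[OF cmodule])
  fix l :: "'v \<Rightarrow> 'v \<Rightarrow>\<^sub>0 complex" assume l: "lin_on V l"
  let ?\<Phi> = "\<lambda>xs v. (\<xi> (xs ! 0) * \<zeta> (xs ! 1)) *\<^sub>C l v"
  have \<Phi>: "multilin 2 V ?\<Phi>"
    using \<xi> \<zeta> by (intro multilin_2I lin_scaleC_left lin_on_scaleC l)
      (auto simp: lin_def scaleC_complex_def algebra_simps)
  have "l (act \<zeta> (act \<xi> v)) = tens_eval ?\<Phi> (comult_id uea_comult V (\<rho> v))"
    using uea_comodule v by (simp add: act_act_eval[OF v \<xi> \<zeta> l] coalgebra_comodule_def)
  also have "\<dots> = tens_eval (\<lambda>xs v. tensor_eval (\<lambda>a b. ?\<Phi> [a, b] v) (uea_comult (hd xs))) (\<rho> v)"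
    by (rule comult_id_eval[OF cmodule coaction_closed[OF v] \<Phi>])
  also have "\<dots> = l (act (conv \<xi> \<zeta>) v)"
    by (simp add: act_eval[OF v l] tensor_eval_scaleC_left conv_def)
  finally show "l (act \<zeta> (act \<xi> v)) = l (act (conv \<xi> \<zeta>) v)" .
qed (simp_all add: act_closed v)

end

section \<open>Lie coactions in coordinates\<close>

text \<open>Words of length \<open>n\<close> with letters in \<open>B\<close>.\<close>

definition words :: "'b set \<Rightarrow> nat \<Rightarrow> 'b list set" where
  "words B n = {w. set w \<subseteq> B \<and> length w = n}"

lemma words_0 [simp]: "words B 0 = {[]}"
  by (auto simp: words_def)

lemma words_length: "w \<in> words B n \<Longrightarrow> length w = n"
  by (auto simp: words_def)

lemma sum_words_Suc: "(\<Sum>w\<in>words B (Suc n). f w) = (\<Sum>b\<in>B. \<Sum>w\<in>words B n. f (b # w))"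
proof -
  have "(\<Sum>w\<in>words B (Suc n). f w) = (\<Sum>(b, w)\<in>B \<times> words B n. f (b # w))"
    by (rule sum.reindex_bij_witness[of _ "\<lambda>(b, w). b # w" "\<lambda>w. (hd w, tl w)"])
      (auto simp: words_def length_Suc_conv)
  then show ?thesis by (simp add: sum.cartesian_product)
qed

lemma sum_words_Suc_right: "(\<Sum>w\<in>words B (Suc n). f w) = (\<Sum>w\<in>words B n. \<Sum>b\<in>B. f (w @ [b]))"
proof -
  have "(\<Sum>w\<in>words B (Suc n). f w) = (\<Sum>(w, b)\<in>words B n \<times> B. f (w @ [b]))"
    by (rule sum.reindex_bij_witness[of _ "\<lambda>(w, b). w @ [b]" "\<lambda>w. (butlast w, last w)"])
      (auto simp: words_def length_Suc_conv_rev)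
  then show ?thesis by (simp add: sum.cartesian_product)
qed

text \<open>A finite basis of the Lie algebra.\<close>

locale lie_basis =
  fixes B :: "'g::complex_lie_algebra set"
  assumes finite_B: "finite B" and independent_B: "complex_vector.independent B"
    and span_B: "complex_vector.span B = UNIV"
begin

text \<open>The coordinate functional of the basis element \<open>b\<close>.\<close>

definition coord :: "'g \<Rightarrow> 'g \<Rightarrow> complex" where
  "coord b x = complex_vector.representation B x b"

lemma lin_coord: "lin (coord b)"
  using complex_vector.representation_add[OF independent_B] complex_vector.representation_scale[OF independent_B]
  by (intro linI) (simp_all add: coord_def span_B scaleC_complex_def)

lemma sum_coord: "(\<Sum>b\<in>B. coord b x *\<^sub>C b) = x"
  unfolding coord_def
  by (rule complex_vector.sum_representation_eq[OF independent_B _ finite_B]) (auto simp: span_B)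

lemma coord_basis: "a \<in> B \<Longrightarrow> coord b a = (if b = a then 1 else 0)"
  by (auto simp: coord_def complex_vector.representation_basis[OF independent_B])

lemma lin_expand: "lin f \<Longrightarrow> f x = (\<Sum>b\<in>B. coord b x *\<^sub>C f b)"
  by (subst sum_coord[symmetric, of x]) (simp add: lin_sum lin_scaleC)

lemma finite_words: "finite (words B n)"
  unfolding words_def by (rule finite_lists_length_eq[OF finite_B])

lemma uea_power_expand:
  "uea_embed x ^ n = (\<Sum>w\<in>words B n. prod_list (map (\<lambda>b. coord b x) w) *\<^sub>C uea_word w)"
proof (induction n)
  case (Suc n)
  have "lin uea_embed" by (intro linI uea_embed_linear)
  then have "uea_embed x = (\<Sum>b\<in>B. coord b x *\<^sub>C uea_embed b)" by (rule lin_expand)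
  then have "uea_embed x ^ Suc n = (\<Sum>b\<in>B. coord b x *\<^sub>C uea_embed b)
      * (\<Sum>w\<in>words B n. prod_list (map (\<lambda>b. coord b x) w) *\<^sub>C uea_word w)"
    using Suc by simp
  then show ?case
    by (simp add: sum_words_Suc sum_product mult_scaleC_left mult_scaleC_right mult.commute)
qed (simp add: scaleC_one)

text \<open>The convolution product of the functionals \<open>coord b \<circ> log\<close> for the letters \<open>b\<close> of a word.\<close>

abbreviation conv_word :: "'g list \<Rightarrow> 'g uea \<Rightarrow> complex" where
  "conv_word w \<equiv> conv_logs (map coord w)"

lemma lin_conv_word: "lin (conv_word w)"
  by (rule lin_conv_logs) (auto simp: lin_coord)

lemma conv_word_power:
  "conv_word w (uea_embed x ^ m) = (if m = length w then fact m * prod_list (map (\<lambda>b. coord b x) w) else 0)"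
  by (subst conv_logs_power) (auto simp: lin_coord o_def)

lemma conv_word_vanishes: "\<exists>N. \<forall>w. N \<le> length w \<longrightarrow> conv_word w u = 0"
proof (induction u rule: uea_power_induct)
  case (add u v)
  then obtain N1 N2 where "\<forall>w. N1 \<le> length w \<longrightarrow> conv_word w u = 0" "\<forall>w. N2 \<le> length w \<longrightarrow> conv_word w v = 0"
    by blast
  then show ?case by (intro exI[of _ "max N1 N2"]) (simp add: lin_add[OF lin_conv_word])
next
  case (scaleC c u)
  then show ?case by (auto simp: lin_scaleC[OF lin_conv_word])
next
  case (power x m)
  then show ?case by (intro exI[of _ "Suc m"]) (simp add: conv_word_power)
qed

text \<open>The convolution exponential of the logarithm is the identity. The sum stabilizes for each \<open>u\<close>
because a convolution product of more than \<open>m\<close> logarithms vanishes on an \<open>m\<close>-th power.\<close>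

lemma conv_exp_log:
  "\<exists>N. \<forall>M\<ge>N. (\<Sum>n<M. inverse (fact n) *\<^sub>C (\<Sum>w\<in>words B n. conv_word w u *\<^sub>C uea_word w)) = u"
proof (induction u rule: uea_power_induct)
  case (add u v)
  then obtain N1 N2 where
    "\<forall>M\<ge>N1. (\<Sum>n<M. inverse (fact n) *\<^sub>C (\<Sum>w\<in>words B n. conv_word w u *\<^sub>C uea_word w)) = u"
    "\<forall>M\<ge>N2. (\<Sum>n<M. inverse (fact n) *\<^sub>C (\<Sum>w\<in>words B n. conv_word w v *\<^sub>C uea_word w)) = v"
    by blast
  then show ?case
    by (intro exI[of _ "max N1 N2"])
      (simp add: lin_add[OF lin_conv_word] scaleC_add_left scaleC_add_right sum.distrib)
next
  case (scaleC c u)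
  then obtain N where
    N: "\<forall>M\<ge>N. (\<Sum>n<M. inverse (fact n) *\<^sub>C (\<Sum>w\<in>words B n. conv_word w u *\<^sub>C uea_word w)) = u" by blast
  have "inverse (fact n) *\<^sub>C (\<Sum>w\<in>words B n. conv_word w (c *\<^sub>C u) *\<^sub>C uea_word w)
      = c *\<^sub>C (inverse (fact n) *\<^sub>C (\<Sum>w\<in>words B n. conv_word w u *\<^sub>C uea_word w))" for n
    by (simp add: lin_scaleC[OF lin_conv_word] complex_vector.scale_sum_right scaleC_complex_def ac_simps)
  then have "(\<Sum>n<M. inverse (fact n) *\<^sub>C (\<Sum>w\<in>words B n. conv_word w (c *\<^sub>C u) *\<^sub>C uea_word w))
      = c *\<^sub>C (\<Sum>n<M. inverse (fact n) *\<^sub>C (\<Sum>w\<in>words B n. conv_word w u *\<^sub>C uea_word w))" for M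
    by (simp only: complex_vector.scale_sum_right)
  then show ?case using N by (intro exI[of _ N] allI impI) (simp only: simp_thms)
next
  case (power x m)
  have "inverse (fact n) *\<^sub>C (\<Sum>w\<in>words B n. conv_word w (uea_embed x ^ m) *\<^sub>C uea_word w)
      = (if n = m then uea_embed x ^ m else 0)" for n
  proof (cases "n = m")
    case True
    then have "(\<Sum>w\<in>words B n. conv_word w (uea_embed x ^ m) *\<^sub>C uea_word w)
        = (\<Sum>w\<in>words B n. fact m *\<^sub>C (prod_list (map (\<lambda>b. coord b x) w) *\<^sub>C uea_word w))"
      by (intro sum.cong) (auto simp: conv_word_power words_length)
    also have "\<dots> = fact m *\<^sub>C uea_embed x ^ m"
      using True by (simp only: complex_vector.scale_sum_right[symmetric] uea_power_expand)
    finally show ?thesis using True by (simp add: scaleC_one)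
  next
    case False
    then have "(\<Sum>w\<in>words B n. conv_word w (uea_embed x ^ m) *\<^sub>C uea_word w) = 0"
      by (intro sum.neutral) (auto simp: conv_word_power words_length)
    then show ?thesis using False by simp
  qed
  then show ?case by (intro exI[of _ "Suc m"]) (auto simp: sum.delta)
qed

end

text \<open>A linear map \<open>V \<rightarrow> \<gg> \<otimes> V\<close> together with a basis of \<open>\<gg>\<close>.\<close>

locale lie_coaction = lie_basis B + coaction V \<delta>
  for B :: "'g::complex_lie_algebra set" and V :: "'v cspace" and \<delta> :: "'v \<Rightarrow> ('g, 'v) tens"
begin

text \<open>The components of \<open>\<delta>\<close>: one has \<open>\<delta> v = \<Sum>b\<in>B. b \<otimes> D b v\<close>. Outside of the carrier \<open>D b\<close> is the
identity, so that commuting on \<open>V\<close> means commuting as functions.\<close>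

definition D :: "'g \<Rightarrow> 'v \<Rightarrow> 'v" where
  "D b v = (if v \<in> carrier V then act (coord b) v else v)"

text \<open>The operators of the letters of a word, the first letter being applied first.\<close>

abbreviation D_word :: "'g list \<Rightarrow> 'v \<Rightarrow> 'v" where
  "D_word \<equiv> fold D"

lemma D_closed: "v \<in> carrier V \<Longrightarrow> D b v \<in> carrier V"
  by (simp add: D_def act_closed)

lemma D_word_closed: "v \<in> carrier V \<Longrightarrow> D_word w v \<in> carrier V"
  by (induction w arbitrary: v) (simp_all add: D_closed)

lemma D_linear: "clinear_map V V (D b)"
  using act_linear[OF lin_coord[of b]] by (auto simp: clinear_map_def D_def)

lemma D_word_linear: "clinear_map V V (D_word w)"
proof (induction w)
  case (Cons b w)
  then show ?case using D_linear[of b] by (auto simp: clinear_map_def Pi_iff)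
qed (simp add: clinear_map_def)

lemma D_word_zero: "D_word w \<zero>\<^bsub>V\<^esub> = \<zero>\<^bsub>V\<^esub>"
proof (rule cmodule_eqI[OF cmodule])
  fix l :: "'v \<Rightarrow> 'v \<Rightarrow>\<^sub>0 complex" assume l: "lin_on V l"
  show "l (D_word w \<zero>\<^bsub>V\<^esub>) = l \<zero>\<^bsub>V\<^esub>"
    using lin_on_zero[OF lin_on_comp[OF D_word_linear l] cmodule] lin_on_zero[OF l cmodule] by simp
qed (simp_all add: D_word_closed)

lemma coaction_expand:
  assumes v: "v \<in> carrier V" and \<Phi>: "multilin 1 V \<Phi>"
  shows "tens_eval \<Phi> (\<delta> v) = (\<Sum>b\<in>B. \<Phi> [b] (D b v))"
proof -
  have l: "lin_on V (\<Phi> [b])" for b using \<Phi> unfolding multilin_1_iff by blast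
  have "tens_eval \<Phi> (\<delta> v) = tens_eval (\<lambda>xs u. \<Sum>b\<in>B. coord b (hd xs) *\<^sub>C \<Phi> [b] u) (\<delta> v)"
  proof (rule tens_eval_cong[OF cmodule coaction_closed[OF v]])
    fix xs :: "'g list" and u assume "length xs = 1" and u: "u \<in> carrier V"
    then obtain x where x: "xs = [x]" by (auto simp: length_Suc_conv)
    have "lin (\<lambda>x. \<Phi> [x] u)" using \<Phi> u unfolding multilin_1_iff by blast
    from lin_expand[OF this, of x] show "\<Phi> xs u = (\<Sum>b\<in>B. coord b (hd xs) *\<^sub>C \<Phi> [b] u)"
      by (simp add: x)
  qed
  also have "\<dots> = (\<Sum>b\<in>B. tens_eval (\<lambda>xs u. coord b (hd xs) *\<^sub>C \<Phi> [b] u) (\<delta> v))"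
    by (rule tens_eval_sum)
  also have "\<dots> = (\<Sum>b\<in>B. \<Phi> [b] (D b v))"
    by (intro sum.cong refl) (simp add: D_def v act_eval[OF v l])
  finally show ?thesis .
qed

lemma id_coaction_expand:
  assumes v: "v \<in> carrier V" and \<Phi>: "multilin 2 V \<Phi>"
  shows "tens_eval \<Phi> (id_coaction 1 V \<delta> (\<delta> v)) = (\<Sum>a\<in>B. \<Sum>b\<in>B. \<Phi> [a, b] (D b (D a v)))"
proof -
  have \<Phi>': "multilin (Suc 1) V \<Phi>" using \<Phi> by (simp add: numeral_2_eq_2)
  have 1: "multilin 1 V (\<lambda>ys w. \<Phi> ([a] @ ys) w)" for a
    by (rule multilin_append[OF \<Phi>']) simp
  have "tens_eval \<Phi> (id_coaction 1 V \<delta> (\<delta> v))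
      = tens_eval (\<lambda>xs u. tens_eval (\<lambda>ys w. \<Phi> (xs @ ys) w) (\<delta> u)) (\<delta> v)"
    by (rule id_coaction_eval[OF coaction_closed[OF v] \<Phi>'])
  also have "\<dots> = tens_eval (\<lambda>xs u. \<Sum>b\<in>B. \<Phi> [hd xs, b] (D b u)) (\<delta> v)"
    by (rule tens_eval_cong[OF cmodule coaction_closed[OF v]])
      (auto simp: length_Suc_conv coaction_expand[OF _ 1, simplified])
  also have "\<dots> = (\<Sum>a\<in>B. \<Sum>b\<in>B. \<Phi> [a, b] (D b (D a v)))"
  proof (subst coaction_expand[OF v])
    show "multilin 1 V (\<lambda>xs u. \<Sum>b\<in>B. \<Phi> [hd xs, b] (D b u))"
      using \<Phi> unfolding multilin_2_iff
      by (intro multilin_1I lin_sum_fun lin_on_sum) (auto intro: D_closed lin_on_comp[OF D_linear])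
  qed simp
  finally show ?thesis .
qed

lemma iterated_coaction_expand:
  assumes v: "v \<in> carrier V" and \<Phi>: "multilin n V \<Phi>"
  shows "tens_eval \<Phi> (iterated_coaction n V \<delta> v) = (\<Sum>w\<in>words B n. \<Phi> w (D_word w v))"
  using \<Phi>
proof (induction n arbitrary: \<Phi>)
  case 0
  then show ?case by (simp add: tens_eval_pure[OF 0])
next
  case (Suc n)
  have \<Phi>': "multilin n V (\<lambda>xs u. \<Sum>b\<in>B. \<Phi> (xs @ [b]) (D b u))"
    unfolding multilin_def
  proof (intro conjI allI impI ballI)
    fix xs ys :: "'g list" and u assume "length xs + length ys + 1 = n" "u \<in> carrier V"
    then show "lin (\<lambda>x. \<Sum>b\<in>B. \<Phi> ((xs @ x # ys) @ [b]) (D b u))"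
      using multilinD(1)[OF Suc.prems, of xs "ys @ [b]" "D b u" for b] by (intro lin_sum_fun) (simp add: D_closed)
  next
    fix xs :: "'g list" assume "length xs = n"
    then show "lin_on V (\<lambda>u. \<Sum>b\<in>B. \<Phi> (xs @ [b]) (D b u))"
      using multilinD(2)[OF Suc.prems] by (intro lin_on_sum lin_on_comp[OF D_linear]) simp
  qed
  have "tens_eval \<Phi> (iterated_coaction (Suc n) V \<delta> v)
      = tens_eval (\<lambda>xs u. tens_eval (\<lambda>ys w. \<Phi> (xs @ ys) w) (\<delta> u)) (iterated_coaction n V \<delta> v)"
    by (simp add: id_coaction_eval[OF iterated_coaction_closed[OF v] Suc.prems])
  also have "\<dots> = tens_eval (\<lambda>xs u. \<Sum>b\<in>B. \<Phi> (xs @ [b]) (D b u)) (iterated_coaction n V \<delta> v)"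
    by (rule tens_eval_cong[OF cmodule iterated_coaction_closed[OF v]])
      (rule coaction_expand[OF _ multilin_append[OF Suc.prems]])
  also have "\<dots> = (\<Sum>w\<in>words B (Suc n). \<Phi> w (D_word w v))"
    by (simp add: Suc.IH[OF \<Phi>'] sum_words_Suc_right)
  finally show ?case .
qed

lemma lie_comodule_iff:
  "lie_comodule (V, \<delta>) \<longleftrightarrow> (\<forall>v\<in>carrier V. \<forall>a\<in>B. \<forall>b\<in>B. D a (D b v) = D b (D a v))"
proof
  assume lie: "lie_comodule (V, \<delta>)"
  show "\<forall>v\<in>carrier V. \<forall>a\<in>B. \<forall>b\<in>B. D a (D b v) = D b (D a v)"
  proof (intro ballI)
    fix v a b assume v: "v \<in> carrier V" and ab: "a \<in> B" "b \<in> B"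
    have "lin (coord a)" "lin (coord b)" by (rule lin_coord)+
    then have "bilin (\<lambda>x y. coord a x * coord b y - coord b x * coord a y)"
      by (auto simp: bilin_def lin_def scaleC_complex_def algebra_simps)
    \<comment> \<open>Contract the first tensor factor with the alternating form \<open>coord a \<and> coord b\<close>.\<close>
    from ex_exterior2_functional[OF this] obtain \<omega> where
      \<omega>: "lin \<omega>" "\<And>x y. \<omega> (wedge x y) = coord a x * coord b y - coord b x * coord a y" by auto
    show "D a (D b v) = D b (D a v)"
    proof (rule cmodule_eqI[OF cmodule])
      fix l :: "'v \<Rightarrow> 'v \<Rightarrow>\<^sub>0 complex" assume l: "lin_on V l"
      let ?\<Phi> = "\<lambda>xs v. \<omega> (hd xs) *\<^sub>C l v"
      have \<Phi>: "multilin 1 V ?\<Phi>" by (rule multilin_contract[OF \<omega>(1) l])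
      have "0 = tens_eval ?\<Phi> (wedge_id V (id_coaction 1 V \<delta> (\<delta> v)))"
        using lie v by (simp add: lie_comodule_def tens_eval_zero[OF \<Phi>, simplified])
      also have "\<dots> = tens_eval (\<lambda>xs v. ?\<Phi> [wedge (xs ! 0) (xs ! 1)] v) (id_coaction 1 V \<delta> (\<delta> v))"
        using id_coaction_closed[OF coaction_closed[OF v]]
        by (intro wedge_id_eval[OF cmodule _ \<Phi>]) (simp add: numeral_2_eq_2)
      also have "\<dots> = (\<Sum>x\<in>B. \<Sum>y\<in>B. ?\<Phi> [wedge x y] (D y (D x v)))"
        by (subst id_coaction_expand[OF v multilin_wedge[OF \<Phi>]]) simp
      also have "\<dots> = (\<Sum>x\<in>B. \<Sum>y\<in>B. (coord a x * coord b y) *\<^sub>C l (D y (D x v)))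
          - (\<Sum>x\<in>B. \<Sum>y\<in>B. (coord b x * coord a y) *\<^sub>C l (D y (D x v)))"
        by (simp add: \<omega>(2) complex_vector.scale_left_diff_distrib sum_subtractf)
      also have "\<dots> = l (D b (D a v)) - l (D a (D b v))"
      proof -
        have "(\<Sum>x\<in>B. \<Sum>y\<in>B. (coord c x * coord d y) *\<^sub>C l (D y (D x v))) = l (D d (D c v))"
          if "c \<in> B" "d \<in> B" for c d
        proof -
          have "(coord c x * coord d y) *\<^sub>C l (D y (D x v))
              = (if x = c then if y = d then l (D d (D c v)) else 0 else 0)" if "x \<in> B" "y \<in> B" for x y
            using that by (auto simp: coord_basis scaleC_one)
          then have "(\<Sum>y\<in>B. (coord c x * coord d y) *\<^sub>C l (D y (D x v)))
              = (if x = c then l (D d (D c v)) else 0)" if "x \<in> B" for x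
            using that \<open>d \<in> B\<close> finite_B by (cases "x = c") (simp_all add: sum.delta)
          then show ?thesis using \<open>c \<in> B\<close> finite_B by (simp add: sum.delta)
        qed
        then show ?thesis using ab by simp
      qed
      finally show "l (D a (D b v)) = l (D b (D a v))" by simp
    qed (simp_all add: D_closed v)
  qed
next
  assume comm: "\<forall>v\<in>carrier V. \<forall>a\<in>B. \<forall>b\<in>B. D a (D b v) = D b (D a v)"
  show "lie_comodule (V, \<delta>)"
    unfolding lie_comodule_def prod.case
  proof (intro conjI ballI linear_coaction)
    fix v assume v: "v \<in> carrier V"
    have c2: "id_coaction 1 V \<delta> (\<delta> v) \<in> carrier (tens 2 V)"
      using id_coaction_closed[OF coaction_closed[OF v]] by (simp add: numeral_2_eq_2)
    show "wedge_id V (id_coaction 1 V \<delta> (\<delta> v)) = \<zero>\<^bsub>tens 1 V\<^esub>"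
    proof (rule tens_eqI[of _ 1 V])
      fix \<Phi> :: "'g exterior2 list \<Rightarrow> 'v \<Rightarrow> ('g exterior2 list \<times> 'v \<Rightarrow>\<^sub>0 complex)"
      assume \<Phi>: "multilin 1 V \<Phi>"
      let ?S = "\<Sum>x\<in>B. \<Sum>y\<in>B. \<Phi> [wedge x y] (D y (D x v))"
      have "?S = (\<Sum>y\<in>B. \<Sum>x\<in>B. \<Phi> [wedge x y] (D y (D x v)))" by (rule sum.swap)
      also have "\<dots> = (\<Sum>y\<in>B. \<Sum>x\<in>B. - \<Phi> [wedge y x] (D x (D y v)))"
      proof (intro sum.cong refl)
        fix x y assume xy: "y \<in> B" "x \<in> B"
        have "lin (\<lambda>s. \<Phi> [s] (D x (D y v)))" using \<Phi> v unfolding multilin_1_iff by (simp add: D_closed)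
        from lin_diff[OF this, of 0 "wedge y x"] lin_zero[OF this]
        show "\<Phi> [wedge x y] (D y (D x v)) = - \<Phi> [wedge y x] (D x (D y v))"
          using comm v xy by (simp add: wedge_anti[of x y])
      qed
      also have "\<dots> = - ?S" by (simp add: sum_negf)
      finally have "?S + ?S = 0" by (simp add: eq_neg_iff_add_eq_0)
      then have "2 *\<^sub>C ?S = 0" using scaleC_add_left[of 1 1 ?S] by (simp add: scaleC_one)
      then have "?S = 0" by simp
      then have "tens_eval \<Phi> (wedge_id V (id_coaction 1 V \<delta> (\<delta> v))) = 0"
        using id_coaction_expand[OF v multilin_wedge[OF \<Phi>]]
        by (simp add: wedge_id_eval[OF cmodule c2 \<Phi>] \<open>?S = 0\<close> del: One_nat_def)
      then show "tens_eval \<Phi> (wedge_id V (id_coaction 1 V \<delta> (\<delta> v))) = tens_eval \<Phi> \<zero>\<^bsub>tens 1 V\<^esub>"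
        using tens_eval_zero[OF \<Phi>] by simp
    qed (auto simp: tens_zero intro!: wedge_id_closed[OF cmodule c2, simplified] tens_coset_closed)
  qed
qed

text \<open>The functional on \<open>\<gg>\<^sup>\<otimes>\<^sup>n\<close> that is dual to the basis tensor of the word \<open>w\<close>, tensored with \<open>l\<close>.\<close>

lemma multilin_coord_word:
  assumes "length w = n" and l: "lin_on V l"
  shows "multilin n V (\<lambda>xs v. prod_list (map2 coord w xs) *\<^sub>C l v)"
  unfolding multilin_def
proof (intro conjI allI impI ballI lin_on_scaleC l)
  fix xs ys :: "'g list" and v assume len: "length xs + length ys + 1 = n"
  define w1 b w2 where "w1 = take (length xs) w" "b = w ! length xs" "w2 = drop (Suc (length xs)) w"
  have w: "w = w1 @ b # w2" unfolding w1_b_w2_def using assms len by (intro id_take_nth_drop) simp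
  have l1: "length w1 = length xs" using assms len by (simp add: w1_b_w2_def)
  show "lin (\<lambda>x. prod_list (map2 coord w (xs @ x # ys)) *\<^sub>C l v)"
    using l1 lin_coord[of b]
    by (intro lin_scaleC_left) (simp add: w lin_def scaleC_complex_def algebra_simps)
qed

lemma iterated_coaction_eq_zero_iff:
  assumes v: "v \<in> carrier V"
  shows "iterated_coaction n V \<delta> v = \<zero>\<^bsub>tens n V\<^esub> \<longleftrightarrow> (\<forall>w\<in>words B n. D_word w v = \<zero>\<^bsub>V\<^esub>)"
proof
  assume *: "iterated_coaction n V \<delta> v = \<zero>\<^bsub>tens n V\<^esub>"
  show "\<forall>w\<in>words B n. D_word w v = \<zero>\<^bsub>V\<^esub>"
  proof
    fix w assume w: "w \<in> words B n"
    show "D_word w v = \<zero>\<^bsub>V\<^esub>"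
    proof (rule cmodule_eqI[OF cmodule])
      fix l :: "'v \<Rightarrow> 'v \<Rightarrow>\<^sub>0 complex" assume l: "lin_on V l"
      let ?\<Phi> = "\<lambda>xs v. prod_list (map2 coord w xs) *\<^sub>C l v"
      have \<Phi>: "multilin n V ?\<Phi>" using w by (intro multilin_coord_word l) (simp add: words_length)
      have delta: "prod_list (map2 coord w w') = (if w = w' then 1 else 0)"
        if "length w' = length w" "set w' \<subseteq> B" for w' w :: "'g list"
        using that
      proof (induction w' w rule: list_induct2)
        case (Cons x xs y ys)
        then show ?case by (simp add: coord_basis)
      qed simp
      have "l (D_word w v) = (\<Sum>w'\<in>words B n. if w' = w then l (D_word w v) else 0)"
        using w by (simp add: sum.delta' finite_words sum.delta)
      also have "\<dots> = (\<Sum>w'\<in>words B n. ?\<Phi> w' (D_word w' v))"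
        using w by (intro sum.cong refl) (auto simp: delta words_def scaleC_one)
      also have "\<dots> = l \<zero>\<^bsub>V\<^esub>"
        using iterated_coaction_expand[OF v \<Phi>] * tens_eval_zero[OF \<Phi>] lin_on_zero[OF l cmodule] by simp
      finally show "l (D_word w v) = l \<zero>\<^bsub>V\<^esub>" .
    qed (simp_all add: D_word_closed v)
  qed
next
  assume *: "\<forall>w\<in>words B n. D_word w v = \<zero>\<^bsub>V\<^esub>"
  show "iterated_coaction n V \<delta> v = \<zero>\<^bsub>tens n V\<^esub>"
  proof (rule tens_eqI)
    fix \<Phi> :: "'g list \<Rightarrow> 'v \<Rightarrow> ('g list \<times> 'v \<Rightarrow>\<^sub>0 complex)" assume \<Phi>: "multilin n V \<Phi>"
    have "\<Phi> w (D_word w v) = 0" if "w \<in> words B n" for w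
      using * that lin_on_zero[OF multilinD(2)[OF \<Phi>, of w] cmodule] by (simp add: words_length)
    then show "tens_eval \<Phi> (iterated_coaction n V \<delta> v) = tens_eval \<Phi> \<zero>\<^bsub>tens n V\<^esub>"
      by (simp add: iterated_coaction_expand[OF v \<Phi>] tens_eval_zero[OF \<Phi>])
  qed (auto simp: iterated_coaction_closed v tens_zero intro!: tens_coset_closed)
qed

lemma locally_conilpotent_iff:
  "locally_conilpotent (V, \<delta>) \<longleftrightarrow> (\<forall>v\<in>carrier V. \<exists>n. \<forall>w\<in>words B n. D_word w v = \<zero>\<^bsub>V\<^esub>)"
  by (simp add: locally_conilpotent_def iterated_coaction_eq_zero_iff)

end

lemma linear_coactionI:
  fixes V :: "'v cspace" and \<sigma> :: "'v \<Rightarrow> ('a::complex_vector, 'v) tens"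
  assumes "cspace V" "\<sigma> \<in> extensional (carrier V)" and closed: "\<And>v. v \<in> carrier V \<Longrightarrow> \<sigma> v \<in> carrier (tens 1 V)"
    and lin: "\<And>\<Phi> :: 'a list \<Rightarrow> 'v \<Rightarrow> ('a list \<times> 'v \<Rightarrow>\<^sub>0 complex). multilin 1 V \<Phi> \<Longrightarrow> lin_on V (\<lambda>v. tens_eval \<Phi> (\<sigma> v))"
  shows "linear_coaction (V, \<sigma>)"
proof -
  interpret V: Module.module "ring_of_type_algebra :: complex ring" V using assms(1) by (rule cspace_cmodule)
  interpret T: Module.module "ring_of_type_algebra :: complex ring" "tens 1 V :: ('a, 'v) tens cspace" by (rule cmodule_tens)
  have "clinear_map V (tens 1 V) \<sigma>"
    unfolding clinear_map_def
  proof (intro conjI ballI allI)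
    fix v w assume vw: "v \<in> carrier V" "w \<in> carrier V"
    show "\<sigma> (v \<oplus>\<^bsub>V\<^esub> w) = \<sigma> v \<oplus>\<^bsub>tens 1 V\<^esub> \<sigma> w"
    proof (rule tens_eqI[of _ 1 V])
      fix \<Phi> :: "'a list \<Rightarrow> 'v \<Rightarrow> ('a list \<times> 'v \<Rightarrow>\<^sub>0 complex)" assume \<Phi>: "multilin 1 V \<Phi>"
      show "tens_eval \<Phi> (\<sigma> (v \<oplus>\<^bsub>V\<^esub> w)) = tens_eval \<Phi> (\<sigma> v \<oplus>\<^bsub>tens 1 V\<^esub> \<sigma> w)"
        using vw by (simp add: lin_on_add[OF lin[OF \<Phi>]] lin_on_add[OF lin_on_tens_eval[OF \<Phi>]] closed del: One_nat_def)
    qed (use vw closed in \<open>simp_all del: One_nat_def\<close>)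
  next
    fix c v assume v: "v \<in> carrier V"
    show "\<sigma> (c \<odot>\<^bsub>V\<^esub> v) = c \<odot>\<^bsub>tens 1 V\<^esub> \<sigma> v"
    proof (rule tens_eqI[of _ 1 V])
      fix \<Phi> :: "'a list \<Rightarrow> 'v \<Rightarrow> ('a list \<times> 'v \<Rightarrow>\<^sub>0 complex)" assume \<Phi>: "multilin 1 V \<Phi>"
      show "tens_eval \<Phi> (\<sigma> (c \<odot>\<^bsub>V\<^esub> v)) = tens_eval \<Phi> (c \<odot>\<^bsub>tens 1 V\<^esub> \<sigma> v)"
        using v by (simp add: lin_on_smult[OF lin[OF \<Phi>]] lin_on_smult[OF lin_on_tens_eval[OF \<Phi>]] closed del: One_nat_def)
    qed (use v closed in \<open>simp_all del: One_nat_def\<close>)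
  qed (use closed in blast)
  then show ?thesis using assms(1,2) by (simp add: linear_coaction_def)
qed

lemma multilin_tens_map_left: "lin f \<Longrightarrow> multilin 1 V \<Phi> \<Longrightarrow> multilin 1 V (\<lambda>xs v. \<Phi> [f (hd xs)] v)"
  unfolding multilin_1_iff by (auto intro: lin_comp)

section \<open>From comodules over the enveloping algebra to Lie comodules\<close>

text \<open>The coaction \<open>(log \<otimes> id) \<circ> \<rho>\<close> of the Lie algebra, extended by \<open>undefined\<close> as coactions are.\<close>

definition log_coaction :: "'v cspace \<Rightarrow> ('v \<Rightarrow> ('g::complex_lie_algebra uea, 'v) tens) \<Rightarrow> 'v \<Rightarrow> ('g, 'v) tens" where
  "log_coaction V \<rho> = (\<lambda>v\<in>carrier V. tens_map_left V uea_log (\<rho> v))"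

lemma log_coaction_eval:
  assumes "linear_coaction (V, \<rho>)" "v \<in> carrier V" "multilin 1 V \<Phi>"
  shows "tens_eval \<Phi> (log_coaction V \<rho> v) = tens_eval (\<lambda>xs u. \<Phi> [uea_log (hd xs)] u) (\<rho> v)"
proof -
  interpret coaction V \<rho> by standard (rule assms)
  show ?thesis using assms(2,3) by (simp add: log_coaction_def tens_map_left_eval[OF cmodule coaction_closed])
qed

lemma linear_log_coaction:
  assumes "linear_coaction (V, \<rho>)"
  shows "linear_coaction (V, log_coaction V \<rho>)"
proof -
  interpret coaction V \<rho> by standard (rule assms)
  show ?thesis
  proof (rule linear_coactionI[OF cspace])
    show "log_coaction V \<rho> v \<in> carrier (tens 1 V)" if "v \<in> carrier V" for v
      using that tens_map_left_closed[OF cmodule coaction_closed] by (simp add: log_coaction_def)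
    fix \<Phi> :: "'b list \<Rightarrow> 'a \<Rightarrow> ('b list \<times> 'a \<Rightarrow>\<^sub>0 complex)" assume \<Phi>: "multilin 1 V \<Phi>"
    show "lin_on V (\<lambda>v. tens_eval \<Phi> (log_coaction V \<rho> v))"
      using lin_on_coaction[OF multilin_tens_map_left[OF lin_uea_log \<Phi>]]
      unfolding lin_on_def by (auto simp: log_coaction_eval[OF assms _ \<Phi>])
  qed (simp add: log_coaction_def)
qed

text \<open>A comodule over the enveloping algebra together with a basis of the Lie algebra.\<close>

locale uea_comodule_basis = lie_basis B + uea_comodule V \<rho>
  for B :: "'g::complex_lie_algebra set" and V :: "'v cspace" and \<rho> :: "'v \<Rightarrow> ('g uea, 'v) tens"
begin

sublocale log: lie_coaction B V "log_coaction V \<rho>"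
  by unfold_locales (rule linear_log_coaction[OF linear_coaction])

lemma log_D:
  assumes v: "v \<in> carrier V" shows "log.D b v = act (\<lambda>u. coord b (uea_log u)) v"
proof (rule cmodule_eqI[OF cmodule])
  fix l :: "'v \<Rightarrow> 'v \<Rightarrow>\<^sub>0 complex" assume l: "lin_on V l"
  show "l (log.D b v) = l (act (\<lambda>u. coord b (uea_log u)) v)"
    by (simp add: log.D_def v log.act_eval[OF v l] act_eval[OF v l]
        log_coaction_eval[OF linear_coaction v multilin_contract[OF lin_coord l]])
qed (simp_all add: log.D_closed act_closed v)

lemma log_D_word:
  assumes v: "v \<in> carrier V" shows "log.D_word w v = act (conv_word w) v"
  using v
proof (induction w arbitrary: v)
  case (Cons b w)
  then show ?case
    by (simp add: log.D_closed) (simp add: log_D act_act lin_comp[OF lin_coord lin_uea_log] lin_conv_word)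
qed (simp add: act_counit)

lemma lie_comodule_log: "lie_comodule (V, log_coaction V \<rho>)"
  unfolding log.lie_comodule_iff
proof (intro ballI)
  fix v a b assume v: "v \<in> carrier V"
  have "lin (\<lambda>u. coord a (uea_log u))" "lin (\<lambda>u. coord b (uea_log u))"
    by (rule lin_comp[OF lin_coord lin_uea_log])+
  then have "conv (\<lambda>u. coord b (uea_log u)) (\<lambda>u. coord a (uea_log u))
      = conv (\<lambda>u. coord a (uea_log u)) (\<lambda>u. coord b (uea_log u))"
    by (intro ext conv_commute)
  then show "log.D a (log.D b v) = log.D b (log.D a v)"
    using v by (simp add: log_D act_closed act_act lin_comp[OF lin_coord lin_uea_log])
qed

lemma locally_conilpotent_log: "locally_conilpotent (V, log_coaction V \<rho>)"
  unfolding log.locally_conilpotent_iff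
proof
  fix v assume v: "v \<in> carrier V"
  obtain N where N: "\<And>u w. N u \<le> length w \<Longrightarrow> conv_word w u = 0"
    using conv_word_vanishes by metis
  define M where "M = Max (N ` support (\<rho> v))"
  have "log.D_word w v = \<zero>\<^bsub>V\<^esub>" if w: "w \<in> words B M" for w
  proof (rule cmodule_eqI[OF cmodule])
    fix l :: "'v \<Rightarrow> 'v \<Rightarrow>\<^sub>0 complex" assume l: "lin_on V l"
    have "l (log.D_word w v) = tens_eval (\<lambda>xs u. conv_word w (hd xs) *\<^sub>C l u) (\<rho> v)"
      by (simp add: log_D_word v act_eval[OF v l])
    also have "\<dots> = tens_eval (\<lambda>xs u. 0) (\<rho> v)"
    proof (rule tens_eval_cong_support[OF cmodule coaction_closed[OF v]])
      fix x u assume "x \<in> support (\<rho> v)"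
      then have "N x \<le> length w"
        using w finite_support[of "\<rho> v"] Max_ge[of "N ` support (\<rho> v)" "N x"] by (simp add: M_def words_length)
      then show "conv_word w (hd [x]) *\<^sub>C l u = 0" using N by simp
    qed
    also have "\<dots> = l \<zero>\<^bsub>V\<^esub>" using lin_on_zero[OF l cmodule] by (simp add: tens_eval_def lin_ext_def split_def)
    finally show "l (log.D_word w v) = l \<zero>\<^bsub>V\<^esub>" .
  qed (simp_all add: log.D_word_closed v)
  then show "\<exists>n. \<forall>w\<in>words B n. log.D_word w v = \<zero>\<^bsub>V\<^esub>" by blast
qed

end

section \<open>From Lie comodules to comodules over the enveloping algebra\<close>

context lie_coaction
begin

text \<open>For a locally conilpotent coaction, the least length such that all words of this length kill \<open>v\<close>.\<close>

definition level :: "'v \<Rightarrow> nat" where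
  "level v = (LEAST n. \<forall>w\<in>words B n. D_word w v = \<zero>\<^bsub>V\<^esub>)"

text \<open>The exponential of \<open>\<delta>\<close>, cut off where its terms start to vanish for locally conilpotent \<open>\<delta>\<close>.\<close>

definition exp_coaction :: "'v \<Rightarrow> ('g uea, 'v) tens" where
  "exp_coaction = (\<lambda>v\<in>carrier V. tens_coset 1 V (\<Sum>n<level v. \<Sum>w\<in>words B n.
     Poly_Mapping.single ([uea_word w], D_word w v) (inverse (fact n))))"

text \<open>All words in the operators \<open>D b\<close> of length at least \<open>M\<close> vanish on \<open>v\<close>.\<close>

definition killed :: "nat \<Rightarrow> 'v \<Rightarrow> bool" where
  "killed M v \<longleftrightarrow> (\<forall>w. set w \<subseteq> B \<longrightarrow> M \<le> length w \<longrightarrow> D_word w v = \<zero>\<^bsub>V\<^esub>)"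

lemma killed_mono: "killed M v \<Longrightarrow> M \<le> N \<Longrightarrow> killed N v"
  by (auto simp: killed_def)

lemma killed_if_words:
  assumes "\<forall>w\<in>words B n. D_word w v = \<zero>\<^bsub>V\<^esub>" shows "killed n v"
  unfolding killed_def
proof (intro allI impI)
  fix w assume w: "set w \<subseteq> B" "n \<le> length w"
  then have "take n w \<in> words B n" using set_take_subset[of n w] by (auto simp: words_def)
  then have "D_word (take n w @ drop n w) v = \<zero>\<^bsub>V\<^esub>"
    using assms by (simp only: fold_append o_apply D_word_zero)
  then show "D_word w v = \<zero>\<^bsub>V\<^esub>" by simp
qed

lemma exp_coaction_closed:
  assumes v: "v \<in> carrier V" shows "exp_coaction v \<in> carrier (tens 1 V)"
proof -
  have sum_keys: "Poly_Mapping.keys (sum f A) \<subseteq> K" if "\<And>x. x \<in> A \<Longrightarrow> Poly_Mapping.keys (f x) \<subseteq> K"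
    for f :: "'z \<Rightarrow> ('g uea list \<times> 'v) \<Rightarrow>\<^sub>0 complex" and A K
    using that by (induction A rule: infinite_finite_induct) (auto intro!: keys_add_subset del: subsetI)
  have sum_keys': "Poly_Mapping.keys (sum f A) \<subseteq> K" if "\<And>x. x \<in> A \<Longrightarrow> Poly_Mapping.keys (f x) \<subseteq> K"
    for f :: "'y \<Rightarrow> ('g uea list \<times> 'v) \<Rightarrow>\<^sub>0 complex" and A K
    using that by (induction A rule: infinite_finite_induct) (auto intro!: keys_add_subset del: subsetI)
  show ?thesis using v D_word_closed[OF v]
    by (auto simp: exp_coaction_def intro!: tens_coset_closed sum_keys sum_keys' del: subsetI)
qed

end

text \<open>A locally conilpotent Lie comodule together with a basis of the Lie algebra.\<close>

locale lie_comodule_basis = lie_coaction B V \<delta>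
  for B :: "'g::complex_lie_algebra set" and V :: "'v cspace" and \<delta> :: "'v \<Rightarrow> ('g, 'v) tens" +
  assumes lie_comodule: "lie_comodule (V, \<delta>)" and conilpotent: "locally_conilpotent (V, \<delta>)"
begin

lemma D_commute: "a \<in> B \<Longrightarrow> b \<in> B \<Longrightarrow> D a (D b v) = D b (D a v)"
  using lie_comodule unfolding lie_comodule_iff by (cases "v \<in> carrier V") (auto simp: D_def)

lemma D_word_mset:
  assumes "mset w = mset w'" "set w \<subseteq> B" shows "D_word w = D_word w'"
proof (rule fold_multiset_equiv[OF _ assms(1)])
  fix a b assume "a \<in> set w" "b \<in> set w"
  then have "a \<in> B" "b \<in> B" using assms(2) by blast+
  then show "D a \<circ> D b = D b \<circ> D a" by (intro ext) (simp only: o_apply D_commute[of a b])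
qed

lemma killed_level:
  assumes "v \<in> carrier V" shows "killed (level v) v"
proof -
  have "\<exists>n. \<forall>w\<in>words B n. D_word w v = \<zero>\<^bsub>V\<^esub>"
    using conilpotent assms unfolding locally_conilpotent_iff by blast
  from killed_if_words[OF LeastI_ex[OF this]] show ?thesis unfolding level_def .
qed

text \<open>The sum may be cut off at any bound beyond which the operators vanish, not only at the level.\<close>

lemma exp_coaction_eval:
  assumes v: "v \<in> carrier V" and \<Phi>: "multilin 1 V \<Phi>" and M: "killed M v"
  shows "tens_eval \<Phi> (exp_coaction v)
    = (\<Sum>n<M. inverse (fact n) *\<^sub>C (\<Sum>w\<in>words B n. \<Phi> [uea_word w] (D_word w v)))"
proof -
  let ?t = "\<lambda>n. inverse (fact n) *\<^sub>C (\<Sum>w\<in>words B n. \<Phi> [uea_word w] (D_word w v))"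
  have lin: "lin (lin_ext (\<lambda>(xs, v). \<Phi> xs v))" by (intro linI) simp_all
  have zero: "?t n = 0" if "killed N v" "N \<le> n" for N n
  proof -
    have "\<Phi> [uea_word w] (D_word w v) = 0" if "w \<in> words B n" for w
    proof -
      have "D_word w v = \<zero>\<^bsub>V\<^esub>" using that \<open>killed N v\<close> \<open>N \<le> n\<close> by (auto simp: killed_def words_def)
      moreover have "lin_on V (\<Phi> [uea_word w])" using \<Phi> unfolding multilin_1_iff by blast
      ultimately show ?thesis using lin_on_zero[OF _ cmodule] by metis
    qed
    then show ?thesis by simp
  qed
  have "tens_eval \<Phi> (exp_coaction v) = (\<Sum>n<level v. ?t n)"
    using v by (simp add: exp_coaction_def tens_eval_coset[OF \<Phi>] lin_sum[OF lin] complex_vector.scale_sum_right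
        del: One_nat_def)
  also have "\<dots> = (\<Sum>n<max M (level v). ?t n)"
    using zero[OF killed_level[OF v]] by (intro sum.mono_neutral_left) auto
  also have "\<dots> = (\<Sum>n<M. ?t n)"
    using zero[OF M] by (intro sum.mono_neutral_right) auto
  finally show ?thesis .
qed

lemma killed_add:
  assumes "killed M v" "killed M w" "v \<in> carrier V" "w \<in> carrier V"
  shows "killed M (v \<oplus>\<^bsub>V\<^esub> w)"
  using assms D_word_linear by (auto simp: killed_def clinear_map_def)

lemma killed_smult:
  assumes "killed M v" "v \<in> carrier V" shows "killed M (c \<odot>\<^bsub>V\<^esub> v)"
  using assms D_word_linear V.smult_r_null[of c] by (auto simp: killed_def clinear_map_def)

lemma linear_exp_coaction: "linear_coaction (V, exp_coaction)"
proof (rule linear_coactionI[OF cspace _ exp_coaction_closed])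
  fix \<Phi> :: "'g uea list \<Rightarrow> 'v \<Rightarrow> ('g uea list \<times> 'v \<Rightarrow>\<^sub>0 complex)" assume \<Phi>: "multilin 1 V \<Phi>"
  have l: "lin_on V (\<lambda>v. \<Phi> [u] (D_word w v))" for u w
    using \<Phi> unfolding multilin_1_iff by (intro lin_on_comp[OF D_word_linear]) blast
  show "lin_on V (\<lambda>v. tens_eval \<Phi> (exp_coaction v))"
  proof (rule lin_onI)
    fix v w assume vw: "v \<in> carrier V" "w \<in> carrier V"
    define M where "M = max (level v) (level w)"
    have M: "killed M v" "killed M w" using killed_mono[OF killed_level] vw by (simp_all add: M_def)
    show "tens_eval \<Phi> (exp_coaction (v \<oplus>\<^bsub>V\<^esub> w)) = tens_eval \<Phi> (exp_coaction v) + tens_eval \<Phi> (exp_coaction w)"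
      using vw by (simp add: exp_coaction_eval[OF _ \<Phi> M(1)] exp_coaction_eval[OF _ \<Phi> M(2)]
          exp_coaction_eval[OF _ \<Phi> killed_add[OF M]] lin_on_add[OF l] sum.distrib scaleC_add_right)
  next
    fix c v assume v: "v \<in> carrier V"
    show "tens_eval \<Phi> (exp_coaction (c \<odot>\<^bsub>V\<^esub> v)) = c *\<^sub>C tens_eval \<Phi> (exp_coaction v)"
      using v by (simp add: exp_coaction_eval[OF v \<Phi> killed_level[OF v]]
          exp_coaction_eval[OF _ \<Phi> killed_smult[OF killed_level[OF v] v]]
          lin_on_smult[OF l] complex_vector.scale_sum_right mult.commute)
  qed
qed (simp_all only: exp_coaction_def restrict_extensional)

sublocale exp: coaction V exp_coaction
  by standard (rule linear_exp_coaction)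

text \<open>A primitive element multiplies a tensor in one factor at a time.\<close>

lemma tensor_eval_primitive_mult:
  assumes \<beta>: "bilin \<beta>"
  shows "tensor_eval \<beta> ((x \<otimes>\<^sub>C 1 + 1 \<otimes>\<^sub>C x) * t)
    = tensor_eval (\<lambda>a b. \<beta> (x * a) b) t + tensor_eval (\<lambda>a b. \<beta> a (x * b)) t"
proof -
  have \<beta>': "bilin (\<lambda>a b. \<beta> (x * a) b)" "bilin (\<lambda>a b. \<beta> a (x * b))"
    using \<beta> by (auto simp: bilin_def lin_def distrib_left mult_scaleC_right)
  show ?thesis
    by (induction t rule: tensor_induct)
      (simp_all add: distrib_left distrib_right tensor_pure_mult tensor_eval_simps[OF \<beta>] tensor_eval_simps[OF \<beta>'(1)]
        tensor_eval_simps[OF \<beta>'(2)])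
qed

text \<open>Comultiplying a word gives the sum of its unshuffles. Since the operators commute, an unshuffle
\<open>(w, w')\<close> enters with the operator of \<open>w @ w'\<close>, and each pair of lengths \<open>(i, n - i)\<close> occurs
\<open>n choose i\<close> times.\<close>

lemma sum_words_comult:
  fixes T :: "'g uea \<Rightarrow> 'g uea \<Rightarrow> 'v \<Rightarrow> 'x::complex_vector"
  assumes "\<And>v. v \<in> carrier V \<Longrightarrow> bilin (\<lambda>a b. T a b v)" "v \<in> carrier V"
  shows "(\<Sum>w\<in>words B n. tensor_eval (\<lambda>a b. T a b (D_word w v)) (uea_comult (uea_word w)))
    = (\<Sum>i\<le>n. of_nat (n choose i) *\<^sub>C
        (\<Sum>w\<in>words B i. \<Sum>w'\<in>words B (n - i). T (uea_word w) (uea_word w') (D_word (w @ w') v)))"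
  using assms
proof (induction n arbitrary: T v)
  case 0
  then show ?case by (simp add: uea_comult_hom one_tensor_eq tensor_eval_simps(3) scaleC_one)
next
  case (Suc n)
  define R where "R T i j v = (\<Sum>w\<in>words B i. \<Sum>w'\<in>words B j. T (uea_word w) (uea_word w') (D_word (w @ w') v))"
    for T :: "'g uea \<Rightarrow> 'g uea \<Rightarrow> 'v \<Rightarrow> 'x" and i j v
  let ?T1 = "\<lambda>b a c. T (uea_embed b * a) c" and ?T2 = "\<lambda>b a c. T a (uea_embed b * c)"
  have bil: "bilin (\<lambda>a c. ?T1 b a c v)" "bilin (\<lambda>a c. ?T2 b a c v)" if "v \<in> carrier V" for b v
    using Suc.prems(1)[OF that] by (auto simp: bilin_def lin_def distrib_left mult_scaleC_right)
  have R1: "(\<Sum>b\<in>B. R (?T1 b) i j (D b v)) = R T (Suc i) j v" for i j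
    by (simp add: R_def sum_words_Suc)
  have R2: "(\<Sum>b\<in>B. R (?T2 b) i j (D b v)) = R T i (Suc j) v" for i j
  proof -
    have "R T i (Suc j) v = (\<Sum>w\<in>words B i. \<Sum>b\<in>B. \<Sum>w'\<in>words B j.
        T (uea_word w) (uea_embed b * uea_word w') (D_word (w @ b # w') v))"
      by (simp add: R_def sum_words_Suc)
    also have "\<dots> = (\<Sum>w\<in>words B i. \<Sum>b\<in>B. \<Sum>w'\<in>words B j.
        T (uea_word w) (uea_embed b * uea_word w') (D_word (b # w @ w') v))"
    proof (intro sum.cong refl)
      fix w b w' assume "w \<in> words B i" "b \<in> B" "w' \<in> words B j"
      then have "D_word (w @ b # w') = D_word (b # w @ w')"
        by (intro D_word_mset) (auto simp: words_def)
      then show "T (uea_word w) (uea_embed b * uea_word w') (D_word (w @ b # w') v)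
        = T (uea_word w) (uea_embed b * uea_word w') (D_word (b # w @ w') v)" by simp
    qed
    also have "\<dots> = (\<Sum>b\<in>B. R (?T2 b) i j (D b v))"
      by (subst sum.swap) (simp add: R_def)
    finally show ?thesis ..
  qed
  have "(\<Sum>w\<in>words B (Suc n). tensor_eval (\<lambda>a b. T a b (D_word w v)) (uea_comult (uea_word w)))
      = (\<Sum>b\<in>B. \<Sum>w\<in>words B n. tensor_eval (\<lambda>a c. ?T1 b a c (D_word w (D b v))) (uea_comult (uea_word w))
          + tensor_eval (\<lambda>a c. ?T2 b a c (D_word w (D b v))) (uea_comult (uea_word w)))"
    using Suc.prems(2)
    by (simp add: sum_words_Suc uea_comult_hom tensor_eval_primitive_mult[OF Suc.prems(1)] D_word_closed D_closed)
  also have "\<dots> = (\<Sum>b\<in>B. (\<Sum>i\<le>n. of_nat (n choose i) *\<^sub>C R (?T1 b) i (n - i) (D b v))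
      + (\<Sum>i\<le>n. of_nat (n choose i) *\<^sub>C R (?T2 b) i (n - i) (D b v)))"
    unfolding R_def sum.distrib
    using Suc.IH[of "?T1 b" "D b v" for b, OF bil(1) D_closed[OF Suc.prems(2)]]
      Suc.IH[of "?T2 b" "D b v" for b, OF bil(2) D_closed[OF Suc.prems(2)]] by simp
  also have "\<dots> = (\<Sum>i\<le>n. of_nat (n choose i) *\<^sub>C (\<Sum>b\<in>B. R (?T1 b) i (n - i) (D b v)))
      + (\<Sum>i\<le>n. of_nat (n choose i) *\<^sub>C (\<Sum>b\<in>B. R (?T2 b) i (n - i) (D b v)))"
    unfolding sum.distrib complex_vector.scale_sum_right by (simp only: sum.swap[of _ B])
  also have "\<dots> = (\<Sum>i\<le>n. of_nat (n choose i) *\<^sub>C (R T (Suc i) (n - i) v + R T i (Suc n - i) v))"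
    unfolding R1 R2 by (simp add: scaleC_add_right sum.distrib Suc_diff_le)
  also have "\<dots> = (\<Sum>i\<le>Suc n. of_nat (Suc n choose i) *\<^sub>C R T i (Suc n - i) v)"
    by (rule sum_pascal[where r = "\<lambda>i j. R T i j v"])
  finally show ?case by (simp only: R_def)
qed

lemma exp_coaction_coassociative:
  assumes v: "v \<in> carrier V"
  shows "comult_id uea_comult V (exp_coaction v) = id_coaction 1 V exp_coaction (exp_coaction v)"
proof (rule tens_eqI[of _ 2 V])
  fix \<Phi> :: "'g uea list \<Rightarrow> 'v \<Rightarrow> ('g uea list \<times> 'v \<Rightarrow>\<^sub>0 complex)" assume \<Phi>: "multilin 2 V \<Phi>"
  have \<Phi>': "multilin (Suc 1) V \<Phi>" using \<Phi> by (simp add: numeral_2_eq_2)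
  have bil: "bilin (\<lambda>a b. \<Phi> [a, b] u)" if "u \<in> carrier V" for u
    using \<Phi> that unfolding multilin_2_iff bilin_def by blast
  define M where "M = level v"
  have M: "killed M v" using killed_level[OF v] by (simp add: M_def)
  have Mw: "killed M (D_word w v)" if "set w \<subseteq> B" for w
    unfolding killed_def
  proof (intro allI impI)
    fix w' assume "set w' \<subseteq> B" "M \<le> length w'"
    then have "D_word (w @ w') v = \<zero>\<^bsub>V\<^esub>" using M that by (simp add: killed_def del: fold_append)
    then show "D_word w' (D_word w v) = \<zero>\<^bsub>V\<^esub>" by simp
  qed
  \<comment> \<open>The contribution of pairs of words of lengths \<open>i\<close> and \<open>j\<close> to both sides; it vanishes for \<open>M \<le> i + j\<close>, so the triangle and the square of indices give the same sum.\<close>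
  define r where "r i j = inverse (fact i) *\<^sub>C inverse (fact j) *\<^sub>C
    (\<Sum>w\<in>words B i. \<Sum>w'\<in>words B j. \<Phi> [uea_word w, uea_word w'] (D_word (w @ w') v))" for i j
  have r0: "r i j = 0" if "M \<le> i + j" for i j
  proof -
    have "\<Phi> [uea_word w, uea_word w'] (D_word (w @ w') v) = 0" if "w \<in> words B i" "w' \<in> words B j" for w w'
    proof -
      have "D_word (w @ w') v = \<zero>\<^bsub>V\<^esub>" using M that \<open>M \<le> i + j\<close> by (simp add: killed_def words_def del: fold_append)
      moreover have "lin_on V (\<Phi> [uea_word w, uea_word w'])" using \<Phi> unfolding multilin_2_iff by blast
      ultimately show ?thesis using lin_on_zero[OF _ cmodule] by metis
    qed
    then show ?thesis by (simp add: r_def del: fold_append)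
  qed
  have "tens_eval \<Phi> (comult_id uea_comult V (exp_coaction v))
      = tens_eval (\<lambda>xs u. tensor_eval (\<lambda>a b. \<Phi> [a, b] u) (uea_comult (hd xs))) (exp_coaction v)"
    by (rule comult_id_eval[OF cmodule exp_coaction_closed[OF v] \<Phi>])
  also have "\<dots> = (\<Sum>n<M. inverse (fact n) *\<^sub>C
      (\<Sum>w\<in>words B n. tensor_eval (\<lambda>a b. \<Phi> [a, b] (D_word w v)) (uea_comult (uea_word w))))"
  proof (subst exp_coaction_eval[OF v _ M])
    show "multilin 1 V (\<lambda>xs u. tensor_eval (\<lambda>a b. \<Phi> [a, b] u) (uea_comult (hd xs)))"
    proof (rule multilin_1I)
      show "lin (\<lambda>x. tensor_eval (\<lambda>a b. \<Phi> [a, b] u) (uea_comult (hd [x])))" if "u \<in> carrier V" for u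
        by (intro linI) (simp_all add: uea_comult_hom tensor_eval_simps(1,2)[OF bil[OF that]])
      have l: "lin_on V (\<Phi> [a, b])" for a b using \<Phi> unfolding multilin_2_iff by blast
      show "lin_on V (\<lambda>u. tensor_eval (\<lambda>a b. \<Phi> [a, b] u) (uea_comult (hd [x])))" for x
        unfolding tensor_eval_def lin_ext_def split_def
        by (intro lin_on_sum lin_on_scaleC l)
    qed
  qed simp
  also have "\<dots> = (\<Sum>n<M. \<Sum>i\<le>n. r i (n - i))"
  proof (intro sum.cong refl)
    fix n
    have comult: "(\<Sum>w\<in>words B n. tensor_eval (\<lambda>a b. \<Phi> [a, b] (D_word w v)) (uea_comult (uea_word w)))
      = (\<Sum>i\<le>n. of_nat (n choose i) *\<^sub>C (\<Sum>w\<in>words B i. \<Sum>w'\<in>words B (n - i).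
          \<Phi> [uea_word w, uea_word w'] (D_word (w @ w') v)))"
      by (rule sum_words_comult[OF _ v]) (rule bil)
    have "inverse (fact n) *\<^sub>C of_nat (n choose i) *\<^sub>C x = inverse (fact i) *\<^sub>C inverse (fact (n - i)) *\<^sub>C x"
      if "i \<le> n" for i and x :: "'g uea list \<times> 'v \<Rightarrow>\<^sub>0 complex"
      using that by (simp add: binomial_fact field_simps)
    then show "inverse (fact n) *\<^sub>C (\<Sum>w\<in>words B n. tensor_eval (\<lambda>a b. \<Phi> [a, b] (D_word w v)) (uea_comult (uea_word w)))
      = (\<Sum>i\<le>n. r i (n - i))"
      unfolding comult complex_vector.scale_sum_right[of "inverse (fact n)" _ "{..n}"] r_def
      by (intro sum.cong refl) simp
  qed
  also have "\<dots> = (\<Sum>(i, j)\<in>{(i, j). i + j < M}. r i j)"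
    by (rule sum.triangle_reindex[symmetric])
  also have "\<dots> = (\<Sum>(i, j)\<in>{..<M} \<times> {..<M}. r i j)"
    by (rule sum.mono_neutral_left) (auto, metis r0 not_le)
  also have "\<dots> = (\<Sum>i<M. \<Sum>j<M. r i j)" by (simp add: sum.cartesian_product)
  also have "\<dots> = (\<Sum>i<M. inverse (fact i) *\<^sub>C (\<Sum>w\<in>words B i. \<Sum>j<M. inverse (fact j) *\<^sub>C
      (\<Sum>w'\<in>words B j. \<Phi> [uea_word w, uea_word w'] (D_word w' (D_word w v)))))"
    unfolding r_def by (simp add: complex_vector.scale_sum_right) (simp only: sum.swap[of _ "words B _" "{..<M}"])
  also have "\<dots> = (\<Sum>i<M. inverse (fact i) *\<^sub>C (\<Sum>w\<in>words B i.
      tens_eval (\<lambda>ys u. \<Phi> ([uea_word w] @ ys) u) (exp_coaction (D_word w v))))"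
  proof (intro sum.cong refl arg_cong2[where f = scaleC])
    fix i w assume "w \<in> words B i"
    then have "killed M (D_word w v)" by (intro Mw) (simp add: words_def)
    from exp_coaction_eval[OF D_word_closed[OF v] multilin_append[OF \<Phi>'] this, of "[uea_word w]"]
    show "(\<Sum>j<M. inverse (fact j) *\<^sub>C (\<Sum>w'\<in>words B j. \<Phi> [uea_word w, uea_word w'] (D_word w' (D_word w v))))
      = tens_eval (\<lambda>ys u. \<Phi> ([uea_word w] @ ys) u) (exp_coaction (D_word w v))" by simp
  qed
  also have "\<dots> = tens_eval (\<lambda>xs u. tens_eval (\<lambda>ys w. \<Phi> ([hd xs] @ ys) w) (exp_coaction u)) (exp_coaction v)"
  proof (subst exp_coaction_eval[OF v _ M])
    show "multilin 1 V (\<lambda>xs u. tens_eval (\<lambda>ys w. \<Phi> ([hd xs] @ ys) w) (exp_coaction u))"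
    proof (rule multilin_1I)
      show "lin_on V (\<lambda>u. tens_eval (\<lambda>ys w. \<Phi> ([hd [x]] @ ys) w) (exp_coaction u))" for x
        by (rule exp.lin_on_coaction[OF multilin_append[OF \<Phi>']]) simp
      fix u assume u: "u \<in> carrier V"
      have "lin (\<lambda>x. \<Phi> [x, y] w)" if "w \<in> carrier V" for y w
        using \<Phi> that unfolding multilin_2_iff by blast
      then have "lin (\<lambda>x. \<Sum>n<level u. inverse (fact n) *\<^sub>C (\<Sum>w\<in>words B n. \<Phi> [x, uea_word w] (D_word w u)))"
        using u by (intro lin_sum_fun lin_scaleC_right) (simp add: D_word_closed)
      moreover have "tens_eval (\<lambda>ys w. \<Phi> ([hd [x]] @ ys) w) (exp_coaction u)
          = (\<Sum>n<level u. inverse (fact n) *\<^sub>C (\<Sum>w\<in>words B n. \<Phi> [x, uea_word w] (D_word w u)))" for x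
        using exp_coaction_eval[OF u multilin_append[OF \<Phi>'] killed_level[OF u], of "[x]"] by simp
      ultimately show "lin (\<lambda>x. tens_eval (\<lambda>ys w. \<Phi> ([hd [x]] @ ys) w) (exp_coaction u))" by simp
    qed
  qed simp
  also have "\<dots> = tens_eval (\<lambda>xs u. tens_eval (\<lambda>ys w. \<Phi> (xs @ ys) w) (exp_coaction u)) (exp_coaction v)"
    by (rule tens_eval_cong[OF cmodule exp_coaction_closed[OF v]]) (auto simp: length_Suc_conv)
  also have "\<dots> = tens_eval \<Phi> (id_coaction 1 V exp_coaction (exp_coaction v))"
    by (rule exp.id_coaction_eval[OF exp_coaction_closed[OF v] \<Phi>', symmetric])
  finally show "tens_eval \<Phi> (comult_id uea_comult V (exp_coaction v))
    = tens_eval \<Phi> (id_coaction 1 V exp_coaction (exp_coaction v))" .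
qed (use comult_id_closed[OF cmodule exp_coaction_closed[OF v]]
    exp.id_coaction_closed[OF exp_coaction_closed[OF v]] in \<open>simp_all add: numeral_2_eq_2\<close>)

lemma exp_coaction_counital:
  assumes v: "v \<in> carrier V" shows "counit_id uea_counit V (exp_coaction v) = v"
proof (rule cmodule_eqI[OF cmodule])
  fix l :: "'v \<Rightarrow> 'v \<Rightarrow>\<^sub>0 complex" assume l: "lin_on V l"
  have counit: "uea_counit (uea_word w) = 0" if "w \<noteq> []" for w :: "'g list"
    using that by (cases w) (simp_all add: uea_counit_hom)
  have "l (counit_id uea_counit V (exp_coaction v)) = tens_eval (\<lambda>xs u. uea_counit (hd xs) *\<^sub>C l u) (exp_coaction v)"
    by (rule counit_id_eval[OF cmodule exp_coaction_closed[OF v] l])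
  also have "\<dots> = (\<Sum>n<Suc (level v). inverse (fact n) *\<^sub>C
      (\<Sum>w\<in>words B n. uea_counit (uea_word w) *\<^sub>C l (D_word w v)))"
    using exp_coaction_eval[OF v multilin_contract[OF lin_uea_counit l] killed_mono[OF killed_level[OF v]], of "Suc (level v)"]
    by simp
  \<comment> \<open>Only the empty word survives; the bound \<open>Suc (level v)\<close> includes it even when the level is zero.\<close>
  also have "\<dots> = (\<Sum>n<Suc (level v). if n = 0 then l v else 0)"
  proof (intro sum.cong refl)
    fix n
    have "(\<Sum>w\<in>words B n. uea_counit (uea_word w) *\<^sub>C l (D_word w v)) = 0" if "n \<noteq> 0"
      using that by (intro sum.neutral) (auto simp: words_def intro!: counit)
    then show "inverse (fact n) *\<^sub>C (\<Sum>w\<in>words B n. uea_counit (uea_word w) *\<^sub>C l (D_word w v))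
      = (if n = 0 then l v else 0)" by (simp add: uea_counit_hom scaleC_one)
  qed
  also have "\<dots> = l v" by (simp add: sum.delta del: sum.lessThan_Suc)
  finally show "l (counit_id uea_counit V (exp_coaction v)) = l v" .
qed (use v counit_id_closed[OF cmodule exp_coaction_closed[OF v]] in auto)

lemma exp_coaction_comodule: "coalgebra_comodule uea_comult uea_counit (V, exp_coaction)"
  by (simp add: coalgebra_comodule_def linear_exp_coaction exp_coaction_coassociative[simplified] exp_coaction_counital)

text \<open>As the operators commute, the sum can be symmetrized over the rearrangements of the words, and
the logarithm vanishes on symmetrized products.\<close>

lemma sum_words_log:
  fixes f :: "'g \<Rightarrow> 'v \<Rightarrow> 'x::complex_vector"
  assumes f: "\<And>v. v \<in> carrier V \<Longrightarrow> lin (\<lambda>x. f x v)" and v: "v \<in> carrier V" and n: "n \<ge> 2"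
  shows "(\<Sum>w\<in>words B n. f (uea_log (uea_word w)) (D_word w v)) = 0"
proof -
  let ?S = "\<Sum>w\<in>words B n. f (uea_log (uea_word w)) (D_word w v)"
  have perm: "?S = (\<Sum>w\<in>words B n. f (uea_log (uea_word (permute_list \<sigma> w))) (D_word w v))"
    if \<sigma>: "\<sigma> permutes {..<n}" for \<sigma>
  proof -
    have inv: "Hilbert_Choice.inv \<sigma> permutes {..<n}" by (rule permutes_inv[OF \<sigma>])
    have "?S = (\<Sum>w\<in>words B n. f (uea_log (uea_word (permute_list \<sigma> w))) (D_word (permute_list \<sigma> w) v))"
    proof (rule sum.reindex_bij_witness[of _ "permute_list \<sigma>" "permute_list (Hilbert_Choice.inv \<sigma>)"])
      fix w assume w: "w \<in> words B n"
      show "permute_list \<sigma> (permute_list (Hilbert_Choice.inv \<sigma>) w) = w"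
        "permute_list (Hilbert_Choice.inv \<sigma>) (permute_list \<sigma> w) = w"
        using w \<sigma> inv by (simp_all add: permute_list_compose[symmetric] words_length permutes_inv_o[OF \<sigma>])
      show "permute_list \<sigma> w \<in> words B n" "permute_list (Hilbert_Choice.inv \<sigma>) w \<in> words B n"
        using w \<sigma> inv by (auto simp: words_def)
    qed (use \<sigma> inv in \<open>simp add: permute_list_compose[symmetric] words_length permutes_inv_o[OF \<sigma>]\<close>)
    also have "\<dots> = (\<Sum>w\<in>words B n. f (uea_log (uea_word (permute_list \<sigma> w))) (D_word w v))"
    proof (intro sum.cong refl)
      fix w assume w: "w \<in> words B n"
      then have "D_word (permute_list \<sigma> w) = D_word w"
        using \<sigma> by (intro D_word_mset) (auto simp: words_def)
      then show "f (uea_log (uea_word (permute_list \<sigma> w))) (D_word (permute_list \<sigma> w) v)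
        = f (uea_log (uea_word (permute_list \<sigma> w))) (D_word w v)" by simp
    qed
    finally show ?thesis .
  qed
  have "fact n *\<^sub>C ?S = (\<Sum>\<sigma> | \<sigma> permutes {..<n}. ?S)"
    by (simp only: complex_vector.sum_constant_scale) (simp add: card_permutations)
  also have "\<dots> = (\<Sum>\<sigma> | \<sigma> permutes {..<n}. \<Sum>w\<in>words B n. f (uea_log (uea_word (permute_list \<sigma> w))) (D_word w v))"
    by (intro sum.cong refl perm) simp
  also have "\<dots> = (\<Sum>w\<in>words B n. f (\<Sum>\<sigma> | \<sigma> permutes {..<n}. uea_log (uea_word (permute_list \<sigma> w))) (D_word w v))"
    by (subst sum.swap) (simp add: lin_sum[OF f] D_word_closed v)
  also have "\<dots> = 0"
  proof (intro sum.neutral ballI)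
    fix w assume "w \<in> words B n"
    then have "(\<Sum>\<sigma> | \<sigma> permutes {..<n}. uea_log (uea_word (permute_list \<sigma> w))) = 0"
      using sum_uea_log_permutations[of w] n by (simp add: words_length)
    then show "f (\<Sum>\<sigma> | \<sigma> permutes {..<n}. uea_log (uea_word (permute_list \<sigma> w))) (D_word w v) = 0"
      using lin_zero[OF f[OF D_word_closed[OF v]]] by simp
  qed
  finally show ?thesis by simp
qed

lemma log_exp: "log_coaction V exp_coaction = \<delta>"
proof (rule extensionalityI)
  show "log_coaction V exp_coaction \<in> extensional (carrier V)" by (simp add: log_coaction_def)
  show "\<delta> \<in> extensional (carrier V)" by (rule coaction_ext)
  fix v assume v: "v \<in> carrier V"
  interpret log: coaction V "log_coaction V exp_coaction"
    by standard (rule linear_log_coaction[OF linear_exp_coaction])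
  show "log_coaction V exp_coaction v = \<delta> v"
  proof (rule tens_eqI[of _ 1 V])
    fix \<Phi> :: "'g list \<Rightarrow> 'v \<Rightarrow> ('g list \<times> 'v \<Rightarrow>\<^sub>0 complex)" assume \<Phi>: "multilin 1 V \<Phi>"
    \<comment> \<open>The bound has to include the term \<open>n = 1\<close>, the only one that contributes.\<close>
    define M where "M = Suc (Suc (level v))"
    have M: "killed M v" by (rule killed_mono[OF killed_level[OF v]]) (simp add: M_def)
    have lin: "lin (\<lambda>x. \<Phi> [x] u)" if "u \<in> carrier V" for u using \<Phi> that unfolding multilin_1_iff by blast
    let ?t = "\<lambda>n. inverse (fact n) *\<^sub>C (\<Sum>w\<in>words B n. \<Phi> [uea_log (uea_word w)] (D_word w v))"
    have "tens_eval \<Phi> (log_coaction V exp_coaction v) = tens_eval (\<lambda>xs u. \<Phi> [uea_log (hd xs)] u) (exp_coaction v)"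
      by (rule log_coaction_eval[OF linear_exp_coaction v \<Phi>])
    also have "\<dots> = (\<Sum>n<M. ?t n)"
      using exp_coaction_eval[OF v multilin_tens_map_left[OF lin_uea_log \<Phi>] M] by simp
    also have "\<dots> = (\<Sum>n<M. if n = 1 then tens_eval \<Phi> (\<delta> v) else 0)"
    proof (intro sum.cong refl)
      fix n :: nat
      consider "n = 0" | "n = 1" | "n \<ge> 2" by linarith
      then show "?t n = (if n = 1 then tens_eval \<Phi> (\<delta> v) else 0)"
      proof cases
        case 1
        have "uea_log (1 :: 'g uea) = 0" using uea_log_power[of "0 :: 'g" 0] by simp
        then show ?thesis using 1 lin_zero[OF lin[OF v]] by simp
      next
        case 2
        then show ?thesis
          using coaction_expand[OF v \<Phi>] by (simp add: sum_words_Suc scaleC_one uea_log_embed)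
      next
        case 3
        then show ?thesis using sum_words_log[OF lin v 3] by simp
      qed
    qed
    also have "\<dots> = tens_eval \<Phi> (\<delta> v)" by (subst sum.delta) (auto simp: M_def)
    finally show "tens_eval \<Phi> (log_coaction V exp_coaction v) = tens_eval \<Phi> (\<delta> v)" .
  qed (use v log.coaction_closed coaction_closed in auto)
qed

end

context uea_comodule_basis
begin

sublocale log: lie_comodule_basis B V "log_coaction V \<rho>"
  by unfold_locales (rule lie_comodule_log locally_conilpotent_log)+

lemma exp_log: "log.exp_coaction = \<rho>"
proof (rule extensionalityI)
  show "log.exp_coaction \<in> extensional (carrier V)" by (rule log.exp.coaction_ext)
  show "\<rho> \<in> extensional (carrier V)" by (rule coaction_ext)
  fix v assume v: "v \<in> carrier V"
  show "log.exp_coaction v = \<rho> v"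
  proof (rule tens_eqI[of _ 1 V])
    fix \<Phi> :: "'g uea list \<Rightarrow> 'v \<Rightarrow> ('g uea list \<times> 'v \<Rightarrow>\<^sub>0 complex)" assume \<Phi>: "multilin 1 V \<Phi>"
    have lin: "lin (\<lambda>x. \<Phi> [x] u)" if "u \<in> carrier V" for u using \<Phi> that unfolding multilin_1_iff by blast
    have lin_on: "lin_on V (\<Phi> [x])" for x using \<Phi> unfolding multilin_1_iff by blast
    obtain N where N: "\<And>u M. N u \<le> M \<Longrightarrow>
        (\<Sum>n<M. inverse (fact n) *\<^sub>C (\<Sum>w\<in>words B n. conv_word w u *\<^sub>C uea_word w)) = u"
      using conv_exp_log by metis
    define M where "M = max (log.level v) (Max (N ` support (\<rho> v)))"
    have M: "log.killed M v" by (rule log.killed_mono[OF log.killed_level[OF v]]) (simp add: M_def)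
    have "tens_eval \<Phi> (log.exp_coaction v)
        = (\<Sum>n<M. inverse (fact n) *\<^sub>C (\<Sum>w\<in>words B n. \<Phi> [uea_word w] (log.D_word w v)))"
      by (rule log.exp_coaction_eval[OF v \<Phi> M])
    also have "\<dots> = tens_eval (\<lambda>xs u. \<Sum>n<M. inverse (fact n) *\<^sub>C
        (\<Sum>w\<in>words B n. conv_word w (hd xs) *\<^sub>C \<Phi> [uea_word w] u)) (\<rho> v)"
      by (simp add: tens_eval_sum tens_eval_scaleC log_D_word v act_eval[OF v lin_on])
    also have "\<dots> = tens_eval \<Phi> (\<rho> v)"
    proof (rule tens_eval_cong_support[OF cmodule coaction_closed[OF v]])
      fix x u assume x: "x \<in> support (\<rho> v)" and u: "u \<in> carrier V"
      have "N x \<le> M" using x finite_support[of "\<rho> v"] Max_ge[of "N ` support (\<rho> v)" "N x"]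
        by (simp add: M_def le_max_iff_disj)
      have "(\<Sum>n<M. inverse (fact n) *\<^sub>C (\<Sum>w\<in>words B n. conv_word w (hd [x]) *\<^sub>C \<Phi> [uea_word w] u))
          = \<Phi> [\<Sum>n<M. inverse (fact n) *\<^sub>C (\<Sum>w\<in>words B n. conv_word w x *\<^sub>C uea_word w)] u"
        by (simp add: lin_sum[OF lin[OF u]] lin_scaleC[OF lin[OF u]])
      then show "(\<Sum>n<M. inverse (fact n) *\<^sub>C (\<Sum>w\<in>words B n. conv_word w (hd [x]) *\<^sub>C \<Phi> [uea_word w] u)) = \<Phi> [x] u"
        by (simp only: N[OF \<open>N x \<le> M\<close>])
    qed
    finally show "tens_eval \<Phi> (log.exp_coaction v) = tens_eval \<Phi> (\<rho> v)" .
  qed (use v log.exp_coaction_closed coaction_closed in auto)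
qed

end

section \<open>The isomorphism of categories\<close>

lemma clinear_map_compose:
  "clinear_map U V f \<Longrightarrow> clinear_map V W g \<Longrightarrow> cmodule U \<Longrightarrow> clinear_map U W (compose (carrier U) g f)"
proof -
  assume f: "clinear_map U V f" and g: "clinear_map V W g" and U: "cmodule U"
  interpret Module.module "ring_of_type_algebra :: complex ring" U by (rule U)
  show ?thesis using f g by (auto simp: clinear_map_def compose_def Pi_iff)
qed

lemma colinear_mapsD:
  assumes "f \<in> colinear_maps (V, \<rho>) (W, \<sigma>)"
  shows "f \<in> extensional (carrier V)" "clinear_map V W f"
    "v \<in> carrier V \<Longrightarrow> \<sigma> (f v) = tens_map_right 1 W f (\<rho> v)"
  using assms by (auto simp: colinear_maps_def)

lemma colinear_maps_eval:
  assumes "linear_coaction (V, \<rho>)" and f: "f \<in> colinear_maps (V, \<rho>) (W, \<sigma>)"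
    and "v \<in> carrier V" "multilin 1 W \<Phi>"
  shows "tens_eval \<Phi> (\<sigma> (f v)) = tens_eval (\<lambda>xs u. \<Phi> xs (f u)) (\<rho> v)"
proof -
  interpret coaction V \<rho> by standard fact
  have "f \<in> carrier V \<rightarrow> carrier W" using colinear_mapsD(2)[OF f] by (simp add: clinear_map_def)
  then show ?thesis
    using tens_map_right_eval[OF cmodule coaction_closed _ assms(4)] assms(3) colinear_mapsD(3)[OF f]
    by (simp del: One_nat_def)
qed

text \<open>Colinearity can be tested by evaluating against multilinear maps.\<close>

lemma colinear_mapsI:
  fixes \<rho> :: "'v \<Rightarrow> ('a::complex_vector, 'v) tens" and f :: "'v \<Rightarrow> 'v"
  assumes "linear_coaction (V, \<rho>)" "linear_coaction (W, \<sigma>)" "f \<in> extensional (carrier V)"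
    and f: "clinear_map V W f"
    and eval: "\<And>v (\<Phi> :: 'a list \<Rightarrow> 'v \<Rightarrow> ('a list \<times> 'v \<Rightarrow>\<^sub>0 complex)). v \<in> carrier V \<Longrightarrow> multilin 1 W \<Phi> \<Longrightarrow>
      tens_eval \<Phi> (\<sigma> (f v)) = tens_eval (\<lambda>xs u. \<Phi> xs (f u)) (\<rho> v)"
  shows "f \<in> colinear_maps (V, \<rho>) (W, \<sigma>)"
proof -
  interpret V: coaction V \<rho> by standard fact
  interpret W: coaction W \<sigma> by standard fact
  have f': "f \<in> carrier V \<rightarrow> carrier W" using f by (simp add: clinear_map_def)
  have "\<sigma> (f v) = tens_map_right 1 W f (\<rho> v)" if v: "v \<in> carrier V" for v
  proof (rule tens_eqI[of _ 1 W])
    show "\<sigma> (f v) \<in> carrier (tens 1 W)" using f' v by (intro W.coaction_closed) auto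
    show "tens_map_right 1 W f (\<rho> v) \<in> carrier (tens 1 W)"
      by (rule tens_map_right_closed[OF V.cmodule V.coaction_closed[OF v] f'])
    fix \<Phi> :: "'a list \<Rightarrow> 'v \<Rightarrow> ('a list \<times> 'v \<Rightarrow>\<^sub>0 complex)" assume \<Phi>: "multilin 1 W \<Phi>"
    show "tens_eval \<Phi> (\<sigma> (f v)) = tens_eval \<Phi> (tens_map_right 1 W f (\<rho> v))"
      unfolding tens_map_right_eval[OF V.cmodule V.coaction_closed[OF v] f' \<Phi>] by (rule eval[OF v \<Phi>])
  qed
  then show ?thesis using assms(3) f by (simp add: colinear_maps_def)
qed

lemma colinear_maps_identity:
  fixes \<rho> :: "'v \<Rightarrow> ('a::complex_vector, 'v) tens"
  assumes "linear_coaction (V, \<rho>)"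
  shows "(\<lambda>v\<in>carrier V. v) \<in> colinear_maps (V, \<rho>) (V, \<rho>)"
proof (rule colinear_mapsI[OF assms assms])
  interpret coaction V \<rho> by standard fact
  show "clinear_map V V (\<lambda>v\<in>carrier V. v)" by (auto simp: clinear_map_def)
  fix v and \<Phi> :: "'a list \<Rightarrow> 'v \<Rightarrow> ('a list \<times> 'v \<Rightarrow>\<^sub>0 complex)" assume v: "v \<in> carrier V"
  have "tens_eval \<Phi> (\<rho> v) = tens_eval (\<lambda>xs u. \<Phi> xs ((\<lambda>v\<in>carrier V. v) u)) (\<rho> v)"
    by (rule tens_eval_cong[OF cmodule coaction_closed[OF v]]) simp
  then show "tens_eval \<Phi> (\<rho> ((\<lambda>v\<in>carrier V. v) v)) = tens_eval (\<lambda>xs u. \<Phi> xs ((\<lambda>v\<in>carrier V. v) u)) (\<rho> v)"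
    using v by simp
qed simp

lemma colinear_maps_compose:
  fixes \<rho> \<sigma> \<tau> :: "'v \<Rightarrow> ('a::complex_vector, 'v) tens"
  assumes L: "linear_coaction (U, \<tau>)" "linear_coaction (V, \<rho>)" "linear_coaction (W, \<sigma>)"
    and f: "f \<in> colinear_maps (U, \<tau>) (V, \<rho>)" and g: "g \<in> colinear_maps (V, \<rho>) (W, \<sigma>)"
  shows "compose (carrier U) g f \<in> colinear_maps (U, \<tau>) (W, \<sigma>)"
proof (rule colinear_mapsI[OF L(1,3)])
  interpret U: coaction U \<tau> by standard fact
  note f' = colinear_mapsD[OF f] and g' = colinear_mapsD[OF g]
  show "clinear_map U W (compose (carrier U) g f)" by (rule clinear_map_compose[OF f'(2) g'(2) U.cmodule])
  fix v and \<Phi> :: "'a list \<Rightarrow> 'v \<Rightarrow> ('a list \<times> 'v \<Rightarrow>\<^sub>0 complex)" assume v: "v \<in> carrier U" and \<Phi>: "multilin 1 W \<Phi>"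
  have fv: "f v \<in> carrier V" using f'(2) v by (auto simp: clinear_map_def)
  have "tens_eval \<Phi> (\<sigma> (g (f v))) = tens_eval (\<lambda>xs u. \<Phi> xs (g u)) (\<rho> (f v))"
    by (rule colinear_maps_eval[OF L(2) g fv \<Phi>])
  also have "\<dots> = tens_eval (\<lambda>xs u. \<Phi> xs (g (f u))) (\<tau> v)"
    by (rule colinear_maps_eval[OF L(1) f v multilin_map_right[OF g'(2) \<Phi>]])
  also have "\<dots> = tens_eval (\<lambda>xs u. \<Phi> xs (compose (carrier U) g f u)) (\<tau> v)"
    by (rule tens_eval_cong[OF U.cmodule U.coaction_closed[OF v]]) (simp add: compose_def)
  finally show "tens_eval \<Phi> (\<sigma> (compose (carrier U) g f v)) = tens_eval (\<lambda>xs u. \<Phi> xs (compose (carrier U) g f u)) (\<tau> v)"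
    using v by (simp add: compose_def)
qed (simp add: compose_def)

lemma category_colinear:
  assumes S: "\<And>M. M \<in> S \<Longrightarrow> linear_coaction M"
  shows "category (colinear_category S)"
proof -
  have carrier: "f v \<in> carrier (fst N)" if "f \<in> colinear_maps M N" "v \<in> carrier (fst M)" for f M N v
    using that colinear_mapsD(2)[of f "fst M" "snd M" "fst N" "snd N"] by (auto simp: clinear_map_def)
  have ext: "f \<in> extensional (carrier (fst M))" if "f \<in> colinear_maps M N" for f M N
    using that colinear_mapsD(1)[of f "fst M" "snd M" "fst N" "snd N"] by auto
  have L: "linear_coaction (fst M, snd M)" if "M \<in> S" for M using S[OF that] by simp
  show ?thesis
    unfolding category_def colinear_category_def cat.simps split_beta
  proof (intro conjI ballI)
    fix A assume "A \<in> S"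
    from colinear_maps_identity[OF L[OF this]] show "(\<lambda>v\<in>carrier (fst A). v) \<in> colinear_maps A A" by simp
  next
    fix A B E f g assume "A \<in> S" "B \<in> S" "E \<in> S" "f \<in> colinear_maps A B" "g \<in> colinear_maps B E"
    then show "compose (carrier (fst A)) g f \<in> colinear_maps A E"
      using colinear_maps_compose[OF L L L, of A B E f g] by simp
  next
    fix A B f assume f: "f \<in> colinear_maps A B"
    show "compose (carrier (fst A)) f (\<lambda>v\<in>carrier (fst A). v) = f"
      by (rule extensionalityI[OF compose_extensional ext[OF f]]) (simp add: compose_def)
    show "compose (carrier (fst A)) (\<lambda>v\<in>carrier (fst B). v) f = f"
      by (rule extensionalityI[OF compose_extensional ext[OF f]]) (simp add: compose_def carrier[OF f])
  next
    fix W A B E f g h assume f: "f \<in> colinear_maps W A"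
    show "compose (carrier (fst W)) h (compose (carrier (fst W)) g f)
      = compose (carrier (fst W)) (compose (carrier (fst A)) h g) f"
      by (rule extensionalityI[OF compose_extensional compose_extensional]) (simp add: compose_def carrier[OF f])
  qed
qed

text \<open>Mutually inverse constructions on coactions that keep the vector space, and for which colinear maps
stay colinear, give an isomorphism of categories that is the identity on maps.\<close>

lemma isomorphic_colinear_categories:
  fixes S :: "('a::complex_vector, 'v) coacted set" and T :: "('b::complex_vector, 'v) coacted set"
  assumes S: "\<And>V \<rho>. (V, \<rho>) \<in> S \<Longrightarrow> linear_coaction (V, \<rho>)"
    and T: "\<And>V \<delta>. (V, \<delta>) \<in> T \<Longrightarrow> linear_coaction (V, \<delta>)"
    and ST: "\<And>V \<rho>. (V, \<rho>) \<in> S \<Longrightarrow> (V, F V \<rho>) \<in> T" "\<And>V \<rho>. (V, \<rho>) \<in> S \<Longrightarrow> G V (F V \<rho>) = \<rho>"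
    and TS: "\<And>V \<delta>. (V, \<delta>) \<in> T \<Longrightarrow> (V, G V \<delta>) \<in> S" "\<And>V \<delta>. (V, \<delta>) \<in> T \<Longrightarrow> F V (G V \<delta>) = \<delta>"
    and F: "\<And>V \<rho> W \<sigma> f. (V, \<rho>) \<in> S \<Longrightarrow> (W, \<sigma>) \<in> S \<Longrightarrow> f \<in> colinear_maps (V, \<rho>) (W, \<sigma>) \<Longrightarrow>
      f \<in> colinear_maps (V, F V \<rho>) (W, F W \<sigma>)"
    and G: "\<And>V \<rho> W \<sigma> f. (V, \<rho>) \<in> T \<Longrightarrow> (W, \<sigma>) \<in> T \<Longrightarrow> f \<in> colinear_maps (V, \<rho>) (W, \<sigma>) \<Longrightarrow>
      f \<in> colinear_maps (V, G V \<rho>) (W, G W \<sigma>)"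
  shows "isomorphic_categories (colinear_category S) (colinear_category T)"
  unfolding isomorphic_categories_def
proof (intro conjI exI)
  show "category (colinear_category S)" "category (colinear_category T)"
    using S T by (auto intro!: category_colinear)
  let ?F = "\<lparr>on_obj = (\<lambda>(V, \<rho>). (V, F V \<rho>)), on_hom = (\<lambda>_ _ f. f)\<rparr>"
  let ?G = "\<lparr>on_obj = (\<lambda>(V, \<rho>). (V, G V \<rho>)), on_hom = (\<lambda>_ _ f. f)\<rparr>"
  show "is_functor (colinear_category S) (colinear_category T) ?F"
    using ST(1) F by (auto simp: is_functor_def colinear_category_def)
  show "is_functor (colinear_category T) (colinear_category S) ?G"
    using TS(1) G by (auto simp: is_functor_def colinear_category_def)
  show "left_inverse_functor (colinear_category S) ?F ?G"
    using ST by (auto simp: left_inverse_functor_def colinear_category_def)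
  show "left_inverse_functor (colinear_category T) ?G ?F"
    using TS by (auto simp: left_inverse_functor_def colinear_category_def)
qed

lemma colinear_maps_log:
  fixes \<rho> \<sigma> :: "'v \<Rightarrow> ('g::complex_lie_algebra uea, 'v) tens"
  assumes L: "linear_coaction (V, \<rho>)" "linear_coaction (W, \<sigma>)" and f: "f \<in> colinear_maps (V, \<rho>) (W, \<sigma>)"
  shows "f \<in> colinear_maps (V, log_coaction V \<rho>) (W, log_coaction W \<sigma>)"
proof (rule colinear_mapsI[OF L[THEN linear_log_coaction]])
  note f' = colinear_mapsD[OF f]
  show "f \<in> extensional (carrier V)" "clinear_map V W f" by (rule f')+
  fix v and \<Phi> :: "'g list \<Rightarrow> 'v \<Rightarrow> ('g list \<times> 'v \<Rightarrow>\<^sub>0 complex)" assume v: "v \<in> carrier V" and \<Phi>: "multilin 1 W \<Phi>"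
  have fv: "f v \<in> carrier W" using f'(2) v by (auto simp: clinear_map_def)
  have "tens_eval \<Phi> (log_coaction W \<sigma> (f v)) = tens_eval (\<lambda>xs u. \<Phi> [uea_log (hd xs)] u) (\<sigma> (f v))"
    by (rule log_coaction_eval[OF L(2) fv \<Phi>])
  also have "\<dots> = tens_eval (\<lambda>xs u. \<Phi> [uea_log (hd xs)] (f u)) (\<rho> v)"
    by (rule colinear_maps_eval[OF L(1) f v multilin_tens_map_left[OF lin_uea_log \<Phi>]])
  also have "\<dots> = tens_eval (\<lambda>xs u. \<Phi> xs (f u)) (log_coaction V \<rho> v)"
    by (rule log_coaction_eval[OF L(1) v multilin_map_right[OF f'(2) \<Phi>], symmetric])
  finally show "tens_eval \<Phi> (log_coaction W \<sigma> (f v)) = tens_eval (\<lambda>xs u. \<Phi> xs (f u)) (log_coaction V \<rho> v)" .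
qed

text \<open>A colinear map commutes with the components of the coactions, hence with all words in them.\<close>

lemma colinear_maps_exp:
  fixes \<delta> \<epsilon> :: "'v \<Rightarrow> ('g::complex_lie_algebra, 'v) tens"
  assumes "lie_comodule_basis B V \<delta>" "lie_comodule_basis B W \<epsilon>"
    and f: "f \<in> colinear_maps (V, \<delta>) (W, \<epsilon>)"
  shows "f \<in> colinear_maps (V, lie_coaction.exp_coaction B V \<delta>) (W, lie_coaction.exp_coaction B W \<epsilon>)"
proof -
  interpret V: lie_comodule_basis B V \<delta> by fact
  interpret W: lie_comodule_basis B W \<epsilon> by fact
  note f' = colinear_mapsD[OF f]
  have closed: "f v \<in> carrier W" if "v \<in> carrier V" for v using f'(2) that by (auto simp: clinear_map_def)
  have D: "W.D b (f v) = f (V.D b v)" if v: "v \<in> carrier V" for b v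
  proof (rule cmodule_eqI[OF W.cmodule])
    fix l :: "'v \<Rightarrow> 'v \<Rightarrow>\<^sub>0 complex" assume l: "lin_on W l"
    have "l (W.D b (f v)) = tens_eval (\<lambda>xs u. V.coord b (hd xs) *\<^sub>C l u) (\<epsilon> (f v))"
      by (simp add: W.D_def closed v W.act_eval[OF _ l])
    also have "\<dots> = tens_eval (\<lambda>xs u. V.coord b (hd xs) *\<^sub>C l (f u)) (\<delta> v)"
      by (rule colinear_maps_eval[OF V.linear_coaction f v multilin_contract[OF V.lin_coord l]])
    also have "\<dots> = l (f (V.D b v))"
      by (simp add: V.D_def v V.act_eval[OF v lin_on_comp[OF f'(2) l]])
    finally show "l (W.D b (f v)) = l (f (V.D b v))" .
  qed (use v in \<open>simp_all add: W.D_closed closed V.D_closed\<close>)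
  have D_word: "W.D_word w (f v) = f (V.D_word w v)" if "v \<in> carrier V" for w v
    using that by (induction w arbitrary: v) (simp_all add: D V.D_closed)
  show ?thesis
  proof (rule colinear_mapsI[OF V.linear_exp_coaction W.linear_exp_coaction f'(1,2)])
    fix v and \<Phi> :: "'g uea list \<Rightarrow> 'v \<Rightarrow> ('g uea list \<times> 'v \<Rightarrow>\<^sub>0 complex)"
    assume v: "v \<in> carrier V" and \<Phi>: "multilin 1 W \<Phi>"
    define M where "M = max (V.level v) (W.level (f v))"
    have M: "V.killed M v" "W.killed M (f v)"
      using V.killed_mono[OF V.killed_level[OF v]] W.killed_mono[OF W.killed_level[OF closed[OF v]]]
      by (simp_all add: M_def)
    show "tens_eval \<Phi> (W.exp_coaction (f v)) = tens_eval (\<lambda>xs u. \<Phi> xs (f u)) (V.exp_coaction v)"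
      by (simp only: W.exp_coaction_eval[OF closed[OF v] \<Phi> M(2)] D_word[OF v]
          V.exp_coaction_eval[OF v multilin_map_right[OF f'(2) \<Phi>] M(1)])
  qed
qed

theorem proposition5p8:
  assumes "\<exists>Basis :: 'g::complex_lie_algebra set. finite_dimensional_vector_space scaleC Basis"
  shows "isomorphic_categories
           (uea_comodules :: (('g uea, 'v) coacted, 'v \<Rightarrow> 'v) cat)
           (conilpotent_lie_comodules :: (('g, 'v) coacted, 'v \<Rightarrow> 'v) cat)"
proof -
  obtain B :: "'g set" where "finite_dimensional_vector_space scaleC B" using assms by blast
  then interpret finite_dimensional_vector_space "scaleC :: complex \<Rightarrow> 'g \<Rightarrow> 'g" B .
  interpret lie_basis B
    using finite_Basis independent_Basis span_Basis by unfold_locales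
  have U: "uea_comodule_basis B V \<rho>" if "coalgebra_comodule uea_comult uea_counit (V, \<rho>)"
    for V :: "'v cspace" and \<rho> :: "'v \<Rightarrow> ('g uea, 'v) tens"
    using that by unfold_locales (auto simp: coalgebra_comodule_def)
  have L: "lie_comodule_basis B V \<delta>" if "lie_comodule (V, \<delta>)" "locally_conilpotent (V, \<delta>)"
    for V :: "'v cspace" and \<delta> :: "'v \<Rightarrow> ('g, 'v) tens"
    using that by unfold_locales (auto simp: lie_comodule_def)
  show ?thesis
    unfolding uea_comodules_def conilpotent_lie_comodules_def
  proof (rule isomorphic_colinear_categories[where F = log_coaction and G = "lie_coaction.exp_coaction B"], goal_cases)
    case (1 V \<rho>) then show ?case by (simp add: coalgebra_comodule_def)
  next
    case (2 V \<delta>) then show ?case by (simp add: lie_comodule_def)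
  next
    case (3 V \<rho>)
    then interpret uea_comodule_basis B V \<rho> by (intro U) simp
    show ?case by (simp add: lie_comodule_log locally_conilpotent_log)
  next
    case (4 V \<rho>)
    then interpret uea_comodule_basis B V \<rho> by (intro U) simp
    show ?case by (rule exp_log)
  next
    case (5 V \<delta>)
    then interpret lie_comodule_basis B V \<delta> by (intro L) simp_all
    show ?case by (simp add: exp_coaction_comodule)
  next
    case (6 V \<delta>)
    then interpret lie_comodule_basis B V \<delta> by (intro L) simp_all
    show ?case by (rule log_exp)
  next
    case (7 V \<rho> W \<sigma> f)
    then show ?case by (intro colinear_maps_log) (simp_all add: coalgebra_comodule_def)
  next
    case (8 V \<rho> W \<sigma> f)
    then show ?case by (intro colinear_maps_exp L) simp_all
  qed
qed

end
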